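(* Let $\mathcal R=\{(r_m,\rho_m)\}_{m\ge1}\in\mathcal{MP}^{\mathbb N}$ and set $R_*=\prod_{m=1}^\infty(1-\rho_m)$. Define $$\eta_m=\frac{r_1\cdots r_{m-1}\rho_m}{1-R_*}\quad(m\ge1),\qquad\eta=\{\eta_m\}_{m\ge1}.$$ (1) If $\sum_{m=1}^\infty\rho_m=\infty$, then $R_*=0$, $\mathcal F_{\mathcal R}=\mathcal F_\eta$ and $\mathcal E_{\mathcal R}(u,v)=\mathcal D^I_\eta(u,v)$ for any $u,v\in\mathcal F_{\mathcal R}$. (2) If $\sum_{m=1}^\infty\rho_m<\infty$, then $R_*\in(0,1)$, $\mathcal F_{\mathcal R}=\mathcal F^*_\eta$ and $$\mathcal E_{\mathcal R}(u,v)=\frac1{R_*}\mathcal E^*(u,v)+\frac1{1-R_*}\mathcal D^I_\eta(u,v)$$ for any $u,v\in\mathcal F_{\mathcal R}$.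
   Context: **Geometry.** Let $S=\{1,2,3\}$, $B=\{(1,2),(2,3),(3,1)\}$, and let $p_1,p_2,p_3\in\mathbb{R}^2$ be the vertices of a regular triangle with side length $1$ and $p_1+p_2+p_3=0$. Fix $\alpha\in(0,1)$. Put $G_i(x)=\frac{1-\alpha}{2}(x-p_i)+p_i$, $p_{ij}=G_i(p_j)$ for $i\ne j$, and let $e_{ij}$ be the line segment from $p_{ij}$ to $p_{ji}$. Let $W_0=\{\emptyset\}$, $W_m=S^m$, $W_*=\bigcup_{m\ge0}W_m$; $G_w=G_{w_1}\circ\cdots\circ G_{w_m}$, $G_\emptyset=\mathrm{id}$, $e^w_{ij}=G_w(e_{ij})$. The stretched Sierpinski gasket $K$ is the unique compact set with $K=\bigcup_{i\in S}G_i(K)\cup e_{12}\cup e_{23}\cup e_{31}$, and $\Sigma$ is the unique nonempty compact set with $\Sigma=\bigcup_iG_i(\Sigma)$; $K=\Sigma\cup\bigcup_{(w,(i,j))\in W_*\times B}e^w_{ij}$. $\Sigma$ is identified with $S^{\mathbb N}$ via $\omega_1\omega_2\ldots\mapsto\bigcap_mG_{\omega_1\dots\omega_m}(\Sigma)$. **Dirichlet integrals.** For a segment $pq$ with $\xi_{p,q}(t)=(1-t)p+tq$, $H^1(pq)=\{u\mid u\circ\xi_{p,q}\in H^1([0,1])\}$ and $\mathcal D_{pq}(u,v)=\int_0^1(u\circ\xi_{p,q})'(v\circ\xi_{p,q})'dx$. $\widetilde{\mathcal F}=\{u\in C(K)\mid u|_{e^w_{ij}}\in H^1(e^w_{ij})\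 \forall(w,(i,j))\in W_*\times B\}$; $\mathcal D^I_m(u,v)=\sum_{(w,(i,j))\in W_{m-1}\times B}\mathcal D_{e^w_{ij}}(u,v)$ for $m\ge1$. **Sierpinski gasket.** Let $F_i(x)=\frac12(x-p_i)+p_i$, $F_w=F_{w_1}\circ\cdots\circ F_{w_m}$, $K_*$ the nonempty compact set with $K_*=\bigcup_iF_i(K_* )$. Let $\pi:\Sigma\to K_*$, $\{\pi(\omega_1\omega_2\ldots)\}=\bigcap_mF_{\omega_1\dots\omega_m}(K_* )$, and let $\pi_*:K\to K_*$ equal $\pi$ on $\Sigma$ and the constant $\pi(wijjj\ldots)=\pi(wjiii\ldots)$ on $e^w_{ij}$. $C(K_* )$ is regarded as a subset of $C(K)$ by identifying $u$ with $u\circ\pi_*$. Let $Q_0(u,u)=\sum_{(i,j)\in B}(u(p_i)-u(p_j))^2$. $\mathcal F^*$ is the set of $u\in C(K_* )$ for which the (non-decreasing) sequence $(5/3)^m\sum_{w\in W_m}Q_0(u\circ F_w,u\circ F_w)$ is bounded; via the identification $\mathcal F^*\subseteq C(K)$. **The forms $\mathcal E^*$, $\mathcal D^I_\eta$ and domains.** $Q^\Sigma_m(u,u)=\sum_{w\in W_m}Q_0(u\circ G_w,u\circ G_w)$. $\mathcal F^\Sigma$ is the set of $u\in C(K)$ such that $\{(5/3)^mQ_m^\Sigma(u,u)\}_m$ is Cauchy, and $\mathcal E^*(u,u)=\lim_m(5/3)^mQ^\Sigma_m(u,u)$ for $u\in\mathcal F^\Sigma$ ($\mathcal E^*(u,v)$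 by polarization). For $m\ge1$: $\widetilde{\mathcal F}_m=\{u\in\widetilde{\mathcal F}\mid u|_{G_w(K)}\text{ constant }\forall w\in W_m\}$, $\widetilde{\mathcal F}_\infty=\bigcup_{m\ge1}\widetilde{\mathcal F}_m$, $\mathcal F^*_m=\{u\in\widetilde{\mathcal F}\mid u\circ G_w\in\mathcal F^*\ \forall w\in W_m\}$, $\mathcal F^*_\infty=\bigcup_{m\ge1}\mathcal F_m^*$. For a positive sequence $\eta$, $\mathcal D^I_\eta(u,u)=\sum_{m\ge1}\frac1{\eta_m}\mathcal D^I_m(u,u)\in[0,\infty]$ for $u\in\widetilde{\mathcal F}$ ($\mathcal D^I_\eta(u,v)$ by polarization when finite). - $\mathcal F_\eta$ is the set of $u\in\widetilde{\mathcal F}$ with $\mathcal D^I_\eta(u,u)<\infty$ for which there is $\{u_n\}\subseteq\widetilde{\mathcal F}_\infty$ with $\mathcal D^I_\eta(u-u_n,u-u_n)\to0$ and $u_n(x)\to u(x)$ for every $x\in K$. - $\mathcal F_\eta^*$ is the set of $u\in\widetilde{\mathcal F}\cap\mathcal F^\Sigma$ with $\mathcal D^I_\eta(u,u)<\infty$ for which there is $\{u_n\}\subseteq\mathcal F^*_\infty$ with $\mathcal E^*(u-u_n,u-u_n)\to0$, $\mathcal D^I_\eta(u-u_n,u-u_n)\to0$ and $u_n(x)\to u(x)$ for every $x\in K$. **Matching pairs.** $\mathcal{MP}=\{(r,\rho)\in(0,\infty)^2\mid\frac53r+\rho=1\}$; $\mathcal{MP}^{\mathbb N}$ is the set of sequences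 in $\mathcal{MP}$. For $\mathcal R=\{(r_m,\rho_m)\}_{m\ge1}\in\mathcal{MP}^{\mathbb N}$ put $\delta_0=1$, $\delta_m=r_1\cdots r_m$, $\gamma_m=\delta_{m-1}\rho_m$, and $\mathcal E_{\mathcal R,m}(u,v)=\frac1{\delta_m}Q^\Sigma_m(u,v)+\sum_{k=1}^m\frac1{\gamma_k}\mathcal D^I_k(u,v)$ for $u,v\in\widetilde{\mathcal F}$. The sequence $\mathcal E_{\mathcal R,m}(u,u)$ is non-decreasing in $m$; $\mathcal F_{\mathcal R}=\{u\in\widetilde{\mathcal F}\mid\lim_m\mathcal E_{\mathcal R,m}(u,u)<\infty\}$ and $\mathcal E_{\mathcal R}(u,v)=\lim_m\mathcal E_{\mathcal R,m}(u,v)$ on $\mathcal F_{\mathcal R}$. *)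

theory Defs
  imports "HOL-Analysis.Analysis"
begin

text \<open>
  The triangle \<open>p\<close> is a function on \<open>nat\<close> of which only \<open>p 1\<close>, \<open>p 2\<close>, \<open>p 3\<close> are used.
  Functions on \<open>K\<close> are total functions on the plane; every definition below depends only on their
  values on \<open>K\<close>, so two functions that agree on \<open>K\<close> are never distinguished.
  Finite words are lists; infinite words \<open>\<omega>\<^sub>1\<omega>\<^sub>2\<dots>\<close> are functions on \<open>nat\<close>, indexed from 0.
  Sequences such as \<open>\<eta>\<close> and \<open>\<R>\<close> are indexed from 1 and their value at 0 is ignored.
\<close>

type_synonym plane = "real^2"

section \<open>Geometry\<close>

definition idx :: "nat set" where
  "idx = {1, 2, 3}"

definition edges :: "(nat \<times> nat) set" where
  "edges = {(1, 2), (2, 3), (3, 1)}"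

definition regular_triangle :: "(nat \<Rightarrow> plane) \<Rightarrow> bool" where
  "regular_triangle p \<longleftrightarrow>
     (\<forall>i\<in>idx. \<forall>j\<in>idx. i \<noteq> j \<longrightarrow> dist (p i) (p j) = 1) \<and> p 1 + p 2 + p 3 = 0"

definition words :: "nat \<Rightarrow> nat list set" where
  "words m = {w. set w \<subseteq> idx \<and> length w = m}"

definition words_fin :: "nat list set" where
  "words_fin = (\<Union>m. words m)"

definition words_inf :: "(nat \<Rightarrow> nat) set" where
  "words_inf = {\<omega>. range \<omega> \<subseteq> idx}"

primrec comp_word :: "(nat \<Rightarrow> 'a \<Rightarrow> 'a) \<Rightarrow> nat list \<Rightarrow> 'a \<Rightarrow> 'a" where
  "comp_word f [] = id"
| "comp_word f (i # w) = f i \<circ> comp_word f w"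

definition G :: "(nat \<Rightarrow> plane) \<Rightarrow> real \<Rightarrow> nat \<Rightarrow> plane \<Rightarrow> plane" where
  "G p \<alpha> i x = ((1 - \<alpha>) / 2) *\<^sub>R (x - p i) + p i"

abbreviation Gw :: "(nat \<Rightarrow> plane) \<Rightarrow> real \<Rightarrow> nat list \<Rightarrow> plane \<Rightarrow> plane" where
  "Gw p \<alpha> \<equiv> comp_word (G p \<alpha>)"

definition pp :: "(nat \<Rightarrow> plane) \<Rightarrow> real \<Rightarrow> nat \<Rightarrow> nat \<Rightarrow> plane" where
  "pp p \<alpha> i j = G p \<alpha> i (p j)"

definition seg :: "(nat \<Rightarrow> plane) \<Rightarrow> real \<Rightarrow> nat \<Rightarrow> nat \<Rightarrow> plane set" where
  "seg p \<alpha> i j = closed_segment (pp p \<alpha> i j) (pp p \<alpha> j i)"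

definition segw :: "(nat \<Rightarrow> plane) \<Rightarrow> real \<Rightarrow> nat list \<Rightarrow> nat \<Rightarrow> nat \<Rightarrow> plane set" where
  "segw p \<alpha> w i j = Gw p \<alpha> w ` seg p \<alpha> i j"

definition ssg_K :: "(nat \<Rightarrow> plane) \<Rightarrow> real \<Rightarrow> plane set" where
  "ssg_K p \<alpha> = (THE K. compact K \<and>
     K = (\<Union>i\<in>idx. G p \<alpha> i ` K) \<union> (seg p \<alpha> 1 2 \<union> seg p \<alpha> 2 3 \<union> seg p \<alpha> 3 1))"

definition ssg_Sigma :: "(nat \<Rightarrow> plane) \<Rightarrow> real \<Rightarrow> plane set" where
  "ssg_Sigma p \<alpha> = (THE A. compact A \<and> A \<noteq> {} \<and> A = (\<Union>i\<in>idx. G p \<alpha> i ` A))"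

section \<open>Sobolev space and Dirichlet integrals\<close>

definition L2_unit :: "(real \<Rightarrow> real) \<Rightarrow> bool" where
  "L2_unit f \<longleftrightarrow> set_borel_measurable lborel {0..1} f \<and>
     set_integrable lborel {0..1} (\<lambda>t. (f t)\<^sup>2)"

text \<open>Weak derivatives on the unit interval are tested against compactly supported \<open>C\<^sup>1\<close>
  functions on the open interval, as in Brezis' textbook.\<close>

definition test_fun :: "(real \<Rightarrow> real) \<Rightarrow> (real \<Rightarrow> real) \<Rightarrow> bool" where
  "test_fun \<phi> \<phi>' \<longleftrightarrow> (\<forall>t. (\<phi> has_real_derivative \<phi>' t) (at t)) \<and> continuous_on UNIV \<phi>' \<and>
     closure {t. \<phi> t \<noteq> 0} \<subseteq> {0<..<1}"

definition weak_deriv :: "(real \<Rightarrow> real) \<Rightarrow> (real \<Rightarrow> real) \<Rightarrow> bool" where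
  "weak_deriv f g \<longleftrightarrow> (\<forall>\<phi> \<phi>'. test_fun \<phi> \<phi>' \<longrightarrow>
     (LINT t:{0..1}|lborel. f t * \<phi>' t) = - (LINT t:{0..1}|lborel. g t * \<phi> t))"

definition H1_unit :: "(real \<Rightarrow> real) set" where
  "H1_unit = {f. L2_unit f \<and> (\<exists>g. L2_unit g \<and> weak_deriv f g)}"

text \<open>The weak derivative is unique only up to null sets; any representative is chosen.\<close>

definition wderiv :: "(real \<Rightarrow> real) \<Rightarrow> real \<Rightarrow> real" where
  "wderiv f = (SOME g. L2_unit g \<and> weak_deriv f g)"

definition H1_seg :: "plane \<Rightarrow> plane \<Rightarrow> (plane \<Rightarrow> real) set" where
  "H1_seg a b = {u. u \<circ> linepath a b \<in> H1_unit}"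

definition dirichlet :: "plane \<Rightarrow> plane \<Rightarrow> (plane \<Rightarrow> real) \<Rightarrow> (plane \<Rightarrow> real) \<Rightarrow> real" where
  "dirichlet a b u v =
     (LINT t:{0..1}|lborel. wderiv (u \<circ> linepath a b) t * wderiv (v \<circ> linepath a b) t)"

definition F_tilde :: "(nat \<Rightarrow> plane) \<Rightarrow> real \<Rightarrow> (plane \<Rightarrow> real) set" where
  "F_tilde p \<alpha> = {u. continuous_on (ssg_K p \<alpha>) u \<and>
     (\<forall>w\<in>words_fin. \<forall>(i, j)\<in>edges.
        u \<in> H1_seg (Gw p \<alpha> w (pp p \<alpha> i j)) (Gw p \<alpha> w (pp p \<alpha> j i)))}"

text \<open>\<open>DI p \<alpha> m\<close> is \<open>\<D>\<^sup>I\<^sub>m\<close>; it is meaningful for \<open>m \<ge> 1\<close> only.\<close>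

definition DI :: "(nat \<Rightarrow> plane) \<Rightarrow> real \<Rightarrow> nat \<Rightarrow> (plane \<Rightarrow> real) \<Rightarrow> (plane \<Rightarrow> real) \<Rightarrow> real" where
  "DI p \<alpha> m u v = (\<Sum>(w, (i, j)) \<in> words (m - 1) \<times> edges.
     dirichlet (Gw p \<alpha> w (pp p \<alpha> i j)) (Gw p \<alpha> w (pp p \<alpha> j i)) u v)"

section \<open>Sierpinski gasket\<close>

definition F :: "(nat \<Rightarrow> plane) \<Rightarrow> nat \<Rightarrow> plane \<Rightarrow> plane" where
  "F p i x = (1 / 2) *\<^sub>R (x - p i) + p i"

abbreviation Fw :: "(nat \<Rightarrow> plane) \<Rightarrow> nat list \<Rightarrow> plane \<Rightarrow> plane" where
  "Fw p \<equiv> comp_word (F p)"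

definition sg_K :: "(nat \<Rightarrow> plane) \<Rightarrow> plane set" where
  "sg_K p = (THE A. compact A \<and> A \<noteq> {} \<and> A = (\<Union>i\<in>idx. F p i ` A))"

definition sigma_pt :: "(nat \<Rightarrow> plane) \<Rightarrow> real \<Rightarrow> (nat \<Rightarrow> nat) \<Rightarrow> plane" where
  "sigma_pt p \<alpha> \<omega> = the_elem (\<Inter>m. Gw p \<alpha> (map \<omega> [0..<m]) ` ssg_Sigma p \<alpha>)"

definition sg_pt :: "(nat \<Rightarrow> plane) \<Rightarrow> (nat \<Rightarrow> nat) \<Rightarrow> plane" where
  "sg_pt p \<omega> = the_elem (\<Inter>m. Fw p (map \<omega> [0..<m]) ` sg_K p)"

definition pi_map :: "(nat \<Rightarrow> plane) \<Rightarrow> real \<Rightarrow> plane \<Rightarrow> plane" where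
  "pi_map p \<alpha> x = sg_pt p (inv_into words_inf (sigma_pt p \<alpha>) x)"

text \<open>\<open>ev_const w j\<close> is the infinite word \<open>w j j j \<dots>\<close>.\<close>

definition ev_const :: "nat list \<Rightarrow> nat \<Rightarrow> nat \<Rightarrow> nat" where
  "ev_const w j n = (if n < length w then w ! n else j)"

definition pi_star :: "(nat \<Rightarrow> plane) \<Rightarrow> real \<Rightarrow> plane \<Rightarrow> plane" where
  "pi_star p \<alpha> x =
     (if x \<in> ssg_Sigma p \<alpha> then pi_map p \<alpha> x
      else THE y. \<exists>w\<in>words_fin. \<exists>(i, j)\<in>edges.
             x \<in> segw p \<alpha> w i j \<and> y = sg_pt p (ev_const (w @ [i]) j))"

definition Q0 :: "(nat \<Rightarrow> plane) \<Rightarrow> (plane \<Rightarrow> real) \<Rightarrow> (plane \<Rightarrow> real) \<Rightarrow> real" where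
  "Q0 p u v = (\<Sum>(i, j)\<in>edges. (u (p i) - u (p j)) * (v (p i) - v (p j)))"

text \<open>\<open>F_star p\<close> is \<open>\<F>\<^sup>*\<close> as a set of functions on the Sierpinski gasket, \<open>F_star_K p \<alpha>\<close> is its
  image under the identification of \<open>f\<close> with \<open>f \<circ> \<pi>\<^sub>*\<close>.\<close>

definition F_star :: "(nat \<Rightarrow> plane) \<Rightarrow> (plane \<Rightarrow> real) set" where
  "F_star p = {f. continuous_on (sg_K p) f \<and>
     bdd_above (range (\<lambda>m. (5/3)^m * (\<Sum>w\<in>words m. Q0 p (f \<circ> Fw p w) (f \<circ> Fw p w))))}"

definition F_star_K :: "(nat \<Rightarrow> plane) \<Rightarrow> real \<Rightarrow> (plane \<Rightarrow> real) set" where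
  "F_star_K p \<alpha> = {u. \<exists>f\<in>F_star p. \<forall>x\<in>ssg_K p \<alpha>. u x = f (pi_star p \<alpha> x)}"

section \<open>The limit forms and their domains\<close>

definition Q_Sigma :: "(nat \<Rightarrow> plane) \<Rightarrow> real \<Rightarrow> nat \<Rightarrow> (plane \<Rightarrow> real) \<Rightarrow> (plane \<Rightarrow> real) \<Rightarrow> real" where
  "Q_Sigma p \<alpha> m u v = (\<Sum>w\<in>words m. Q0 p (u \<circ> Gw p \<alpha> w) (v \<circ> Gw p \<alpha> w))"

definition F_Sigma :: "(nat \<Rightarrow> plane) \<Rightarrow> real \<Rightarrow> (plane \<Rightarrow> real) set" where
  "F_Sigma p \<alpha> = {u. continuous_on (ssg_K p \<alpha>) u \<and> Cauchy (\<lambda>m. (5/3)^m * Q_Sigma p \<alpha> m u u)}"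

definition E_star_quad :: "(nat \<Rightarrow> plane) \<Rightarrow> real \<Rightarrow> (plane \<Rightarrow> real) \<Rightarrow> real" where
  "E_star_quad p \<alpha> u = lim (\<lambda>m. (5/3)^m * Q_Sigma p \<alpha> m u u)"

definition E_star :: "(nat \<Rightarrow> plane) \<Rightarrow> real \<Rightarrow> (plane \<Rightarrow> real) \<Rightarrow> (plane \<Rightarrow> real) \<Rightarrow> real" where
  "E_star p \<alpha> u v =
     (E_star_quad p \<alpha> (\<lambda>x. u x + v x) - E_star_quad p \<alpha> (\<lambda>x. u x - v x)) / 4"

definition F_tilde_m :: "(nat \<Rightarrow> plane) \<Rightarrow> real \<Rightarrow> nat \<Rightarrow> (plane \<Rightarrow> real) set" where
  "F_tilde_m p \<alpha> m =
     {u \<in> F_tilde p \<alpha>. \<forall>w\<in>words m. u constant_on (Gw p \<alpha> w ` ssg_K p \<alpha>)}"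

definition F_tilde_inf :: "(nat \<Rightarrow> plane) \<Rightarrow> real \<Rightarrow> (plane \<Rightarrow> real) set" where
  "F_tilde_inf p \<alpha> = (\<Union>m\<in>{1..}. F_tilde_m p \<alpha> m)"

definition F_star_m :: "(nat \<Rightarrow> plane) \<Rightarrow> real \<Rightarrow> nat \<Rightarrow> (plane \<Rightarrow> real) set" where
  "F_star_m p \<alpha> m = {u \<in> F_tilde p \<alpha>. \<forall>w\<in>words m. u \<circ> Gw p \<alpha> w \<in> F_star_K p \<alpha>}"

definition F_star_inf :: "(nat \<Rightarrow> plane) \<Rightarrow> real \<Rightarrow> (plane \<Rightarrow> real) set" where
  "F_star_inf p \<alpha> = (\<Union>m\<in>{1..}. F_star_m p \<alpha> m)"

text \<open>\<open>DI_eta_quad p \<alpha> \<eta> u\<close> is \<open>\<D>\<^sup>I\<^sub>\<eta>(u, u)\<close>, with values in \<open>[0, \<infinity>]\<close>; the sum starts at level 1.\<close>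

definition DI_eta_quad :: "(nat \<Rightarrow> plane) \<Rightarrow> real \<Rightarrow> (nat \<Rightarrow> real) \<Rightarrow> (plane \<Rightarrow> real) \<Rightarrow> ennreal" where
  "DI_eta_quad p \<alpha> \<eta> u = (\<Sum>m. ennreal (1 / \<eta> (Suc m) * DI p \<alpha> (Suc m) u u))"

definition DI_eta ::
  "(nat \<Rightarrow> plane) \<Rightarrow> real \<Rightarrow> (nat \<Rightarrow> real) \<Rightarrow> (plane \<Rightarrow> real) \<Rightarrow> (plane \<Rightarrow> real) \<Rightarrow> real" where
  "DI_eta p \<alpha> \<eta> u v =
     (enn2real (DI_eta_quad p \<alpha> \<eta> (\<lambda>x. u x + v x)) -
      enn2real (DI_eta_quad p \<alpha> \<eta> (\<lambda>x. u x - v x))) / 4"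

definition F_eta :: "(nat \<Rightarrow> plane) \<Rightarrow> real \<Rightarrow> (nat \<Rightarrow> real) \<Rightarrow> (plane \<Rightarrow> real) set" where
  "F_eta p \<alpha> \<eta> = {u \<in> F_tilde p \<alpha>. DI_eta_quad p \<alpha> \<eta> u < \<infinity> \<and>
     (\<exists>us :: nat \<Rightarrow> plane \<Rightarrow> real. (\<forall>n. us n \<in> F_tilde_inf p \<alpha>) \<and>
        (\<lambda>n. DI_eta_quad p \<alpha> \<eta> (\<lambda>x. u x - us n x)) \<longlonglongrightarrow> 0 \<and>
        (\<forall>x\<in>ssg_K p \<alpha>. (\<lambda>n. us n x) \<longlonglongrightarrow> u x))}"

text \<open>\<open>\<F>\<^sup>\<Sigma>\<close> is not closed under subtraction, so the condition on \<open>\<E>\<^sup>*(u - u\<^sub>n, u - u\<^sub>n)\<close> includes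
  that \<open>u - u\<^sub>n\<close> lies in \<open>\<F>\<^sup>\<Sigma>\<close>, the domain on which this limit exists.\<close>

definition F_eta_star :: "(nat \<Rightarrow> plane) \<Rightarrow> real \<Rightarrow> (nat \<Rightarrow> real) \<Rightarrow> (plane \<Rightarrow> real) set" where
  "F_eta_star p \<alpha> \<eta> = {u \<in> F_tilde p \<alpha> \<inter> F_Sigma p \<alpha>. DI_eta_quad p \<alpha> \<eta> u < \<infinity> \<and>
     (\<exists>us :: nat \<Rightarrow> plane \<Rightarrow> real. (\<forall>n. us n \<in> F_star_inf p \<alpha>) \<and>
        (\<forall>n. (\<lambda>x. u x - us n x) \<in> F_Sigma p \<alpha>) \<and>
        (\<lambda>n. E_star p \<alpha> (\<lambda>x. u x - us n x) (\<lambda>x. u x - us n x)) \<longlonglongrightarrow> 0 \<and>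
        (\<lambda>n. DI_eta_quad p \<alpha> \<eta> (\<lambda>x. u x - us n x)) \<longlonglongrightarrow> 0 \<and>
        (\<forall>x\<in>ssg_K p \<alpha>. (\<lambda>n. us n x) \<longlonglongrightarrow> u x))}"

section \<open>Matching pairs\<close>

definition MP :: "(real \<times> real) set" where
  "MP = {(r, \<rho>). r > 0 \<and> \<rho> > 0 \<and> 5/3 * r + \<rho> = 1}"

definition delta :: "(nat \<Rightarrow> real \<times> real) \<Rightarrow> nat \<Rightarrow> real" where
  "delta R m = (\<Prod>k=1..m. fst (R k))"

definition gamma :: "(nat \<Rightarrow> real \<times> real) \<Rightarrow> nat \<Rightarrow> real" where
  "gamma R m = delta R (m - 1) * snd (R m)"

definition E_R_m :: "(nat \<Rightarrow> plane) \<Rightarrow> real \<Rightarrow> (nat \<Rightarrow> real \<times> real) \<Rightarrow> nat \<Rightarrow>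
    (plane \<Rightarrow> real) \<Rightarrow> (plane \<Rightarrow> real) \<Rightarrow> real" where
  "E_R_m p \<alpha> R m u v =
     1 / delta R m * Q_Sigma p \<alpha> m u v + (\<Sum>k=1..m. 1 / gamma R k * DI p \<alpha> k u v)"

text \<open>A finite limit of a real sequence is convergence in the reals.\<close>

definition F_R :: "(nat \<Rightarrow> plane) \<Rightarrow> real \<Rightarrow> (nat \<Rightarrow> real \<times> real) \<Rightarrow> (plane \<Rightarrow> real) set" where
  "F_R p \<alpha> R = {u \<in> F_tilde p \<alpha>. convergent (\<lambda>m. E_R_m p \<alpha> R m u u)}"

definition E_R :: "(nat \<Rightarrow> plane) \<Rightarrow> real \<Rightarrow> (nat \<Rightarrow> real \<times> real) \<Rightarrow>
    (plane \<Rightarrow> real) \<Rightarrow> (plane \<Rightarrow> real) \<Rightarrow> real" where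
  "E_R p \<alpha> R u v = lim (\<lambda>m. E_R_m p \<alpha> R m u v)"

text \<open>The library's \<open>prodinf\<close> is undefined for products whose partial products tend to 0, which is
  the case \<open>\<Sum>\<rho>\<^sub>m = \<infinity>\<close>; hence the limit of partial products.\<close>

definition R_star :: "(nat \<Rightarrow> real \<times> real) \<Rightarrow> real" where
  "R_star R = lim (\<lambda>n. \<Prod>m=1..n. 1 - snd (R m))"

definition eta :: "(nat \<Rightarrow> real \<times> real) \<Rightarrow> nat \<Rightarrow> real" where
  "eta R m = (\<Prod>k=1..m-1. fst (R k)) * snd (R m) / (1 - R_star R)"

end

theory Submission
  imports Defs
begin

text \<open>
  Put \<open>c\<^sub>m = (1 - \<rho>\<^sub>1) \<cdots> (1 - \<rho>\<^sub>m)\<close>. With \<open>q\<^sub>m\<close> and \<open>d\<^sub>m\<close> the energies \<open>Q\<^sup>\<Sigma>\<^sub>m\<close> and \<open>\<D>\<^sup>I\<^sub>m\<^sub>+\<^sub>1\<close> scaled by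
  \<open>(5/3)\<^sup>m\<close>, the form \<open>\<E>\<^sub>\<R>\<^sub>,\<^sub>m\<close> is \<open>q\<^sub>m / c\<^sub>m + \<Sum>\<^sub>k\<^sub><\<^sub>m d\<^sub>k / (c\<^sub>k - c\<^sub>k\<^sub>+\<^sub>1)\<close>, so the theorem decides how much of
  the energy survives in the first summand. Everything rests on an explicit family of extensions of
  three boundary values to \<open>K\<close>: each step multiplies the scaled cell energy by \<open>(5 l)\<^sup>2\<close>, with
  \<open>l \<in> [0, 1/5]\<close> free, and puts the fraction \<open>(1 - 5 l)\<^sup>2\<close> of it on the new bridges.

  Given \<open>u \<in> \<F>\<^sub>\<R>\<close>, keep \<open>u\<close> on the bridges up to level \<open>n\<close> and extend it from there. If
  \<open>c\<^sub>m \<longlonglongrightarrow> 0\<close>, choose the factors so that the extension is harmonic for the network whose cells of a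
  high level \<open>N\<close> are shorted; it is constant on these cells and its energy tends to \<open>\<E>\<^sub>\<R>\<^sub>,\<^sub>n(u, u)\<close> as
  \<open>N \<longlonglongrightarrow> \<infinity>\<close>. If \<open>c\<^sub>m\<close> has a positive limit, choose \<open>l = 1/5\<close>: the extension is constant on the new
  bridges and harmonic on the Sierpinski gasket. In both cases the extensions have energy at most
  \<open>\<E>\<^sub>\<R>\<^sub>,\<^sub>n(u, u) + o(1)\<close> and agree with \<open>u\<close> at level \<open>n\<close>, hence converge to \<open>u\<close> in energy by the
  parallelogram law. The Sierpinski gasket is the case \<open>\<alpha> = 0\<close> of the same construction, with bridges
  collapsed to points.
\<close>

section \<open>Weak derivatives on the unit interval\<close>

text \<open>The constant 1/5 is that of the 1/5-2/5 rule for harmonic functions on the Sierpinski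
  gasket. Write \<open>P k\<close> for the product of the first \<open>k\<close> factors
  \<open>5 * l\<close>. Extending \<open>u\<close> from level \<open>n\<close> turns the cell part
  \<open>q / c_n\<close> of the energy into \<open>P j\<close> squared times
  \<open>q / c_(n+j)\<close> plus the sum over \<open>k < j\<close> of \<open>P k - P (k+1)\<close>
  squared times \<open>q / (c_(n+k) - c_(n+k+1))\<close>. By Cauchy-Schwarz the least value with
  \<open>P = 0\<close> at level \<open>N\<close> is \<open>q / (c_n - c_N)\<close>, attained for
  \<open>P\<close> proportional to \<open>c - c_N\<close>; it approaches \<open>q / c_n\<close> when
  \<open>c_N\<close> tends to 0. The choice \<open>P = 1\<close> gives \<open>q / c_(n+j)\<close>,
  which stays close to \<open>q / c_n\<close> when the limit is positive and \<open>n\<close> is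
  large. A separate obstacle is analytic: the Dirichlet form is built from an arbitrary
  representative of the weak derivative. Its bilinearity and its lower bound by end point values
  both rest on the fundamental theorem of calculus for continuous functions with square integrable
  weak derivative.\<close>

abbreviation ind01 :: "real \<Rightarrow> real" where "ind01 \<equiv> indicator {0..1}"

abbreviation lincomb :: "real \<Rightarrow> ('a \<Rightarrow> real) \<Rightarrow> real \<Rightarrow> ('a \<Rightarrow> real) \<Rightarrow> 'a \<Rightarrow> real" where
  "lincomb c u d v \<equiv> \<lambda>x. c * u x + d * v x"

section \<open>Square integrability and weak derivatives: congruence and linearity\<close>

lemma L2_unit_cong:
  assumes "\<And>t. t \<in> {0..1} \<Longrightarrow> f t = g t"
  shows "L2_unit f \<longleftrightarrow> L2_unit g"
proof -
  have "(\<lambda>t. ind01 t *\<^sub>R f t) = (\<lambda>t. ind01 t *\<^sub>R g t)"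
    "(\<lambda>t. ind01 t *\<^sub>R (f t)\<^sup>2) = (\<lambda>t. ind01 t *\<^sub>R (g t)\<^sup>2)"
    using assms by (auto simp: fun_eq_iff indicator_def)
  then show ?thesis
    unfolding L2_unit_def set_borel_measurable_def set_integrable_def by simp
qed

lemma weak_deriv_cong:
  assumes "\<And>t. t \<in> {0..1} \<Longrightarrow> f t = g t"
  shows "weak_deriv f = weak_deriv g"
proof -
  have "(LINT t:{0..1}|lborel. f t * \<phi>' t) = (LINT t:{0..1}|lborel. g t * \<phi>' t)" for \<phi>'
    by (rule set_lebesgue_integral_cong) (use assms in auto)
  then show ?thesis
    unfolding weak_deriv_def by (simp add: fun_eq_iff)
qed

lemma H1_unit_cong:
  assumes "\<And>t. t \<in> {0..1} \<Longrightarrow> f t = g t"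
  shows "f \<in> H1_unit \<longleftrightarrow> g \<in> H1_unit"
  using L2_unit_cong[OF assms] weak_deriv_cong[OF assms] unfolding H1_unit_def by simp

lemma wderiv_cong:
  assumes "\<And>t. t \<in> {0..1} \<Longrightarrow> f t = g t"
  shows "wderiv f = wderiv g"
  using weak_deriv_cong[OF assms] unfolding wderiv_def by simp

lemma L2_unit_mult_integrable:
  assumes "L2_unit f" "L2_unit g"
  shows "set_integrable lborel {0..1} (\<lambda>t. f t * g t)"
proof -
  have m: "set_borel_measurable lborel {0..1} (\<lambda>t. f t * g t)"
  proof -
    have "(\<lambda>t. (ind01 t *\<^sub>R f t) * (ind01 t *\<^sub>R g t)) \<in> borel_measurable lborel"
      using assms unfolding L2_unit_def set_borel_measurable_def by (intro borel_measurable_times) auto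
    also have "(\<lambda>t. (ind01 t *\<^sub>R f t) * (ind01 t *\<^sub>R g t))
       = (\<lambda>t::real. ind01 t *\<^sub>R (f t * g t))"
      by (auto simp: indicator_def)
    finally show ?thesis unfolding set_borel_measurable_def .
  qed
  have i: "set_integrable lborel {0..1} (\<lambda>t. (f t)\<^sup>2 + (g t)\<^sup>2)"
    using assms unfolding L2_unit_def by (intro set_integral_add) auto
  show ?thesis
  proof (rule set_integrable_bound[OF i m], rule AE_I2, rule impI)
    fix t
    have "0 \<le> (\<bar>f t\<bar> - \<bar>g t\<bar>)\<^sup>2" by simp
    then have "2 * (\<bar>f t\<bar> * \<bar>g t\<bar>) \<le> (f t)\<^sup>2 + (g t)\<^sup>2"
      by (simp add: power2_diff algebra_simps)
    moreover have "0 \<le> \<bar>f t\<bar> * \<bar>g t\<bar>" by simp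
    ultimately show "norm (f t * g t) \<le> norm ((f t)\<^sup>2 + (g t)\<^sup>2)"
      unfolding real_norm_def abs_mult by linarith
  qed
qed

lemma L2_unit_lincomb:
  assumes "L2_unit f" "L2_unit g"
  shows "L2_unit (\<lambda>t. a * f t + b * g t)"
  unfolding L2_unit_def
proof
  have "(\<lambda>t. a * (ind01 t *\<^sub>R f t) + b * (ind01 t *\<^sub>R g t)) \<in> borel_measurable lborel"
    using assms unfolding L2_unit_def set_borel_measurable_def
    by (intro borel_measurable_add borel_measurable_times) auto
  also have "(\<lambda>t. a * (ind01 t *\<^sub>R f t) + b * (ind01 t *\<^sub>R g t))
       = (\<lambda>t::real. ind01 t *\<^sub>R (a * f t + b * g t))"
    by (auto simp: indicator_def)
  finally show "set_borel_measurable lborel {0..1} (\<lambda>t. a * f t + b * g t)"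
    unfolding set_borel_measurable_def .
  have "set_integrable lborel {0..1} (\<lambda>t. a\<^sup>2 * (f t)\<^sup>2 + (2 * a * b) * (f t * g t) + b\<^sup>2 * (g t)\<^sup>2)"
    using assms L2_unit_mult_integrable[OF assms] unfolding L2_unit_def
    by (intro set_integral_add set_integrable_mult_right) auto
  then show "set_integrable lborel {0..1} (\<lambda>t. (a * f t + b * g t)\<^sup>2)"
    by (simp add: power2_sum power_mult_distrib algebra_simps)
qed

lemma L2_unit_continuous:
  fixes f :: "real \<Rightarrow> real"
  assumes "continuous_on {0..1} f"
  shows "L2_unit f"
  unfolding L2_unit_def set_borel_measurable_def set_integrable_def
  using borel_integrable_compact[of "{0..1}" f] borel_integrable_compact[of "{0..1}" "\<lambda>t. (f t)\<^sup>2"] assms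
  by (auto intro!: continuous_intros borel_measurable_integrable)

lemma L2_unit_integrable:
  assumes "L2_unit f" shows "set_integrable lborel {0..1} f"
  using L2_unit_mult_integrable[OF assms L2_unit_continuous[of "\<lambda>_. 1"]] by simp

lemma test_fun_L2:
  assumes "test_fun \<phi> \<phi>'" shows "L2_unit \<phi>" "L2_unit \<phi>'"
proof -
  have "continuous_on {0..1} \<phi>"
    using assms unfolding test_fun_def
    by (meson DERIV_continuous_on has_field_derivative_at_within)
  then show "L2_unit \<phi>" by (rule L2_unit_continuous)
  have "continuous_on {0..1} \<phi>'"
    using assms unfolding test_fun_def by (meson continuous_on_subset subset_UNIV)
  then show "L2_unit \<phi>'" by (rule L2_unit_continuous)
qed

lemma set_integral_lincomb:
  fixes f g :: "real \<Rightarrow> real"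
  assumes "set_integrable lborel A f" "set_integrable lborel A g"
  shows "(LINT t:A|lborel. a * f t + b * g t) = a * (LINT t:A|lborel. f t) + b * (LINT t:A|lborel. g t)"
  using assms by (subst set_integral_add) auto

lemma weak_deriv_lincomb:
  assumes "weak_deriv f f'" "weak_deriv g g'" "L2_unit f" "L2_unit g" "L2_unit f'" "L2_unit g'"
  shows "weak_deriv (\<lambda>t. a * f t + b * g t) (\<lambda>t. a * f' t + b * g' t)"
  unfolding weak_deriv_def
proof (intro allI impI)
  fix \<phi> \<phi>' assume t: "test_fun \<phi> \<phi>'"
  note i = test_fun_L2[OF t]
  have "(LINT t:{0..1}|lborel. (a * f t + b * g t) * \<phi>' t)
      = (LINT t:{0..1}|lborel. a * (f t * \<phi>' t) + b * (g t * \<phi>' t))"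
    by (simp add: algebra_simps)
  also have "\<dots> = a * (LINT t:{0..1}|lborel. f t * \<phi>' t) + b * (LINT t:{0..1}|lborel. g t * \<phi>' t)"
    by (intro set_integral_lincomb L2_unit_mult_integrable assms i)
  also have "\<dots> = - (a * (LINT t:{0..1}|lborel. f' t * \<phi> t) + b * (LINT t:{0..1}|lborel. g' t * \<phi> t))"
    using assms t unfolding weak_deriv_def by (simp add: algebra_simps)
  also have "\<dots> = - (LINT t:{0..1}|lborel. a * (f' t * \<phi> t) + b * (g' t * \<phi> t))"
    by (subst set_integral_lincomb) (intro L2_unit_mult_integrable assms i refl)+
  also have "\<dots> = - (LINT t:{0..1}|lborel. (a * f' t + b * g' t) * \<phi> t)"
    by (simp add: algebra_simps)
  finally show "(LINT t:{0..1}|lborel. (a * f t + b * g t) * \<phi>' t) =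
    - (LINT t:{0..1}|lborel. (a * f' t + b * g' t) * \<phi> t)" .
qed

lemma wderiv:
  assumes "f \<in> H1_unit" shows "L2_unit (wderiv f)" "weak_deriv f (wderiv f)"
proof -
  have "\<exists>g. L2_unit g \<and> weak_deriv f g" using assms unfolding H1_unit_def by auto
  then have "L2_unit (wderiv f) \<and> weak_deriv f (wderiv f)"
    unfolding wderiv_def by (rule someI_ex)
  then show "L2_unit (wderiv f)" "weak_deriv f (wderiv f)" by auto
qed

lemma H1_unit_lincomb:
  assumes "f \<in> H1_unit" "g \<in> H1_unit"
  shows "(\<lambda>t. a * f t + b * g t) \<in> H1_unit"
proof -
  have 2: "L2_unit f" "L2_unit g" using assms unfolding H1_unit_def by auto
  show ?thesis
    using L2_unit_lincomb[OF 2, of a b] L2_unit_lincomb[OF wderiv(1)[OF assms(1)] wderiv(1)[OF assms(2)], of a b]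
      weak_deriv_lincomb[OF wderiv(2)[OF assms(1)] wderiv(2)[OF assms(2)] 2 wderiv(1)[OF assms(1)] wderiv(1)[OF assms(2)], of a b]
    unfolding H1_unit_def by blast
qed

text \<open>A \<open>C\<^sup>1\<close> step, so that differences of its translates are admissible test functions.\<close>

definition spline_step :: "real \<Rightarrow> real" where
  "spline_step x = 2 * ((max 0 x)\<^sup>2 - 2 * (max 0 (x - 1/2))\<^sup>2 + (max 0 (x - 1))\<^sup>2)"

text \<open>The derivative of \<open>spline_step\<close>: a tent over the unit interval of height 2,
  hence of mass one.\<close>

definition spline_tent :: "real \<Rightarrow> real" where
  "spline_tent x = 4 * (max 0 x - 2 * max 0 (x - 1/2) + max 0 (x - 1))"

lemma has_real_derivative_max0_power2:
  "((\<lambda>x::real. (max 0 x)\<^sup>2) has_real_derivative 2 * max 0 x) (at x)"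
proof (cases x "0::real" rule: linorder_cases)
  case less
  have "((\<lambda>x::real. 0) has_real_derivative 2 * max 0 x) (at x)" using less by simp
  then show ?thesis
    by (rule has_field_derivative_transform_within_open[where S="{..<0}"]) (use less in auto)
next
  case greater
  have "((\<lambda>x::real. x\<^sup>2) has_real_derivative 2 * max 0 x) (at x)"
    using greater by (auto intro!: derivative_eq_intros)
  then show ?thesis
    by (rule has_field_derivative_transform_within_open[where S="{0<..}"]) (use greater in auto)
next
  case equal
  have "((\<lambda>h::real. (max 0 h)\<^sup>2 / h) \<longlongrightarrow> 0) (at 0)"
  proof (rule Lim_null_comparison[where g="\<lambda>h. \<bar>h\<bar>"])
    show "\<forall>\<^sub>F h::real in at 0. norm ((max 0 h)\<^sup>2 / h) \<le> \<bar>h\<bar>"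
      by (auto intro!: always_eventually simp: max_def power2_eq_square)
    show "((\<lambda>h::real. \<bar>h\<bar>) \<longlongrightarrow> 0) (at 0)"
      by (intro tendsto_eq_intros) auto
  qed
  then show ?thesis using equal by (simp add: DERIV_def)
qed

lemma spline_step_deriv: "(spline_step has_real_derivative spline_tent x) (at x)"
proof -
  have s: "((\<lambda>x::real. (max 0 (x - c))\<^sup>2) has_real_derivative 2 * max 0 (x - c)) (at x)" for c
  proof -
    have "((\<lambda>x::real. x - c) has_real_derivative 1) (at x)"
      by (auto intro!: derivative_eq_intros)
    from DERIV_chain2[where f="\<lambda>y. (max 0 y)\<^sup>2" and g="\<lambda>x. x - c", OF has_real_derivative_max0_power2 this]
    show ?thesis by simp
  qed
  have "(spline_step has_real_derivative 2 * (2 * max 0 (x - 0) - 2 * (2 * max 0 (x - 1/2)) + 2 * max 0 (x - 1))) (at x)"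
    unfolding spline_step_def[abs_def]
    using s[of 0] by (intro DERIV_cmult DERIV_add DERIV_diff s) simp
  then show ?thesis unfolding spline_tent_def by (simp add: algebra_simps)
qed

lemma spline_step_scaled_deriv:
  assumes "0 < e"
  shows "((\<lambda>x. spline_step ((x - s) / e)) has_real_derivative spline_tent ((x - s) / e) / e) (at x)"
proof -
  have "((\<lambda>x. (x - s) / e) has_real_derivative 1 / e) (at x)"
    using assms by (auto intro!: derivative_eq_intros)
  from DERIV_chain2[where f=spline_step and g="\<lambda>x. (x - s) / e", OF spline_step_deriv this]
  show ?thesis by simp
qed

lemma spline_tent_nonneg: "0 \<le> spline_tent x"
  unfolding spline_tent_def by (auto simp: max_def)

lemma spline_tent_outside: "x \<le> 0 \<or> 1 \<le> x \<Longrightarrow> spline_tent x = 0"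
  unfolding spline_tent_def by (auto simp: max_def)

lemma spline_step_0: "x \<le> 0 \<Longrightarrow> spline_step x = 0"
  unfolding spline_step_def by (auto simp: max_def)

lemma spline_step_1: "1 \<le> x \<Longrightarrow> spline_step x = 1"
  unfolding spline_step_def by (auto simp: max_def power2_eq_square algebra_simps)

lemma spline_step_mono: "x \<le> y \<Longrightarrow> spline_step x \<le> spline_step y"
  by (rule DERIV_nonneg_imp_nondecreasing) (use spline_step_deriv spline_tent_nonneg in blast)+

lemma spline_step_range: "0 \<le> spline_step x" "spline_step x \<le> 1"
  using spline_step_mono[of "min x 0" x] spline_step_mono[of x "max x 1"] spline_step_0[of "min x 0"] spline_step_1[of "max x 1"]
  by auto

lemma continuous_on_spline_tent: "continuous_on S spline_tent"
  unfolding spline_tent_def by (intro continuous_intros)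

text \<open>The rescaled tents are nonnegative, live on \<open>[s, s + e]\<close> and have integral
  one, being the derivative of a step from 0 to 1. They form a one-sided approximate identity at
  \<open>s\<close>, and no mass is lost once \<open>s + e < 1\<close>.\<close>

lemma spline_mollifier_tendsto:
  fixes f :: "real \<Rightarrow> real"
  assumes f: "continuous_on {0..1} f" and s: "0 < s" "s < 1"
  shows "((\<lambda>e. LINT t:{0..1}|lborel. f t * (spline_tent ((t - s) / e) / e)) \<longlongrightarrow> f s) (at_right 0)"
proof (rule tendstoI)
  fix d :: real assume d: "0 < d"
  have "isCont f s"
    using continuous_on_interior[OF f] s by (simp add: interior_atLeastAtMost_real)
  then obtain r where r: "r > 0" "\<And>t. \<bar>t - s\<bar> < r \<Longrightarrow> \<bar>f t - f s\<bar> < d / 2"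
    using d unfolding continuous_at_eps_delta dist_real_def by (metis half_gt_zero)
  have "\<forall>\<^sub>F e in at_right 0. 0 < e \<and> e < min r (1 - s)"
    using eventually_at_right_less[of "0::real"] eventually_at_right[of "0::real" "min r (1-s)"] r s
    by (auto simp: eventually_at_right intro!: exI[of _ "min r (1-s)"])
  then show "\<forall>\<^sub>F e in at_right 0. dist (LINT t:{0..1}|lborel. f t * (spline_tent ((t - s) / e) / e)) (f s) < d"
  proof eventually_elim
    case (elim e)
    then have e: "0 < e" "e < r" "s + e < 1" by auto
    define k where "k t = spline_tent ((t - s) / e) / e" for t
    have kc: "continuous_on S k" for S
      unfolding k_def using e
      by (intro continuous_intros continuous_on_compose2[OF continuous_on_spline_tent[of UNIV]]) auto
    have k0: "0 \<le> k t" for t using spline_tent_nonneg e unfolding k_def by simp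
    have kz: "k t = 0" if "\<not> \<bar>t - s\<bar> < r" for t
    proof -
      have "(t - s) / e \<le> 0 \<or> 1 \<le> (t - s) / e"
        using that e by (auto simp: divide_le_0_iff le_divide_eq)
      then show ?thesis unfolding k_def using spline_tent_outside by simp
    qed
    have "((\<lambda>t. spline_step ((t - s) / e)) has_real_derivative k t) (at t)" for t
      unfolding k_def using e
      by (intro spline_step_scaled_deriv)
    then have ki: "(k has_integral 1) {0..1}"
      using fundamental_theorem_of_calculus[of 0 1 "\<lambda>t. spline_step ((t - s) / e)" k]
        spline_step_0[of "(0 - s) / e"] spline_step_1[of "(1 - s) / e"] s e
      by (simp add: has_real_derivative_iff_has_vector_derivative has_vector_derivative_at_within
          divide_le_0_iff le_divide_eq)
    have int: "(\<lambda>t. f t * k t) integrable_on {0..1}" "(\<lambda>t. (f t - f s) * k t) integrable_on {0..1}"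
      by (intro integrable_continuous_interval continuous_intros f kc)+
    have "(LINT t:{0..1}|lborel. f t * k t) = integral {0..1} (\<lambda>t. f t * k t)"
      by (intro set_borel_integral_eq_integral(2))
        (intro L2_unit_integrable L2_unit_continuous continuous_intros f kc)
    also have "\<dots> = integral {0..1} (\<lambda>t. (f t - f s) * k t + f s * k t)"
      by (simp add: algebra_simps)
    also have "\<dots> = integral {0..1} (\<lambda>t. (f t - f s) * k t) + f s"
      using has_integral_add[OF integrable_integral[OF int(2)] has_integral_mult_right[OF ki, of "f s"]]
      by (intro integral_unique) simp
    finally have eq: "(LINT t:{0..1}|lborel. f t * k t) - f s = integral {0..1} (\<lambda>t. (f t - f s) * k t)"
      by simp
    have hk: "((\<lambda>t. d / 2 * k t) has_integral d / 2) {0..1}"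
      using has_integral_mult_right[OF ki, of "d / 2"] by simp
    have "norm (integral {0..1} (\<lambda>t. (f t - f s) * k t)) \<le> integral {0..1} (\<lambda>t. d / 2 * k t)"
    proof (rule integral_norm_bound_integral[OF int(2)])
      show "(\<lambda>t. d / 2 * k t) integrable_on {0..1}" using hk by blast
      fix t
      show "norm ((f t - f s) * k t) \<le> d / 2 * k t"
      proof (cases "\<bar>t - s\<bar> < r")
        case True
        then have "\<bar>f t - f s\<bar> * k t \<le> d / 2 * k t"
          using r(2)[of t] k0[of t] by (intro mult_right_mono) auto
        then show ?thesis using k0[of t] by (simp add: abs_mult)
      qed (use kz[of t] in simp)
    qed
    also have "\<dots> = d / 2" using hk by (rule integral_unique)
    finally have "dist (LINT t:{0..1}|lborel. f t * k t) (f s) < d"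
      using eq d unfolding dist_real_def by simp
    then show ?case unfolding k_def .
  qed
qed

text \<open>The test function is a smoothed indicator, the difference of two steps of width
  \<open>e\<close>. The side with \<open>f\<close> converges to \<open>f s - f t\<close> by the
  mollifier lemma, the side with \<open>g\<close> by dominated convergence. A step still vanishes at
  its starting point, hence the half-open interval.\<close>

lemma weak_deriv_integral_interior:
  assumes f: "continuous_on {0..1} f" and g: "L2_unit g" and w: "weak_deriv f g"
    and st: "0 < s" "s < t" "t < 1"
  shows "(LINT x:{0..1}|lborel. indicator {s<..t} x * g x) = f t - f s"
proof -
  define \<phi> where "\<phi> e x = spline_step ((x - s) / e) - spline_step ((x - t) / e)" for e x :: real
  define \<phi>' where "\<phi>' e x = spline_tent ((x - s) / e) / e - spline_tent ((x - t) / e) / e" for e x :: real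
  \<comment> \<open>A sequence of widths, because dominated convergence is used for sequences. The
    double successor makes every \<open>E n\<close> smaller than \<open>1 - t\<close>, so that the
    support \<open>[s, t + E n]\<close> stays inside the open unit interval.\<close>
  define E where "E n = (1 - t) * inverse (real (Suc (Suc n)))" for n
  have E: "0 < E n" "E n < 1 - t" for n
    using st mult_strict_left_mono[of "inverse (real (Suc (Suc n)))" 1 "1 - t"]
    unfolding E_def by (auto intro: inverse_less_1_iff[THEN iffD2])
  have E0: "filterlim E (at_right 0) sequentially"
    unfolding filterlim_at
    using E(1) tendsto_mult_right_zero[OF LIMSEQ_Suc[OF LIMSEQ_inverse_real_of_nat], of "1 - t"]
    unfolding E_def by (auto intro!: always_eventually)
  have tf: "test_fun (\<phi> e) (\<phi>' e)" if e: "0 < e" "e < 1 - t" for e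
    unfolding test_fun_def
  proof (intro conjI allI)
    show "(\<phi> e has_real_derivative \<phi>' e x) (at x)" for x
      unfolding \<phi>_def[abs_def] \<phi>'_def using e
      by (intro DERIV_diff spline_step_scaled_deriv)
    show "continuous_on UNIV (\<phi>' e)"
      unfolding \<phi>'_def[abs_def] using e
      by (intro continuous_intros continuous_on_compose2[OF continuous_on_spline_tent[of UNIV]]) auto
    have "{x. \<phi> e x \<noteq> 0} \<subseteq> {s..t+e}"
    proof (safe, goal_cases)
      case (1 x)
      show ?case
      proof (rule ccontr)
        assume "x \<notin> {s..t+e}"
        then consider "x < s" | "x > t + e" by fastforce
        then have "\<phi> e x = 0"
        proof cases
          case 1
          then have "(x - s) / e \<le> 0" "(x - t) / e \<le> 0" using st e by (auto simp: divide_le_0_iff)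
          then show ?thesis unfolding \<phi>_def by (simp add: spline_step_0)
        next
          case 2
          then have "1 \<le> (x - s) / e" "1 \<le> (x - t) / e" using st e by (auto simp: le_divide_eq)
          then show ?thesis unfolding \<phi>_def by (simp add: spline_step_1)
        qed
        with 1 show False by simp
      qed
    qed
    then have "closure {x. \<phi> e x \<noteq> 0} \<subseteq> {s..t+e}" by (intro closure_minimal) auto
    then show "closure {x. \<phi> e x \<noteq> 0} \<subseteq> {0<..<1}" using st e by auto
  qed
  let ?J = "\<lambda>s e. LINT x:{0..1}|lborel. f x * (spline_tent ((x - s) / e) / e)"
  have J: "?J s e - ?J t e = - (LINT x:{0..1}|lborel. g x * \<phi> e x)" if elim: "0 < e" "e < 1 - t" for e
  proof -
    have i: "set_integrable lborel {0..1} (\<lambda>x. f x * (spline_tent ((x - u) / e) / e))" for u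
      unfolding set_integrable_def using elim
      by (intro borel_integrable_compact continuous_intros f
          continuous_on_compose2[OF continuous_on_spline_tent[of UNIV]]) auto
    have "?J s e - ?J t e = (LINT x:{0..1}|lborel. f x * \<phi>' e x)"
      unfolding \<phi>'_def right_diff_distrib by (rule set_integral_diff(2)[symmetric]) (rule i)+
    then show ?thesis using w tf elim unfolding weak_deriv_def by metis
  qed
  have "((\<lambda>e. ?J s e - ?J t e) \<longlongrightarrow> f s - f t) (at_right 0)"
    using st by (intro tendsto_diff spline_mollifier_tendsto f) auto
  from filterlim_compose[OF this E0]
  have L1: "(\<lambda>n. - (LINT x:{0..1}|lborel. g x * \<phi> (E n) x)) \<longlonglongrightarrow> f s - f t"
    using J E by simp
  have L2: "(\<lambda>n. LINT x:{0..1}|lborel. g x * \<phi> (E n) x) \<longlonglongrightarrow> (LINT x:{0..1}|lborel. indicator {s<..t} x * g x)"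
    unfolding set_lebesgue_integral_def
  proof (rule integral_dominated_convergence)
    show "integrable lborel (\<lambda>x. \<bar>ind01 x *\<^sub>R g x\<bar>)"
      using L2_unit_integrable[OF g] unfolding set_integrable_def by (intro integrable_abs)
    have gm: "(\<lambda>x. ind01 x *\<^sub>R g x) \<in> borel_measurable lborel"
      using g unfolding L2_unit_def set_borel_measurable_def by auto
    have "(\<lambda>x. indicator {s<..t} x * (ind01 x *\<^sub>R g x)) \<in> borel_measurable lborel"
      using gm by (intro borel_measurable_times) auto
    then show "(\<lambda>x. ind01 x *\<^sub>R (indicator {s<..t} x * g x)) \<in> borel_measurable lborel"
      by (simp add: mult.left_commute)
    show "(\<lambda>x. ind01 x *\<^sub>R (g x * \<phi> (E n) x)) \<in> borel_measurable lborel" for n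
    proof -
      have "continuous_on UNIV (\<phi> (E n))"
        using tf[OF E] unfolding test_fun_def by (meson DERIV_continuous_on has_field_derivative_at_within)
      then have "\<phi> (E n) \<in> borel_measurable lborel" by (simp add: borel_measurable_continuous_onI)
      then have "(\<lambda>x. (ind01 x *\<^sub>R g x) * \<phi> (E n) x) \<in> borel_measurable lborel"
        using gm by (intro borel_measurable_times)
      then show ?thesis by (simp add: mult.assoc)
    qed
    show "AE x in lborel. (\<lambda>n. ind01 x *\<^sub>R (g x * \<phi> (E n) x)) \<longlonglongrightarrow> ind01 x *\<^sub>R (indicator {s<..t} x * g x)"
    proof (rule AE_I2)
      fix x
      have "\<forall>\<^sub>F e in at_right 0. spline_step ((x - u) / e) = (if u < x then 1 else 0)" for u
      proof (cases "u < x")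
        case True
        then have "\<forall>\<^sub>F e in at_right 0. 0 < e \<and> e < x - u"
          by (intro eventually_conj eventually_at_right_less eventually_at_rightI[of 0 "x - u"]) auto
        then show ?thesis
          by eventually_elim (use True in \<open>auto intro!: spline_step_1 simp: le_divide_eq\<close>)
      next
        case False
        show ?thesis
          using eventually_at_right_less[of "0::real"]
          by eventually_elim (use False in \<open>auto intro!: spline_step_0 simp: divide_le_0_iff\<close>)
      qed
      from this[of s] this[of t]
      have "\<forall>\<^sub>F e in at_right 0. indicator {s<..t} x = \<phi> e x"
        by eventually_elim (use st in \<open>auto simp: \<phi>_def\<close>)
      then have "\<forall>\<^sub>F e in at_right 0. ind01 x *\<^sub>R (indicator {s<..t} x * g x) = ind01 x *\<^sub>R (g x * \<phi> e x)"
        by eventually_elim (simp add: mult.commute)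
      then have "((\<lambda>e. ind01 x *\<^sub>R (g x * \<phi> e x)) \<longlongrightarrow> ind01 x *\<^sub>R (indicator {s<..t} x * g x)) (at_right 0)"
        by (rule Lim_transform_eventually[OF tendsto_const])
      from filterlim_compose[OF this E0]
      show "(\<lambda>n. ind01 x *\<^sub>R (g x * \<phi> (E n) x)) \<longlonglongrightarrow> ind01 x *\<^sub>R (indicator {s<..t} x * g x)" .
    qed
    show "AE x in lborel. norm (ind01 x *\<^sub>R (g x * \<phi> (E n) x)) \<le> \<bar>ind01 x *\<^sub>R g x\<bar>" for n
    proof (rule AE_I2)
      fix x
      define e where "e = E n"
      have "\<bar>\<phi> e x\<bar> \<le> 1"
        using spline_step_range[of "(x - s) / e"] spline_step_range[of "(x - t) / e"] unfolding \<phi>_def by linarith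
      then show "norm (ind01 x *\<^sub>R (g x * \<phi> (E n) x)) \<le> \<bar>ind01 x *\<^sub>R g x\<bar>"
        unfolding e_def by (auto simp: indicator_def abs_mult mult_left_le)
    qed
  qed
  show ?thesis
    using LIMSEQ_unique[OF tendsto_minus[OF L1]] L2 by simp
qed

text \<open>By the preceding lemma \<open>f\<close> minus the primitive of \<open>g\<close> is
  constant on the open interval, which is all that test functions see; continuity of both carries
  this to the end points.\<close>

lemma weak_deriv_ftc:
  assumes f: "continuous_on {0..1} f" and g: "L2_unit g" and w: "weak_deriv f g"
    and st: "0 \<le> s" "s \<le> t" "t \<le> 1"
  shows "(g has_integral f t - f s) {s..t}"
proof -
  note gi = L2_unit_integrable[OF g]
  have g01: "g integrable_on {0..1}" by (rule set_borel_integral_eq_integral(1)[OF gi])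
  have gab: "g integrable_on {a..b}" if "0 \<le> a" "b \<le> 1" for a b
    using that by (intro integrable_subinterval_real[OF g01]) auto
  define J where "J x = integral {0..x} g" for x
  have J: "integral {a..b} g = J b - J a" if "0 \<le> a" "a \<le> b" "b \<le> 1" for a b
    using Henstock_Kurzweil_Integration.integral_combine[OF that(1,2) gab[OF order_refl that(3)]] unfolding J_def by simp
  have int: "J b - J a = f b - f a" if ab: "0 < a" "a < b" "b < 1" for a b
  proof -
    have "f b - f a = (LINT x:{0..1}|lborel. indicator {a<..b} x * g x)"
      by (rule weak_deriv_integral_interior[OF f g w ab, symmetric])
    also have "\<dots> = (LINT x:{a<..b}|lborel. g x)"
      unfolding set_lebesgue_integral_def using ab by (intro Bochner_Integration.integral_cong) (auto simp: indicator_def)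
    also have "\<dots> = integral {a<..b} g"
      using ab by (intro set_borel_integral_eq_integral(2) set_integrable_subset[OF gi]) auto
    also have "\<dots> = integral {a..b} g"
    proof (rule integral_spike_set)
      show "negligible {x \<in> {a<..b} - {a..b}. g x \<noteq> 0}" by (rule negligible_subset[of "{}"]) auto
      show "negligible {x \<in> {a..b} - {a<..b}. g x \<noteq> 0}" by (rule negligible_subset[of "{a}"]) auto
    qed
    finally show ?thesis using J[of a b] ab by simp
  qed
  have c: "continuous_on {0..1} (\<lambda>x. f x - J x)"
    unfolding J_def by (intro continuous_intros f indefinite_integral_continuous_1 g01)
  have const: "f x - J x = f (1/2) - J (1/2)" if "x \<in> {0..1}" for x
  proof (rule continuous_constant_on_closure[of "{0<..<1}" "\<lambda>x. f x - J x" "f (1/2) - J (1/2)"])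
    show "continuous_on (closure {0<..<1}) (\<lambda>x. f x - J x)" using c by simp
    show "x \<in> closure {0<..<1}" using that by simp
    show "f x - J x = f (1/2) - J (1/2)" if "x \<in> {0<..<1}" for x
    proof (cases "x = 1/2")
      case False
      then show ?thesis using int[of x "1/2"] int[of "1/2" x] that by (cases "x < 1/2") auto
    qed (simp only:)
  qed
  have "integral {s..t} g = f t - f s"
    using J[OF st] const[of s] const[of t] st by simp
  then show ?thesis using integrable_integral[OF gab[OF st(1,3)]] by simp
qed

text \<open>The fundamental theorem determines the integral over every interval from
  \<open>f\<close> alone, and intervals generate the Borel sets. The factor \<open>ind01\<close>
  appears because nothing constrains a weak derivative outside the unit interval.\<close>

lemma weak_deriv_unique:
  assumes f: "continuous_on {0..1} f" and g: "L2_unit g" "weak_deriv f g" and h: "L2_unit h" "weak_deriv f h"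
  shows "AE x in lborel. ind01 x * g x = ind01 x * h x"
proof (rule density_unique_real)
  let ?d = "\<lambda>g x. ind01 x * g x :: real"
  show i: "integrable lborel (?d g)" "integrable lborel (?d h)"
    using L2_unit_integrable[OF g(1)] L2_unit_integrable[OF h(1)] unfolding set_integrable_def by auto
  fix A :: "real set" assume "A \<in> sets lborel"
  then have "A \<in> sets borel" by simp
  have iA: "set_integrable lborel A (?d g)" "set_integrable lborel A (?d h)" if "A \<in> sets borel" for A
    using integrable_mult_indicator[OF _ i(1), of A] integrable_mult_indicator[OF _ i(2), of A] that
    unfolding set_integrable_def by auto
  have ivl: "(LINT x:{a..b}|lborel. ?d k x) = (if max 0 a \<le> min 1 b then f (min 1 b) - f (max 0 a) else 0)"
    if k: "L2_unit k" "weak_deriv f k" for a b k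
  proof -
    have "(LINT x:{a..b}|lborel. ?d k x) = (LINT x:{max 0 a..min 1 b}|lborel. k x)"
      unfolding set_lebesgue_integral_def by (intro Bochner_Integration.integral_cong) (auto simp: indicator_def)
    also have "\<dots> = integral {max 0 a..min 1 b} k"
      by (intro set_borel_integral_eq_integral(2) set_integrable_subset[OF L2_unit_integrable[OF k(1)]]) auto
    also have "\<dots> = (if max 0 a \<le> min 1 b then f (min 1 b) - f (max 0 a) else 0)"
      using weak_deriv_ftc[OF f k, of "max 0 a" "min 1 b"] by (auto intro!: integral_unique)
    finally show ?thesis .
  qed
  have all: "(LINT x:UNIV|lborel. ?d k x) = (LINT x:{0..1}|lborel. ?d k x)" for k
    unfolding set_lebesgue_integral_def by (intro Bochner_Integration.integral_cong) (auto simp: indicator_def)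
  have univ: "(LINT x:UNIV|lborel. ?d g x) = (LINT x:UNIV|lborel. ?d h x)"
    unfolding all ivl[OF g] ivl[OF h] ..
  show "(LINT x:A|lborel. ?d g x) = (LINT x:A|lborel. ?d h x)"
    using \<open>A \<in> sets borel\<close>
  proof (induction rule: borel_set_induct)
    case empty show ?case by (simp add: set_lebesgue_integral_def)
  next
    case (interval a b) show ?case unfolding ivl[OF g] ivl[OF h] ..
  next
    case (compl A)
    have "(LINT x:UNIV|lborel. k x) = (LINT x:A|lborel. k x) + (LINT x:-A|lborel. k x)"
      if "set_integrable lborel A k" "set_integrable lborel (-A) k" for k :: "real \<Rightarrow> real"
      using set_integral_Un[OF _ that] by (simp add: Compl_partition)
    from this[of "?d g"] this[of "?d h"] show ?case
      using univ compl iA[of A] iA[of "-A"] by simp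
  next
    case (union A)
    have "(LINT x:(\<Union>i. A i)|lborel. k x) = (\<Sum>i. LINT x:A i|lborel. k x)"
      if "set_integrable lborel (\<Union>i. A i) k" for k :: "real \<Rightarrow> real"
      using union that by (intro lebesgue_integral_countable_add) (auto simp: disjoint_family_on_def)
    from this[of "?d g"] this[of "?d h"] show ?case
      using union iA[of "\<Union>i. A i"] by auto
  qed
qed

lemma wderiv_AE_eq:
  assumes f: "continuous_on {0..1} f" "f \<in> H1_unit" and g: "L2_unit g" "weak_deriv f g"
  shows "AE x in lborel. ind01 x * wderiv f x = ind01 x * g x"
  by (rule weak_deriv_unique[OF f(1) wderiv[OF f(2)] g])

text \<open>Cauchy-Schwarz against the constant 1, obtained as nonnegativity of the variance of
  \<open>g\<close> around its mean \<open>I\<close>, which equals \<open>f 1 - f 0\<close>.\<close>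

lemma weak_deriv_difference_square_le:
  assumes f: "continuous_on {0..1} f" and g: "L2_unit g" and w: "weak_deriv f g"
  shows "(f 1 - f 0)\<^sup>2 \<le> (LINT t:{0..1}|lborel. g t * g t)"
proof -
  define I where "I = (LINT t:{0..1}|lborel. g t)"
  have I: "I = f 1 - f 0"
    using weak_deriv_ftc[OF f g w, of 0 1] set_borel_integral_eq_integral(2)[OF L2_unit_integrable[OF g]]
    unfolding I_def by (auto intro: integral_unique)
  have i1: "set_integrable lborel {0..1} (\<lambda>t. g t * g t)"
    by (intro L2_unit_mult_integrable g)
  have i2: "set_integrable lborel {0..1} (\<lambda>t. 2 * I * g t)"
    using L2_unit_integrable[OF g] by (intro set_integrable_mult_right)
  have i3: "set_integrable lborel {0..1} (\<lambda>t::real. I * I)"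
    by (rule L2_unit_integrable[OF L2_unit_continuous]) simp
  have "0 \<le> (LINT t:{0..1}|lborel. (g t - I)\<^sup>2)"
    unfolding set_lebesgue_integral_def by (intro Bochner_Integration.integral_nonneg) auto
  also have "\<dots> = (LINT t:{0..1}|lborel. (g t * g t - 2 * I * g t) + I * I)"
    by (intro set_lebesgue_integral_cong) (auto simp: power2_eq_square algebra_simps)
  also have "\<dots> = (LINT t:{0..1}|lborel. g t * g t) - 2 * I * I + I * I"
    using i1 i2 i3 unfolding I_def[symmetric]
    by (subst set_integral_add(2), simp, simp, subst set_integral_diff(2)) (auto simp: I_def[symmetric] set_integral_const)
  finally show ?thesis unfolding I power2_eq_square by (simp add: algebra_simps)
qed

lemma affine_weak_deriv: "weak_deriv (\<lambda>t. c + t * d) (\<lambda>_. d)"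
  unfolding weak_deriv_def
proof (intro allI impI)
  fix \<phi> \<phi>' assume t: "test_fun \<phi> \<phi>'"
  have d: "(\<phi> has_real_derivative \<phi>' x) (at x)" for x using t unfolding test_fun_def by auto
  have c': "continuous_on {0..1} \<phi>'" using t unfolding test_fun_def by (meson continuous_on_subset subset_UNIV)
  have c: "continuous_on {0..1} \<phi>" using d by (meson DERIV_continuous_on has_field_derivative_at_within)
  have z: "\<phi> 0 = 0" "\<phi> 1 = 0"
    using t closure_subset[of "{t. \<phi> t \<noteq> 0}"] unfolding test_fun_def by fastforce+
  have "((\<lambda>x. (c + x * d) * \<phi>' x + d * \<phi> x) has_integral (c + 1 * d) * \<phi> 1 - (c + 0 * d) * \<phi> 0) {0..1}"
  proof (rule fundamental_theorem_of_calculus, simp, goal_cases)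
    case (1 x)
    have "((\<lambda>x. (c + x * d) * \<phi> x) has_real_derivative (c + x * d) * \<phi>' x + d * \<phi> x) (at x)"
      by (auto intro!: derivative_eq_intros d)
    then show ?case
      by (simp add: has_real_derivative_iff_has_vector_derivative has_vector_derivative_at_within)
  qed
  then have "integral {0..1} (\<lambda>x. (c + x * d) * \<phi>' x + d * \<phi> x) = 0" using z by (simp add: integral_unique)
  moreover have i: "set_integrable lborel {0..1} (\<lambda>x. (c + x * d) * \<phi>' x)" "set_integrable lborel {0..1} (\<lambda>x. d * \<phi> x)"
    by (intro L2_unit_integrable L2_unit_continuous continuous_intros c c')+
  ultimately have "(LINT x:{0..1}|lborel. (c + x * d) * \<phi>' x + d * \<phi> x) = 0"
    by (subst set_borel_integral_eq_integral(2)) (auto intro: set_integral_add)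
  then show "(LINT x:{0..1}|lborel. (c + x * d) * \<phi>' x) = - (LINT x:{0..1}|lborel. d * \<phi> x)"
    using i by (subst (asm) set_integral_add(2)) auto
qed

lemma affine_H1_unit: "(\<lambda>t. c + t * d) \<in> H1_unit"
proof -
  have "L2_unit (\<lambda>t. c + t * d)" "L2_unit (\<lambda>_::real. d)"
    by (intro L2_unit_continuous continuous_intros)+
  then show ?thesis unfolding H1_unit_def using affine_weak_deriv[of c d] by blast
qed

section \<open>Dirichlet integrals on segments\<close>

text \<open>Membership in H1 does not see changes on null sets. Continuity fixes the representative,
  so that end point values are controlled and uniqueness of the weak derivative applies.\<close>

definition H1C :: "plane \<Rightarrow> plane \<Rightarrow> (plane \<Rightarrow> real) \<Rightarrow> bool" where
  "H1C a b u \<longleftrightarrow> u \<in> H1_seg a b \<and> continuous_on (closed_segment a b) u"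

lemma H1C_D:
  assumes "H1C a b u"
  shows "u \<circ> linepath a b \<in> H1_unit" "continuous_on {0..1} (u \<circ> linepath a b)"
proof -
  show "u \<circ> linepath a b \<in> H1_unit" using assms unfolding H1C_def H1_seg_def by simp
  show "continuous_on {0..1} (u \<circ> linepath a b)"
    using assms unfolding H1C_def
    by (intro continuous_on_compose continuous_on_linepath) (simp add: linepath_image_01)
qed

lemma H1C_lincomb:
  assumes "H1C a b u" "H1C a b v"
  shows "H1C a b (lincomb c u d v)"
  using H1_unit_lincomb[OF H1C_D(1)[OF assms(1)] H1C_D(1)[OF assms(2)], of c d] assms
  unfolding H1C_def H1_seg_def by (auto simp: o_def intro!: continuous_intros)

lemma dirichlet_cong:
  assumes "\<And>x. x \<in> closed_segment a b \<Longrightarrow> u x = u' x" "\<And>x. x \<in> closed_segment a b \<Longrightarrow> v x = v' x"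
  shows "dirichlet a b u v = dirichlet a b u' v'"
proof -
  have "wderiv (u \<circ> linepath a b) = wderiv (u' \<circ> linepath a b)" "wderiv (v \<circ> linepath a b) = wderiv (v' \<circ> linepath a b)"
    using assms by (auto intro!: wderiv_cong simp: linepath_in_path)
  then show ?thesis unfolding dirichlet_def by simp
qed

lemma dirichlet_sym: "dirichlet a b u v = dirichlet a b v u"
  unfolding dirichlet_def by (simp add: mult.commute)

lemma dirichlet_nonneg: "0 \<le> dirichlet a b u u"
  unfolding dirichlet_def set_lebesgue_integral_def by (intro Bochner_Integration.integral_nonneg) auto

text \<open>\<open>wderiv\<close> selects a representative for the combination independently of
  those for \<open>u\<close> and \<open>v\<close>; both candidates agree almost everywhere by
  uniqueness, which is enough under the integral.\<close>

lemma dirichlet_lincomb_left: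
  assumes u: "H1C a b u" and v: "H1C a b v" and w: "H1C a b w"
  shows "dirichlet a b (lincomb c u d v) w = c * dirichlet a b u w + d * dirichlet a b v w"
proof -
  let ?l = "linepath a b"
  note h1 [simp] = H1C_D[OF u] H1C_D[OF v] H1C_D[OF w]
  have 2: "L2_unit (u \<circ> ?l)" "L2_unit (v \<circ> ?l)" by (intro L2_unit_continuous h1)+
  have "weak_deriv (\<lambda>t. c * (u \<circ> ?l) t + d * (v \<circ> ?l) t) (\<lambda>t. c * wderiv (u \<circ> ?l) t + d * wderiv (v \<circ> ?l) t)"
    by (intro weak_deriv_lincomb wderiv 2 h1)
  moreover have eq: "(\<lambda>t. c * (u \<circ> ?l) t + d * (v \<circ> ?l) t) = (lincomb c u d v) \<circ> ?l" by (auto simp: o_def)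
  ultimately have wd: "weak_deriv ((lincomb c u d v) \<circ> ?l) (\<lambda>t. c * wderiv (u \<circ> ?l) t + d * wderiv (v \<circ> ?l) t)"
    by (simp only:)
  have ae: "AE t in lborel. ind01 t * wderiv ((lincomb c u d v) \<circ> ?l) t
     = ind01 t * (c * wderiv (u \<circ> ?l) t + d * wderiv (v \<circ> ?l) t)"
    by (intro wderiv_AE_eq H1C_D H1C_lincomb u v L2_unit_lincomb wderiv(1) wd)
  have mul: "(\<lambda>t. ind01 t *\<^sub>R (g t * h t)) \<in> borel_measurable lborel" if "L2_unit g" "L2_unit h" for g h
    using L2_unit_mult_integrable[OF that] unfolding set_integrable_def by (rule borel_measurable_integrable)
  have "dirichlet a b (lincomb c u d v) w
      = (LINT t:{0..1}|lborel. (c * wderiv (u \<circ> ?l) t + d * wderiv (v \<circ> ?l) t) * wderiv (w \<circ> ?l) t)"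
    unfolding dirichlet_def set_lebesgue_integral_def
  proof (rule integral_cong_AE)
    show "(\<lambda>t. ind01 t *\<^sub>R (wderiv ((lincomb c u d v) \<circ> ?l) t * wderiv (w \<circ> ?l) t)) \<in> borel_measurable lborel"
      by (intro mul wderiv H1C_D H1C_lincomb u v w)
    show "(\<lambda>t. ind01 t *\<^sub>R ((c * wderiv (u \<circ> ?l) t + d * wderiv (v \<circ> ?l) t) * wderiv (w \<circ> ?l) t)) \<in> borel_measurable lborel"
      by (intro mul wderiv L2_unit_lincomb h1)
    show "AE t in lborel. ind01 t *\<^sub>R (wderiv ((lincomb c u d v) \<circ> ?l) t * wderiv (w \<circ> ?l) t) =
       ind01 t *\<^sub>R ((c * wderiv (u \<circ> ?l) t + d * wderiv (v \<circ> ?l) t) * wderiv (w \<circ> ?l) t)"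
      using ae by eventually_elim (auto simp: indicator_def)
  qed
  also have "\<dots> = (LINT t:{0..1}|lborel. c * (wderiv (u \<circ> ?l) t * wderiv (w \<circ> ?l) t) + d * (wderiv (v \<circ> ?l) t * wderiv (w \<circ> ?l) t))"
    by (simp add: algebra_simps)
  also have "\<dots> = c * dirichlet a b u w + d * dirichlet a b v w"
    unfolding dirichlet_def by (intro set_integral_lincomb L2_unit_mult_integrable wderiv h1)
  finally show ?thesis .
qed

lemma dirichlet_lincomb:
  assumes u: "H1C a b u" and v: "H1C a b v"
  shows "dirichlet a b (lincomb c u d v) (lincomb c u d v)
    = c\<^sup>2 * dirichlet a b u u + 2 * c * d * dirichlet a b u v + d\<^sup>2 * dirichlet a b v v"
proof -
  note uv = H1C_lincomb[OF u v, of c d]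
  show ?thesis
    unfolding dirichlet_lincomb_left[OF u v uv] dirichlet_sym[of a b _ "\<lambda>x. c * u x + d * v x"]
      dirichlet_lincomb_left[OF u v u] dirichlet_lincomb_left[OF u v v] dirichlet_sym[of a b v u]
    by (simp add: power2_eq_square algebra_simps)
qed

lemma dirichlet_ge:
  assumes u: "H1C a b u"
  shows "(u a - u b)\<^sup>2 \<le> dirichlet a b u u"
  using weak_deriv_difference_square_le[OF H1C_D(2)[OF u] wderiv[OF H1C_D(1)[OF u]]]
  unfolding dirichlet_def by (simp add: linepath_0' linepath_1' power2_commute)

text \<open>The integral runs over the parameter in the unit interval, so the length of the segment
  does not enter; \<open>d\<close> is the difference of the end point values.\<close>

lemma
  assumes "\<And>t. t \<in> {0..1} \<Longrightarrow> u (linepath a b t) = c + t * d"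
  shows affine_H1_seg: "u \<in> H1_seg a b" and dirichlet_affine: "dirichlet a b u u = d\<^sup>2"
proof -
  have eq: "t \<in> {0..1} \<Longrightarrow> (u \<circ> linepath a b) t = c + t * d" for t using assms by simp
  show "u \<in> H1_seg a b"
    using H1_unit_cong[of "u \<circ> linepath a b", OF eq] affine_H1_unit[of c d] unfolding H1_seg_def by blast
  have d2: "L2_unit (\<lambda>_. d)" by (rule L2_unit_continuous) simp
  have w: "wderiv (u \<circ> linepath a b) = wderiv (\<lambda>t. c + t * d)" by (rule wderiv_cong[OF eq])
  have ae: "AE t in lborel. ind01 t * wderiv (\<lambda>t. c + t * d) t = ind01 t * d"
    by (intro wderiv_AE_eq affine_H1_unit affine_weak_deriv d2 continuous_intros)
  have "dirichlet a b u u = (LINT t::real:{0..1}|lborel. d * d)"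
    unfolding dirichlet_def set_lebesgue_integral_def w
  proof (rule integral_cong_AE)
    show "(\<lambda>t. ind01 t *\<^sub>R (wderiv (\<lambda>t. c + t * d) t * wderiv (\<lambda>t. c + t * d) t)) \<in> borel_measurable lborel"
      using L2_unit_mult_integrable[OF wderiv(1)[OF affine_H1_unit] wderiv(1)[OF affine_H1_unit]]
      unfolding set_integrable_def by (rule borel_measurable_integrable)
    show "AE t in lborel. ind01 t *\<^sub>R (wderiv (\<lambda>t. c + t * d) t * wderiv (\<lambda>t. c + t * d) t) = ind01 t *\<^sub>R (d * d)"
      using ae by eventually_elim (auto simp: indicator_def)
  qed simp
  also have "\<dots> = d\<^sup>2" by (simp add: set_integral_const power2_eq_square)
  finally show "dirichlet a b u u = d\<^sup>2" .
qed

declare One_nat_def [simp del]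

section \<open>Words\<close>

lemma words_fin_eq: "words_fin = {w. set w \<subseteq> idx}"
  unfolding words_fin_def words_def by auto

lemma finite_idx [simp]: "finite idx"
  unfolding idx_def by simp

lemma finite_words [simp]: "finite (words m)"
  unfolding words_def by (rule finite_lists_length_eq) simp

lemma finite_edges [simp]: "finite edges"
  unfolding edges_def by simp

lemma words_0 [simp]: "words 0 = {[]}"
  unfolding words_def by auto

lemma words_Suc: "words (Suc m) = (\<lambda>(i, w). i # w) ` (idx \<times> words m)"
  unfolding words_def by (auto simp: length_Suc_conv image_iff)

lemma words_add: "words (m + n) = (\<lambda>(v, w). v @ w) ` (words m \<times> words n)"
proof (intro set_eqI iffI)
  fix w assume "w \<in> words (m + n)"
  then have "take m w \<in> words m" "drop m w \<in> words n" "w = take m w @ drop m w"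
    unfolding words_def by (auto dest: in_set_takeD in_set_dropD)
  then show "w \<in> (\<lambda>(v, w). v @ w) ` (words m \<times> words n)"
    by (intro image_eqI[of _ _ "(take m w, drop m w)"]) auto
qed (auto simp: words_def)

lemma sum_words_add: "(\<Sum>w\<in>words (m + n). f w) = (\<Sum>v\<in>words m. \<Sum>w\<in>words n. f (v @ w))"
proof -
  have "inj_on (\<lambda>(v, w). v @ w) (words m \<times> words n)"
    by (auto simp: inj_on_def words_def)
  then have "(\<Sum>w\<in>words (m + n). f w) = (\<Sum>(v, w)\<in>words m \<times> words n. f (v @ w))"
    unfolding words_add by (simp add: sum.reindex case_prod_unfold o_def)
  then show ?thesis by (simp add: sum.cartesian_product)
qed

lemma sum_words_Suc: "(\<Sum>w\<in>words (Suc m). f w) = (\<Sum>i\<in>idx. \<Sum>w\<in>words m. f (i # w))"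
proof -
  have "inj_on (\<lambda>(i, w). i # w) (idx \<times> words m)" by (auto simp: inj_on_def)
  then have "(\<Sum>w\<in>words (Suc m). f w) = (\<Sum>(i, w)\<in>idx \<times> words m. f (i # w))"
    unfolding words_Suc by (simp add: sum.reindex case_prod_unfold o_def)
  then show ?thesis by (simp add: sum.cartesian_product)
qed

lemma words_fin_mono: "w \<in> words m \<Longrightarrow> w \<in> words_fin"
  unfolding words_fin_def by auto

lemma comp_word_append: "comp_word f (v @ w) = comp_word f v \<circ> comp_word f w"
  by (induction v) (auto simp: o_assoc)

lemma sum_idx: "(\<Sum>i\<in>idx. f i) = f 1 + f 2 + f (3::nat)"
  unfolding idx_def by (simp add: add.assoc)

lemma ball_idx: "(\<forall>i\<in>idx. P i) \<longleftrightarrow> P 1 \<and> P 2 \<and> P (3::nat)"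
  unfolding idx_def by simp

lemma sum_edges: "(\<Sum>(i, j)\<in>edges. f i j) = f 1 2 + f 2 3 + f 3 (1::nat)"
  unfolding edges_def by (simp add: add.assoc)

lemma edges_D: "(i, j) \<in> edges \<Longrightarrow> i \<in> idx \<and> j \<in> idx \<and> i \<noteq> j"
  unfolding edges_def idx_def by auto

section \<open>Geometry of the stretched gasket\<close>

locale gasket =
  fixes p :: "nat \<Rightarrow> plane" and \<alpha> :: real
  assumes triangle: "regular_triangle p" and alpha: "0 \<le> \<alpha>" "\<alpha> < 1"
begin

abbreviation "g \<equiv> G p \<alpha>"
abbreviation "gw \<equiv> Gw p \<alpha>"
abbreviation "tip \<equiv> pp p \<alpha>"
abbreviation "bridge \<equiv> seg p \<alpha>"
abbreviation "bridge_at \<equiv> segw p \<alpha>"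
abbreviation "bridge_form w i j \<equiv> dirichlet (gw w (tip i j)) (gw w (tip j i))"
abbreviation "FT \<equiv> F_tilde p \<alpha>"

definition \<beta> :: real where "\<beta> = (1 - \<alpha>) / 2"

lemma beta: "0 < \<beta>" "\<beta> \<le> 1 / 2" "\<beta> < 1"
  using alpha unfolding \<beta>_def by auto

text \<open>The Gram matrix solves a linear system: three unit side lengths, and the zero sum of the
  vertices paired with each vertex.\<close>

lemma inner_p:
  assumes "i \<in> idx" "j \<in> idx"
  shows "p i \<bullet> p j = (if i = j then 1 / 3 else - 1 / 6)"
proof -
  have d: "(dist (p i) (p j))\<^sup>2 = p i \<bullet> p i - 2 * (p i \<bullet> p j) + p j \<bullet> p j" for i j
    unfolding dist_norm power2_norm_eq_inner by (simp add: inner_diff_left inner_diff_right inner_commute)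
  have 1: "p 1 \<bullet> p 1 - 2 * (p 1 \<bullet> p 2) + p 2 \<bullet> p 2 = 1"
    "p 1 \<bullet> p 1 - 2 * (p 1 \<bullet> p 3) + p 3 \<bullet> p 3 = 1"
    "p 2 \<bullet> p 2 - 2 * (p 2 \<bullet> p 3) + p 3 \<bullet> p 3 = 1"
    using triangle d[of 1 2] d[of 1 3] d[of 2 3] unfolding regular_triangle_def idx_def by auto
  have "p i \<bullet> (p 1 + p 2 + p 3) = 0" for i using triangle unfolding regular_triangle_def by simp
  from this[of 1] this[of 2] this[of 3]
  have 2: "p 1 \<bullet> p 1 + p 1 \<bullet> p 2 + p 1 \<bullet> p 3 = 0" "p 1 \<bullet> p 2 + p 2 \<bullet> p 2 + p 2 \<bullet> p 3 = 0"
    "p 1 \<bullet> p 3 + p 2 \<bullet> p 3 + p 3 \<bullet> p 3 = 0"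
    unfolding inner_add_right by (simp_all add: inner_commute)
  have "p 1 \<bullet> p 1 = 1/3" "p 2 \<bullet> p 2 = 1/3" "p 3 \<bullet> p 3 = 1/3"
    "p 1 \<bullet> p 2 = -1/6" "p 1 \<bullet> p 3 = -1/6" "p 2 \<bullet> p 3 = -1/6"
    using 1 2 by linarith+
  moreover from this have "p 2 \<bullet> p 1 = -1/6" "p 3 \<bullet> p 1 = -1/6" "p 3 \<bullet> p 2 = -1/6"
    by (simp_all add: inner_commute)
  ultimately show ?thesis using assms unfolding idx_def by auto
qed

text \<open>The barycentric coordinates with respect to the triangle.\<close>

definition bary :: "nat \<Rightarrow> plane \<Rightarrow> real" where
  "bary i x = 1 / 3 + 2 * (p i \<bullet> x)"

lemma bary_p: "i \<in> idx \<Longrightarrow> j \<in> idx \<Longrightarrow> bary i (p j) = (if i = j then 1 else 0)"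
  unfolding bary_def by (simp add: inner_p)

lemma bary_p_neq [simp]:
  "i \<in> idx \<Longrightarrow> j \<in> idx \<Longrightarrow> i \<noteq> j \<Longrightarrow> bary i (p j) = 0" "i \<in> idx \<Longrightarrow> bary i (p i) = 1"
  by (auto simp: bary_p)

lemma bary_sum: "bary 1 x + bary 2 x + bary 3 x = 1"
proof -
  have "p 1 \<bullet> x + p 2 \<bullet> x + p 3 \<bullet> x = (p 1 + p 2 + p 3) \<bullet> x" by (simp add: inner_add_left)
  then show ?thesis using triangle unfolding bary_def regular_triangle_def by simp
qed

lemma bary_affine: "bary i (s *\<^sub>R x + t *\<^sub>R y) = s * bary i x + t * bary i y + (1 - s - t) / 3"
  unfolding bary_def by (simp add: inner_add_right field_simps)

lemma G_beta: "g i x = \<beta> *\<^sub>R x + (1 - \<beta>) *\<^sub>R p i"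
  unfolding G_def \<beta>_def[symmetric] by (simp add: algebra_simps)

lemma G_fixed [simp]: "g i (p i) = p i"
  unfolding G_def by simp

lemma bary_G: "bary i (g j x) = \<beta> * bary i x + (1 - \<beta>) * bary i (p j)"
  unfolding G_beta bary_affine by simp

lemma pp_beta: "tip i j = \<beta> *\<^sub>R p j + (1 - \<beta>) *\<^sub>R p i"
  unfolding pp_def G_beta ..

lemma continuous_on_bary: "continuous_on S (bary i)"
  unfolding bary_def[abs_def] by (intro continuous_intros)

text \<open>The closed triangle spanned by the vertices. The reconstruction of \<open>x\<close> from
  its coordinates is built in, so that points are identified by coordinates without a dimension
  argument.\<close>

definition T :: "plane set" where
  "T = {x. (\<forall>i\<in>idx. 0 \<le> bary i x) \<and> x = bary 1 x *\<^sub>R p 1 + bary 2 x *\<^sub>R p 2 + bary 3 x *\<^sub>R p 3}"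

lemma T_nonneg: "x \<in> T \<Longrightarrow> i \<in> idx \<Longrightarrow> 0 \<le> bary i x"
  unfolding T_def by auto

lemma T_le_1: "x \<in> T \<Longrightarrow> i \<in> idx \<Longrightarrow> bary i x \<le> 1"
  using T_nonneg[of x 1] T_nonneg[of x 2] T_nonneg[of x 3] bary_sum[of x]
  unfolding idx_def by auto

lemma T_vertex: assumes "x \<in> T" "i \<in> idx" "bary i x = 1" shows "x = p i"
proof -
  have nn: "0 \<le> bary 1 x" "0 \<le> bary 2 x" "0 \<le> bary 3 x"
    and x: "x = bary 1 x *\<^sub>R p 1 + bary 2 x *\<^sub>R p 2 + bary 3 x *\<^sub>R p 3"
    using assms(1) unfolding T_def idx_def by auto
  from assms(2) consider "i = 1" | "i = 2" | "i = 3" unfolding idx_def by auto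
  then show ?thesis
  proof cases
    case 1
    then have "bary 1 x = 1" "bary 2 x = 0" "bary 3 x = 0" using nn assms(3) bary_sum[of x] by auto
    then show ?thesis using x 1 by simp
  next
    case 2
    then have "bary 1 x = 0" "bary 2 x = 1" "bary 3 x = 0" using nn assms(3) bary_sum[of x] by auto
    then show ?thesis using x 2 by simp
  next
    case 3
    then have "bary 1 x = 0" "bary 2 x = 0" "bary 3 x = 1" using nn assms(3) bary_sum[of x] by auto
    then show ?thesis using x 3 by simp
  qed
qed

lemma p_in_T: "i \<in> idx \<Longrightarrow> p i \<in> T"
  unfolding T_def using bary_p[of 1 i] bary_p[of 2 i] bary_p[of 3 i]
  by (auto simp: idx_def)

lemma convex_T: assumes "x \<in> T" "y \<in> T" "0 \<le> s" "0 \<le> t" "s + t = 1" shows "s *\<^sub>R x + t *\<^sub>R y \<in> T"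
proof -
  have b: "bary i (s *\<^sub>R x + t *\<^sub>R y) = s * bary i x + t * bary i y" for i
    unfolding bary_affine using assms by (simp add: field_simps)
  have x: "x = bary 1 x *\<^sub>R p 1 + bary 2 x *\<^sub>R p 2 + bary 3 x *\<^sub>R p 3"
    and y: "y = bary 1 y *\<^sub>R p 1 + bary 2 y *\<^sub>R p 2 + bary 3 y *\<^sub>R p 3" using assms unfolding T_def by auto
  have "s *\<^sub>R x + t *\<^sub>R y = s *\<^sub>R (bary 1 x *\<^sub>R p 1 + bary 2 x *\<^sub>R p 2 + bary 3 x *\<^sub>R p 3)
     + t *\<^sub>R (bary 1 y *\<^sub>R p 1 + bary 2 y *\<^sub>R p 2 + bary 3 y *\<^sub>R p 3)"
    using x y by simp
  then show ?thesis unfolding T_def b mem_Collect_eq using assms T_nonneg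
    by (auto simp: algebra_simps)
qed

lemma G_in_T: "x \<in> T \<Longrightarrow> i \<in> idx \<Longrightarrow> g i x \<in> T"
  unfolding G_beta using beta by (intro convex_T p_in_T) auto

lemma closed_T: "closed T"
proof -
  have "T = (\<Inter>i\<in>idx. {x. 0 \<le> bary i x}) \<inter> {x. x = bary 1 x *\<^sub>R p 1 + bary 2 x *\<^sub>R p 2 + bary 3 x *\<^sub>R p 3}"
    unfolding T_def by auto
  moreover have "closed {x. 0 \<le> bary i x}" for i
    by (intro closed_Collect_le continuous_intros continuous_on_bary)
  moreover have "closed {x. x = bary 1 x *\<^sub>R p 1 + bary 2 x *\<^sub>R p 2 + bary 3 x *\<^sub>R p 3}"
    by (intro closed_Collect_eq continuous_intros continuous_on_bary)
  ultimately show ?thesis by (simp add: closed_Int closed_INT)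
qed

lemma bounded_T: "bounded T"
proof -
  have "norm x \<le> norm (p 1) + norm (p 2) + norm (p 3)" if x: "x \<in> T" for x
  proof -
    have "x = bary 1 x *\<^sub>R p 1 + bary 2 x *\<^sub>R p 2 + bary 3 x *\<^sub>R p 3" using x unfolding T_def by auto
    then have "norm x = norm (bary 1 x *\<^sub>R p 1 + bary 2 x *\<^sub>R p 2 + bary 3 x *\<^sub>R p 3)" by simp
    also have "\<dots> \<le> norm (bary 1 x *\<^sub>R p 1) + norm (bary 2 x *\<^sub>R p 2) + norm (bary 3 x *\<^sub>R p 3)"
      by (intro norm_triangle_le add_mono order_refl norm_triangle_ineq)
    also have "norm (bary i x *\<^sub>R p i) \<le> norm (p i)" if "i \<in> idx" for i
      using T_nonneg[OF x that] T_le_1[OF x that] by (simp add: mult_left_le_one_le)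
    then have "norm (bary 1 x *\<^sub>R p 1) + norm (bary 2 x *\<^sub>R p 2) + norm (bary 3 x *\<^sub>R p 3)
        \<le> norm (p 1) + norm (p 2) + norm (p 3)"
      by (intro add_mono) (auto simp: idx_def)
    finally show ?thesis .
  qed
  then show ?thesis unfolding bounded_iff by blast
qed

section \<open>The similitudes and their compositions along words\<close>

lemma Gw_affine: "gw w x = \<beta> ^ length w *\<^sub>R x + gw w 0"
proof (induction w arbitrary: x)
  case (Cons i w)
  have "gw (i # w) x = g i (\<beta> ^ length w *\<^sub>R x + gw w 0)" using Cons[of x] by simp
  moreover have "gw (i # w) 0 = g i (gw w 0)" by simp
  moreover have "g i (c *\<^sub>R x + y) = (\<beta> * c) *\<^sub>R x + g i y" for c y
    unfolding G_beta by (simp add: algebra_simps)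
  ultimately show ?case by simp
qed simp

lemma dist_Gw: "dist (gw w x) (gw w y) = \<beta> ^ length w * dist x y"
  unfolding Gw_affine[of w x] Gw_affine[of w y] dist_norm using beta by (simp flip: scaleR_diff_right)

lemma dist_G: "dist (g i x) (g i y) = \<beta> * dist x y"
  using dist_Gw[of "[i]" x y] by simp

lemma Gw_linepath: "gw w (linepath x y t) = linepath (gw w x) (gw w y) t"
  unfolding linepath_def Gw_affine[where x=x] Gw_affine[where x=y] Gw_affine[where x="(1 - t) *\<^sub>R x + t *\<^sub>R y"]
  by (simp add: algebra_simps)

lemma inj_G: "inj (g i)"
  by (rule injI) (use beta in \<open>simp add: G_beta\<close>)

lemma continuous_on_G: "continuous_on S (g i)"
  unfolding G_beta[abs_def] by (intro continuous_intros)

lemma continuous_on_Gw: "continuous_on S (gw w)"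
proof -
  have "gw w = (\<lambda>x. \<beta> ^ length w *\<^sub>R x + gw w 0)" by (rule ext) (rule Gw_affine)
  moreover have "continuous_on S \<dots>" by (intro continuous_intros)
  ultimately show ?thesis by (simp only:)
qed

lemma segw_eq: "bridge_at w i j = closed_segment (gw w (tip i j)) (gw w (tip j i))"
  unfolding segw_def seg_def linepath_image_01[symmetric] image_image Gw_linepath ..

lemma pp_in_T: "i \<in> idx \<Longrightarrow> j \<in> idx \<Longrightarrow> tip i j \<in> T"
  unfolding pp_def by (intro G_in_T p_in_T)

lemma seg_in_T: "i \<in> idx \<Longrightarrow> j \<in> idx \<Longrightarrow> bridge i j \<subseteq> T"
  unfolding seg_def closed_segment_def using convex_T[OF pp_in_T pp_in_T] by auto

subsection \<open>Attractors\<close>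

text \<open>A point of \<open>A\<close> is pulled back through the cells: either it meets
  \<open>C\<close> after finitely many steps, or its distance to \<open>B\<close> is contracted by
  \<beta> at every step and hence is zero. Leaving \<open>C\<close> and \<open>D\<close> independent
  lets one comparison give the uniqueness of both attractors, the inclusion of \<Sigma> in
  \<open>K\<close> and the decomposition of \<open>K\<close> into \<Sigma> and bridges.\<close>

lemma attractor_unique:
  assumes A: "compact A" "A = (\<Union>i\<in>idx. g i ` A) \<union> C"
    and B: "compact B" "B \<noteq> {}" "B = (\<Union>i\<in>idx. g i ` B) \<union> D"
    and x: "x \<in> A"
  shows "x \<in> B \<or> (\<exists>w\<in>words_fin. x \<in> gw w ` C)"
proof -
  define M where "M = (SUP x\<in>A. infdist x B)"
  have "compact ((\<lambda>x. infdist x B) ` A)"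
    by (intro compact_continuous_image continuous_on_infdist continuous_on_id A)
  then have "bdd_above ((\<lambda>x. infdist x B) ` A)" by (intro bounded_imp_bdd_above compact_imp_bounded)
  then have M: "infdist y B \<le> M" if "y \<in> A" for y
    unfolding M_def using that by (rule cSUP_upper2) simp
  have "(\<exists>w\<in>words_fin. y \<in> gw w ` C) \<or> infdist y B \<le> \<beta> ^ n * M" if "y \<in> A" for y n
    using that
  proof (induction n arbitrary: y)
    case 0 then show ?case using M by simp
  next
    case (Suc n)
    from Suc.prems have "y \<in> (\<Union>i\<in>idx. g i ` A) \<union> C" using A(2) by blast
    then consider "y \<in> C" | i z where "i \<in> idx" "z \<in> A" "y = g i z" by auto
    then show ?case
    proof cases
      case 1
      then show ?thesis by (intro disjI1 bexI[of _ "[]"]) (auto simp: words_fin_eq)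
    next
      case 2
      from Suc.IH[OF 2(2)] show ?thesis
      proof
        assume "\<exists>w\<in>words_fin. z \<in> gw w ` C"
        then obtain w c where "w \<in> words_fin" "c \<in> C" "z = gw w c" by auto
        then have "i # w \<in> words_fin" "y = gw (i # w) c" using 2 by (auto simp: words_fin_eq)
        then show ?thesis using \<open>c \<in> C\<close> by blast
      next
        assume z: "infdist z B \<le> \<beta> ^ n * M"
        obtain q where q: "q \<in> B" "infdist z B = dist z q"
          using infdist_attains_inf[OF compact_imp_closed[OF B(1)] B(2)] by metis
        have "g i q \<in> B" using q(1) 2(1) B(3) by blast
        then have "infdist y B \<le> dist y (g i q)" by (rule infdist_le)
        also have "\<dots> = \<beta> * infdist z B" unfolding 2 dist_G q ..
        also have "\<dots> \<le> \<beta> * (\<beta> ^ n * M)" using z beta by (intro mult_left_mono) auto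
        finally show ?thesis by simp
      qed
    qed
  qed
  then have *: "(\<exists>w\<in>words_fin. x \<in> gw w ` C) \<or> (\<forall>n. infdist x B \<le> \<beta> ^ n * M)" using x by blast
  have "(\<lambda>n. \<beta> ^ n * M) \<longlonglongrightarrow> 0"
    using beta by (intro tendsto_mult_left_zero LIMSEQ_power_zero) auto
  then have "infdist x B \<le> 0" if "\<forall>n. infdist x B \<le> \<beta> ^ n * M"
    using that by (intro LIMSEQ_le_const) auto
  then have "infdist x B = 0" if "\<forall>n. infdist x B \<le> \<beta> ^ n * M"
    using that infdist_nonneg[of x B] by fastforce
  then show ?thesis using * in_closed_iff_infdist_zero[OF compact_imp_closed[OF B(1)] B(2)] by blast
qed

lemma closure_G: "closure (g i ` S) = g i ` closure S"
proof -
  have "g i ` S = (\<lambda>x. (1 - \<beta>) *\<^sub>R p i + x) ` ((\<lambda>x. \<beta> *\<^sub>R x) ` S)" for S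
    by (auto simp: G_beta add.commute image_image)
  then show ?thesis by (simp only: closure_translation closure_scaleR)
qed

text \<open>The closure of the orbit of \<open>C\<close> and the vertices under all words. The
  vertices keep the set nonempty when \<open>C\<close> is empty, and they do not disturb the
  equation, because each is a fixed point of its own map.\<close>

lemma attractor_exists:
  assumes C: "compact C" "C \<subseteq> T"
  obtains A where "compact A" "A = (\<Union>i\<in>idx. g i ` A) \<union> C" "A \<subseteq> T" "p ` idx \<subseteq> A"
proof -
  let ?V = "p ` idx"
  define E where "E = (\<Union>w\<in>words_fin. gw w ` (C \<union> ?V))"
  have wf: "words_fin = insert [] ((\<lambda>(i, w). i # w) ` (idx \<times> words_fin))"
  proof (intro set_eqI iffI)
    fix w assume "w \<in> words_fin"
    then show "w \<in> insert [] ((\<lambda>(i, w). i # w) ` (idx \<times> words_fin))"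
      by (cases w) (auto simp: words_fin_eq image_iff)
  qed (auto simp: words_fin_eq)
  have E: "E = (\<Union>i\<in>idx. g i ` E) \<union> (C \<union> ?V)"
  proof -
    have "E = (C \<union> ?V) \<union> (\<Union>(i, w)\<in>idx \<times> words_fin. gw (i # w) ` (C \<union> ?V))"
      unfolding E_def by (subst wf) auto
    also have "(\<Union>(i, w)\<in>idx \<times> words_fin. gw (i # w) ` (C \<union> ?V)) = (\<Union>i\<in>idx. g i ` E)"
      unfolding E_def image_UN image_image by (auto simp: image_image)
    finally show ?thesis by blast
  qed
  have ET: "E \<subseteq> T"
  proof -
    have "gw w x \<in> T" if "set w \<subseteq> idx" "x \<in> T" for w x
      using that by (induction w) (auto intro: G_in_T)
    then show ?thesis unfolding E_def words_fin_eq using C p_in_T by auto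
  qed
  have V: "?V \<subseteq> closure E" using E closure_subset[of E] by blast
  have "closure E = closure ((\<Union>i\<in>idx. g i ` E) \<union> (C \<union> ?V))" by (rule arg_cong[OF E])
  also have "\<dots> = (\<Union>i\<in>idx. g i ` closure E) \<union> (C \<union> ?V)"
  proof -
    have "closure (C \<union> ?V) = C \<union> ?V"
      using C by (intro closure_closed closed_Un compact_imp_closed finite_imp_closed) auto
    moreover have "closure (\<Union>i\<in>idx. g i ` E) = (\<Union>i\<in>idx. g i ` closure E)"
      by (simp add: idx_def closure_Un closure_G)
    ultimately show ?thesis by (simp only: closure_Un)
  qed
  also have "\<dots> = (\<Union>i\<in>idx. g i ` closure E) \<union> C"
  proof -
    have "p i \<in> g i ` closure E" if "i \<in> idx" for i
      using V that by (intro image_eqI[of _ _ "p i"]) auto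
    then show ?thesis by blast
  qed
  finally have "closure E = (\<Union>i\<in>idx. g i ` closure E) \<union> C" .
  moreover have "closure E \<subseteq> T" by (rule closure_minimal[OF ET closed_T])
  moreover from this have "compact (closure E)"
    using bounded_T bounded_subset by (auto simp: compact_eq_bounded_closed)
  ultimately show ?thesis using V that by blast
qed

section \<open>The two attractors, their cells and bridges\<close>

abbreviation "K \<equiv> ssg_K p \<alpha>"
abbreviation "\<Sigma> \<equiv> ssg_Sigma p \<alpha>"

definition bridges :: "plane set" where
  "bridges = bridge 1 2 \<union> bridge 2 3 \<union> bridge 3 1"

lemma bridges_eq: "bridges = (\<Union>(i, j)\<in>edges. bridge i j)"
  unfolding bridges_def edges_def by auto

lemma compact_bridges: "compact bridges"
  unfolding bridges_def seg_def by (intro compact_Un compact_segment)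

lemma bridges_T: "bridges \<subseteq> T"
  unfolding bridges_def using seg_in_T by (auto simp: idx_def)

text \<open>Every solution of the equation is nonempty because of the bridges and contains all
  images of the bridges under words; so the comparison of attractors applies in both directions and
  settles the definite description.\<close>

lemma K: "compact K" "K = (\<Union>i\<in>idx. g i ` K) \<union> bridges" "K \<subseteq> T" "p ` idx \<subseteq> K"
proof -
  obtain A where A: "compact A" "A = (\<Union>i\<in>idx. g i ` A) \<union> bridges" "A \<subseteq> T" "p ` idx \<subseteq> A"
    using attractor_exists[OF compact_bridges bridges_T] .
  have br: "bridges \<noteq> {}" unfolding bridges_def seg_def by auto
  have w: "x \<in> B" if "B = (\<Union>i\<in>idx. g i ` B) \<union> bridges" "w \<in> words_fin" "x \<in> gw w ` bridges" for B w x
    using that(2,3)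
  proof (induction w arbitrary: x)
    case Nil then have "x \<in> bridges" by simp then show ?case using that(1) by blast
  next
    case (Cons i w)
    then obtain y where "y \<in> gw w ` bridges" "x = g i y" by auto
    moreover from this have "y \<in> B" using Cons.IH[of y] Cons.prems by (simp add: words_fin_eq)
    moreover have "i \<in> idx" using Cons.prems by (simp add: words_fin_eq)
    ultimately show ?case using that(1) by blast
  qed
  have u: "B \<subseteq> B'" if B: "compact B" "B = (\<Union>i\<in>idx. g i ` B) \<union> bridges"
    and B': "compact B'" "B' = (\<Union>i\<in>idx. g i ` B') \<union> bridges" for B B'
  proof
    fix x assume "x \<in> B"
    have "B' \<noteq> {}" using B'(2) br by blast
    then show "x \<in> B'" using attractor_unique[OF B B'(1) _ B'(2) \<open>x \<in> B\<close>] w[OF B'(2)] by blast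
  qed
  have "K = A"
    unfolding ssg_K_def bridges_def[symmetric]
  proof (rule the_equality)
    show "compact A \<and> A = (\<Union>i\<in>idx. g i ` A) \<union> bridges" using A by blast
    show "B = A" if "compact B \<and> B = (\<Union>i\<in>idx. g i ` B) \<union> bridges" for B
      using that A(1,2) u[of A B] u[of B A] by blast
  qed
  then show "compact K" "K = (\<Union>i\<in>idx. g i ` K) \<union> bridges" "K \<subseteq> T" "p ` idx \<subseteq> K" using A by metis+
qed

lemma Sigma: "compact \<Sigma>" "\<Sigma> = (\<Union>i\<in>idx. g i ` \<Sigma>)" "\<Sigma> \<subseteq> T" "p ` idx \<subseteq> \<Sigma>" "\<Sigma> \<noteq> {}"
proof -
  obtain A where A: "compact A" "A = (\<Union>i\<in>idx. g i ` A) \<union> {}" "A \<subseteq> T" "p ` idx \<subseteq> A"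
    using attractor_exists[of "{}"] by auto
  have ne: "A \<noteq> {}" using A(4) by (auto simp: idx_def)
  have "\<Sigma> = A"
    unfolding ssg_Sigma_def
  proof (rule the_equality)
    show "compact A \<and> A \<noteq> {} \<and> A = (\<Union>i\<in>idx. g i ` A)" using A(1,2) ne by blast
    fix B assume "compact B \<and> B \<noteq> {} \<and> B = (\<Union>i\<in>idx. g i ` B)"
    then have B: "compact B" "B \<noteq> {}" "B = (\<Union>i\<in>idx. g i ` B) \<union> {}" by blast+
    show "B = A"
      using attractor_unique[OF A(1,2) B] attractor_unique[OF B(1,3) A(1) ne A(2)] by blast
  qed
  then show "compact \<Sigma>" "\<Sigma> = (\<Union>i\<in>idx. g i ` \<Sigma>)" "\<Sigma> \<subseteq> T" "p ` idx \<subseteq> \<Sigma>" "\<Sigma> \<noteq> {}" using A ne by (metis Un_empty_right)+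
qed

lemma p_in_K: "i \<in> idx \<Longrightarrow> p i \<in> K" using K(4) by auto
lemma p_in_Sigma: "i \<in> idx \<Longrightarrow> p i \<in> \<Sigma>" using Sigma(4) by auto
lemma K_in_T: "x \<in> K \<Longrightarrow> x \<in> T" using K(3) by auto

lemma G_in_K: "i \<in> idx \<Longrightarrow> x \<in> K \<Longrightarrow> g i x \<in> K"
  using K(2) by blast

lemma Gw_in_K: "w \<in> words_fin \<Longrightarrow> x \<in> K \<Longrightarrow> gw w x \<in> K"
  by (induction w) (auto simp: words_fin_eq intro: G_in_K)

lemma G_in_Sigma: "i \<in> idx \<Longrightarrow> x \<in> \<Sigma> \<Longrightarrow> g i x \<in> \<Sigma>"
  using Sigma(2) by blast

lemma Gw_in_Sigma: "w \<in> words_fin \<Longrightarrow> x \<in> \<Sigma> \<Longrightarrow> gw w x \<in> \<Sigma>"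
  by (induction w) (auto simp: words_fin_eq intro: G_in_Sigma)

lemma seg_in_K: "(i, j) \<in> edges \<Longrightarrow> bridge i j \<subseteq> K"
  using K(2) unfolding bridges_eq by blast

lemma segw_in_K: "w \<in> words_fin \<Longrightarrow> (i, j) \<in> edges \<Longrightarrow> bridge_at w i j \<subseteq> K"
  unfolding segw_def using seg_in_K Gw_in_K by blast

lemma Sigma_subset_K: "\<Sigma> \<subseteq> K"
proof
  fix x assume "x \<in> \<Sigma>"
  have "K \<noteq> {}" using p_in_K[of 1] by (auto simp: idx_def)
  then show "x \<in> K"
    using attractor_unique[OF Sigma(1) _ K(1) _ K(2) \<open>x \<in> \<Sigma>\<close>, of "{}"] Sigma(2) by blast
qed

lemma K_cases: "x \<in> K \<Longrightarrow> x \<in> \<Sigma> \<or> (\<exists>w\<in>words_fin. \<exists>(i, j)\<in>edges. x \<in> bridge_at w i j)"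
proof -
  assume x: "x \<in> K"
  have "\<Sigma> = (\<Union>i\<in>idx. g i ` \<Sigma>) \<union> {}" using Sigma(2) by blast
  from attractor_unique[OF K(1,2) Sigma(1,5) this x]
  consider "x \<in> \<Sigma>" | w y where "w \<in> words_fin" "y \<in> bridges" "x = gw w y" by blast
  then show ?thesis
  proof cases
    case 2
    then obtain i j where "(i, j) \<in> edges" "y \<in> bridge i j" unfolding bridges_eq by auto
    then have "x \<in> bridge_at w i j" using 2 unfolding segw_def by simp
    then show ?thesis using 2(1) \<open>(i, j) \<in> edges\<close> by blast
  qed simp
qed

lemma K_level_cases:
  assumes "x \<in> K"
  shows "(\<exists>w\<in>words m. x \<in> gw w ` K) \<or> (\<exists>w\<in>words_fin. length w < m \<and> (\<exists>(i, j)\<in>edges. x \<in> bridge_at w i j))"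
  using assms
proof (induction m arbitrary: x)
  case (Suc m)
  from Suc.prems K(2) consider "x \<in> bridges" | i y where "i \<in> idx" "y \<in> K" "x = g i y" by blast
  then show ?case
  proof cases
    case 1
    then obtain i j where "(i, j) \<in> edges" "x \<in> bridge_at [] i j" unfolding bridges_eq segw_def by auto
    moreover have "[] \<in> words_fin" "length [] < Suc m" by (simp_all add: words_fin_eq)
    ultimately show ?thesis by blast
  next
    case 2
    from Suc.IH[OF 2(2)] show ?thesis
    proof
      assume "\<exists>w\<in>words m. y \<in> gw w ` K"
      then obtain w z where "w \<in> words m" "z \<in> K" "y = gw w z" by auto
      then have "i # w \<in> words (Suc m)" "x = gw (i # w) z" using 2 by (auto simp: words_def)
      then show ?thesis using \<open>z \<in> K\<close> by blast
    next
      assume "\<exists>w\<in>words_fin. length w < m \<and> (\<exists>(i, j)\<in>edges. y \<in> bridge_at w i j)"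
      then obtain w k l where "w \<in> words_fin" "length w < m" "(k, l) \<in> edges" "y \<in> bridge_at w k l" by auto
      then have "i # w \<in> words_fin" "length (i # w) < Suc m" "x \<in> bridge_at (i # w) k l"
        using 2 by (auto simp: words_fin_eq segw_def)
      then show ?thesis using \<open>(k, l) \<in> edges\<close> by blast
    qed
  qed
next
  case 0
  then show ?case by (intro disjI1) simp
qed

end

section \<open>Gluing along cells and piecewise harmonic functions\<close>

context gasket
begin

section \<open>Position of the bridges relative to the cells\<close>

lemma seg_bary:
  assumes "(i, j) \<in> edges" "x \<in> bridge i j"
  obtains t where "0 \<le> t" "t \<le> 1" "x = linepath (tip i j) (tip j i) t"
    "bary i x = (1 - \<beta>) - t * \<alpha>" "bary j x = \<beta> + t * \<alpha>"
    "\<And>k. k \<in> idx \<Longrightarrow> k \<noteq> i \<Longrightarrow> k \<noteq> j \<Longrightarrow> bary k x = 0"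
proof -
  obtain t where t: "0 \<le> t" "t \<le> 1" "x = linepath (tip i j) (tip j i) t"
    using assms(2) unfolding seg_def linepath_image_01[symmetric] by auto
  have ij: "i \<in> idx" "j \<in> idx" "i \<noteq> j" using edges_D[OF assms(1)] by auto
  have b: "bary k x = (1 - t) * (\<beta> * bary k (p j) + (1 - \<beta>) * bary k (p i)) + t * (\<beta> * bary k (p i) + (1 - \<beta>) * bary k (p j))" for k
    unfolding t(3) linepath_def bary_affine pp_def bary_G by simp
  show ?thesis
  proof (rule that[OF t])
    show "bary i x = (1 - \<beta>) - t * \<alpha>" "bary j x = \<beta> + t * \<alpha>"
      unfolding b \<beta>_def using ij by (simp_all add: field_simps)
    show "bary k x = 0" if "k \<in> idx" "k \<noteq> i" "k \<noteq> j" for k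
      unfolding b using ij that by simp
  qed
qed

lemma dist_pp: "i \<in> idx \<Longrightarrow> j \<in> idx \<Longrightarrow> i \<noteq> j \<Longrightarrow> dist (tip i j) (tip j i) = \<alpha>"
proof -
  assume "i \<in> idx" "j \<in> idx" "i \<noteq> j"
  then have 1: "dist (p i) (p j) = 1" using triangle unfolding regular_triangle_def by auto
  have "tip i j - tip j i = \<alpha> *\<^sub>R (p i - p j)"
    unfolding pp_beta \<beta>_def by (simp add: vec_eq_iff field_simps)
  then show ?thesis using 1 alpha unfolding dist_norm by simp
qed

lemma pp_collapse: "\<alpha> = 0 \<Longrightarrow> tip i j = tip j i"
  unfolding pp_beta \<beta>_def by (simp add: add.commute)

definition G_inv :: "nat \<Rightarrow> plane \<Rightarrow> plane" where
  "G_inv i x = (1 / \<beta>) *\<^sub>R (x - (1 - \<beta>) *\<^sub>R p i)"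

lemma G_inv [simp]: "G_inv i (g i x) = x"
  unfolding G_inv_def G_beta using beta by simp

lemma continuous_on_G_inv: "continuous_on S (G_inv i)"
  unfolding G_inv_def[abs_def] by (intro continuous_intros)

text \<open>The cell of the index \<open>i\<close> is the part of the triangle where the \<open>i\<close>-th barycentric
  coordinate is at least \<open>1 - \<beta>\<close>.\<close>

definition glue :: "(nat \<Rightarrow> plane \<Rightarrow> real) \<Rightarrow> (plane \<Rightarrow> real) \<Rightarrow> plane \<Rightarrow> real" where
  "glue v e x =
     (if 1 - \<beta> \<le> bary 1 x then v 1 (G_inv 1 x)
      else if 1 - \<beta> \<le> bary 2 x then v 2 (G_inv 2 x)
      else if 1 - \<beta> \<le> bary 3 x then v 3 (G_inv 3 x)
      else e x)"

text \<open>Agreement at the tips of the bridges. For \<alpha> = 0 the two tips of a bridge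
  coincide, and the condition then also makes neighbouring cells agree at their common
  point.\<close>

definition matching :: "(nat \<Rightarrow> plane \<Rightarrow> real) \<Rightarrow> (plane \<Rightarrow> real) \<Rightarrow> bool" where
  "matching v e \<longleftrightarrow> (\<forall>i\<in>idx. \<forall>j\<in>idx. i \<noteq> j \<longrightarrow> v i (p j) = e (tip i j))"

lemma glue_unique:
  assumes "\<And>i. i \<in> idx \<Longrightarrow> 1 - \<beta> \<le> bary i x \<Longrightarrow> v i (G_inv i x) = c"
    and "(\<forall>i\<in>idx. bary i x < 1 - \<beta>) \<Longrightarrow> e x = c"
  shows "glue v e x = c"
  using assms(1)[of 1] assms(1)[of 2] assms(1)[of 3] assms(2) unfolding glue_def by (auto simp: idx_def)

text \<open>The order of the tests in \<open>glue\<close> could matter only at a point of two cells.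
  That forces \<beta> = 1/2 and \<open>x = p j\<close>, the common vertex of the two cells, where
  the matching condition makes both candidates equal.\<close>

lemma glue_cell:
  assumes m: "matching v e" and i: "i \<in> idx" and x: "x \<in> T"
  shows "glue v e (g i x) = v i x"
proof (rule glue_unique)
  fix j assume j: "j \<in> idx" "1 - \<beta> \<le> bary j (g i x)"
  show "v j (G_inv j (g i x)) = v i x"
  proof (cases "j = i")
    case False
    have le: "bary j x \<le> 1" by (rule T_le_1[OF x j(1)])
    have "1 - \<beta> \<le> \<beta> * bary j x" using j i False by (simp add: bary_G)
    also have "\<dots> \<le> \<beta>" using le beta by (simp add: mult_left_le)
    finally have b: "\<beta> = 1 / 2" using beta by auto
    then have "\<alpha> = 0" unfolding \<beta>_def by simp
    have "bary j x = 1" using j i False le b by (simp add: bary_G)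
    then have xj: "x = p j" by (rule T_vertex[OF x j(1)])
    have "g i x = g j (p i)" using pp_collapse[OF \<open>\<alpha> = 0\<close>, of i j] unfolding pp_def xj .
    then have "v j (G_inv j (g i x)) = v j (p i)" by simp
    also have "\<dots> = v i (p j)"
      using m i j False pp_collapse[OF \<open>\<alpha> = 0\<close>, of i j] unfolding matching_def by metis
    finally show ?thesis unfolding xj .
  qed simp
next
  assume "\<forall>j\<in>idx. bary j (g i x) < 1 - \<beta>"
  then have "\<beta> * bary i x < 0" using i by (auto simp: bary_G)
  then have False using beta T_nonneg[OF x i] by (simp add: mult_less_0_iff)
  then show "e (g i x) = v i x" ..
qed

text \<open>Along a bridge the coordinate of either cell it joins falls below
  \<open>1 - \<beta>\<close> as soon as the tip is left; for \<alpha> = 0 the bridge is nothing but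
  its tip.\<close>

lemma seg_cell_endpoint:
  assumes ij: "(i, j) \<in> edges" and x: "x \<in> bridge i j" and k: "k \<in> idx" "1 - \<beta> \<le> bary k x"
  shows "(k = i \<and> x = tip i j) \<or> (k = j \<and> x = tip j i)"
proof -
  obtain t where t: "0 \<le> t" "t \<le> 1" "x = linepath (tip i j) (tip j i) t"
    "bary i x = (1 - \<beta>) - t * \<alpha>" "bary j x = \<beta> + t * \<alpha>"
    "\<And>k. k \<in> idx \<Longrightarrow> k \<noteq> i \<Longrightarrow> k \<noteq> j \<Longrightarrow> bary k x = 0"
    using seg_bary[OF ij x] by blast
  have "0 < 1 - \<beta>" using beta by simp
  then consider "k = i" | "k = j" using t(6)[OF k(1)] k(2) by force
  then show ?thesis
  proof cases
    case 1
    then have "t * \<alpha> \<le> 0" using k t by simp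
    then have "t = 0 \<or> \<alpha> = 0" using t alpha by (auto simp: mult_le_0_iff)
    then show ?thesis using 1 t(3) pp_collapse[of i j] by (auto simp: linepath_def simp flip: scaleR_add_left)
  next
    case 2
    then have "(1 - t) * \<alpha> \<le> 0" using k t by (simp add: \<beta>_def field_simps)
    then have "t = 1 \<or> \<alpha> = 0" using t alpha by (auto simp: mult_le_0_iff)
    then show ?thesis using 2 t(3) pp_collapse[of i j] by (auto simp: linepath_def simp flip: scaleR_add_left)
  qed
qed

lemma glue_edge:
  assumes m: "matching v e" and ij: "(i, j) \<in> edges" and x: "x \<in> bridge i j"
  shows "glue v e x = e x"
proof (rule glue_unique)
  fix k assume "k \<in> idx" "1 - \<beta> \<le> bary k x"
  from seg_cell_endpoint[OF ij x this]
  show "v k (G_inv k x) = e x"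
  proof (elim disjE conjE)
    assume "k = i" "x = tip i j"
    then show ?thesis using m edges_D[OF ij] unfolding matching_def pp_def by simp
  next
    assume "k = j" "x = tip j i"
    then show ?thesis using m edges_D[OF ij] unfolding matching_def pp_def by simp
  qed
qed simp

lemma continuous_on_glue:
  assumes m: "matching v e" and v: "\<And>i. i \<in> idx \<Longrightarrow> continuous_on K (v i)"
    and e: "\<And>i j. (i, j) \<in> edges \<Longrightarrow> continuous_on (bridge i j) e"
  shows "continuous_on K (glue v e)"
proof -
  have c: "continuous_on (g i ` K) (glue v e)" if "i \<in> idx" for i
  proof (rule continuous_on_eq)
    show "continuous_on (g i ` K) (\<lambda>x. v i (G_inv i x))"
      by (rule continuous_on_compose2[OF v[OF that] continuous_on_G_inv]) auto
    show "v i (G_inv i x) = glue v e x" if "x \<in> g i ` K" for x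
      using that glue_cell[OF m \<open>i \<in> idx\<close>] K_in_T by auto
  qed
  have s: "continuous_on (bridge i j) (glue v e)" if "(i, j) \<in> edges" for i j
    using continuous_on_eq[OF e[OF that]] glue_edge[OF m that] by simp
  have cl: "closed (g i ` K)" for i
    by (intro compact_imp_closed compact_continuous_image continuous_on_G K)
  have cs: "closed (bridge i j)" for i j unfolding seg_def by (rule closed_segment)
  have eq: "K = g 1 ` K \<union> (g 2 ` K \<union> (g 3 ` K \<union> (bridge 1 2 \<union> (bridge 2 3 \<union> bridge 3 1))))" (is "_ = ?U")
    using K(2) unfolding bridges_def idx_def by blast
  have "continuous_on ?U (glue v e)"
    by (intro continuous_on_closed_Un closed_Un cl cs c s) (auto simp: idx_def edges_def)
  then show ?thesis using eq by (rule ssubst[rotated])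
qed

text \<open>Interpolation along the three bridges; on a bridge, \<open>dist x (tip i j) / \<alpha>\<close> is the affine
  parameter (for \<open>\<alpha> = 0\<close> the bridge is a point and the quotient is 0).\<close>

definition interp :: "nat \<Rightarrow> nat \<Rightarrow> (nat \<Rightarrow> nat \<Rightarrow> real) \<Rightarrow> plane \<Rightarrow> real" where
  "interp i j c x = c i j + dist x (tip i j) / \<alpha> * (c j i - c i j)"

definition interps :: "(nat \<Rightarrow> nat \<Rightarrow> real) \<Rightarrow> plane \<Rightarrow> real" where
  "interps c x = (if x \<in> bridge 1 2 then interp 1 2 c x
     else if x \<in> bridge 2 3 then interp 2 3 c x else interp 3 1 c x)"

text \<open>A point of a bridge has exactly two positive barycentric coordinates, and their indices
  name the bridge.\<close>

lemma seg_disjoint: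
  assumes "(i, j) \<in> edges" "(k, l) \<in> edges" "x \<in> bridge i j" "x \<in> bridge k l"
  shows "(i, j) = (k, l)"
proof -
  have pos: "0 < bary i x \<and> 0 < bary j x" if e: "(i, j) \<in> edges" "x \<in> bridge i j" for i j
  proof -
    obtain t where t: "0 \<le> t" "t \<le> 1" "bary i x = (1 - \<beta>) - t * \<alpha>" "bary j x = \<beta> + t * \<alpha>"
      using seg_bary[OF e] by metis
    have "t * \<alpha> \<le> \<alpha>" using t alpha by (simp add: mult_left_le_one_le)
    moreover have "0 \<le> t * \<alpha>" using t alpha by simp
    moreover have "1 - \<beta> = \<beta> + \<alpha>" unfolding \<beta>_def by (simp add: field_simps)
    ultimately show ?thesis unfolding t using beta(1) by (intro conjI) linarith+
  qed
  have zero: "k \<in> {i, j}" if "k \<in> idx" "(i, j) \<in> edges" "x \<in> bridge i j" "0 < bary k x" for i j k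
    using seg_bary[OF that(2,3)] that(1,4) by (metis insert_iff less_irrefl)
  have "i \<in> {k, l}" "j \<in> {k, l}"
    using pos[OF assms(1,3)] edges_D[OF assms(1)] zero[OF _ assms(2,4), of i] zero[OF _ assms(2,4), of j] by blast+
  then show ?thesis using assms(1,2) by (auto simp: edges_def)
qed

lemma interps_edge:
  assumes "(i, j) \<in> edges" "x \<in> bridge i j"
  shows "interps c x = interp i j c x"
proof -
  have e: "(1, 2) \<in> edges" "(2, 3) \<in> edges" "(3, 1) \<in> edges" unfolding edges_def by auto
  have "(i, j) = (1, 2) \<or> (i, j) = (2, 3) \<or> (i, j) = (3, 1)" using assms(1) unfolding edges_def by auto
  then show ?thesis
    using assms(2) seg_disjoint[OF e(1) e(2), of x] seg_disjoint[OF e(1) e(3), of x] seg_disjoint[OF e(2) e(3), of x]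
    unfolding interps_def by auto
qed

text \<open>At the far tip the parameter is \<open>\<alpha> / \<alpha>\<close>, which is 1 except
  for \<alpha> = 0, where it is 0 by convention; there the two tips are one point and the prescribed
  values must be symmetric.\<close>

lemma interps_pp:
  assumes c: "\<alpha> = 0 \<Longrightarrow> \<forall>i j. c i j = c j i" and ij: "i \<in> idx" "j \<in> idx" "i \<noteq> j"
  shows "interps c (tip i j) = c i j"
proof -
  have s: "tip i j \<in> bridge i j" "tip i j \<in> bridge j i" for i j unfolding seg_def by auto
  consider "(i, j) \<in> edges" | "(j, i) \<in> edges" using ij unfolding idx_def edges_def by auto
  then show ?thesis
  proof cases
    case 1
    then show ?thesis using interps_edge[OF 1 s(1)] by (simp add: interp_def)
  next
    case 2
    have "interps c (tip i j) = c j i + \<alpha> / \<alpha> * (c i j - c j i)"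
      by (simp only: interps_edge[OF 2 s(2)] interp_def dist_pp[OF ij])
    moreover have "c i j = c j i" if "\<alpha> = 0" using c[OF that] by blast
    ultimately show ?thesis by (cases "\<alpha> = 0") simp_all
  qed
qed

lemma continuous_on_interps: "(i, j) \<in> edges \<Longrightarrow> continuous_on (bridge i j) (interps c)"
  by (rule continuous_on_eq[of _ "interp i j c"])
    (auto simp: interps_edge interp_def[abs_def] divide_inverse intro!: continuous_intros)

lemma interps_linepath:
  assumes ij: "(i, j) \<in> edges" and t: "t \<in> {0..1}"
  shows "interps c (linepath (tip i j) (tip j i) t) = c i j + t * (if \<alpha> = 0 then 0 else c j i - c i j)"
proof -
  have "linepath (tip i j) (tip j i) t \<in> bridge i j"
    unfolding seg_def using t by (intro linepath_in_path) auto
  moreover have "dist (linepath (tip i j) (tip j i) t) (tip i j) = t * \<alpha>"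
  proof -
    have "linepath (tip i j) (tip j i) t - tip i j = t *\<^sub>R (tip j i - tip i j)"
      unfolding linepath_def by (simp add: algebra_simps)
    then show ?thesis using t dist_pp[of j i] edges_D[OF ij] unfolding dist_norm by auto
  qed
  ultimately show ?thesis using interps_edge[OF ij] by (simp add: interp_def)
qed

text \<open>The values at the vertices of the \<open>i\<close>-th cell of the function that is harmonic for the network
  consisting of the three cells and three bridges, with boundary values \<open>a\<close>. The parameter \<open>l\<close>
  encodes the share of the cells in the total resistance: \<open>l = 0\<close> makes all cells
  equipotential, \<open>l = 1/5\<close> makes all bridges equipotential.\<close>

definition subvals :: "real \<Rightarrow> (nat \<Rightarrow> real) \<Rightarrow> nat \<Rightarrow> nat \<Rightarrow> real" where
  "subvals l a i j = (if i = j then a i else (1 - 4 * l) * a i + l * a j + l * (a 1 + a 2 + a 3))"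

text \<open>One parameter for each successive subdivision. The range makes \<open>5 * l k\<close> a
  number in the unit interval; bridges that are points cannot carry a difference, which leaves only
  1/5 when \<alpha> = 0.\<close>

definition admissible :: "(nat \<Rightarrow> real) \<Rightarrow> bool" where
  "admissible l \<longleftrightarrow> (\<forall>k. 0 \<le> l k \<and> l k \<le> 1 / 5 \<and> (\<alpha> = 0 \<longrightarrow> l k = 1 / 5))"

lemma admissible_Suc: "admissible l \<Longrightarrow> admissible (\<lambda>k. l (Suc k))"
  unfolding admissible_def by auto

lemma subvals_self [simp]: "subvals l a i i = a i"
  unfolding subvals_def by simp

lemma interps_subvals_pp:
  assumes "admissible l" "i \<in> idx" "j \<in> idx" "i \<noteq> j"
  shows "interps (subvals (l 0) a) (tip i j) = subvals (l 0) a i j"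
proof (rule interps_pp[OF _ assms(2-)])
  assume "\<alpha> = 0"
  then have "l 0 = 1 / 5" using assms(1) unfolding admissible_def by blast
  then show "\<forall>i j. subvals (l 0) a i j = subvals (l 0) a j i" unfolding subvals_def by (auto simp: field_simps)
qed

section \<open>Oscillation bounds and approximations of the extension\<close>

definition osc_le :: "real \<Rightarrow> (nat \<Rightarrow> real) \<Rightarrow> bool" where
  "osc_le D a \<longleftrightarrow> (\<forall>i\<in>idx. \<forall>j\<in>idx. \<bar>a i - a j\<bar> \<le> D)"

lemma osc_leI:
  assumes "\<bar>a 1 - a 2\<bar> \<le> D" "\<bar>a 1 - a 3\<bar> \<le> D" "\<bar>a 2 - a 3\<bar> \<le> D"
  shows "osc_le D a"
proof -
  have "0 \<le> D" using assms(1) by (rule order_trans[OF abs_ge_zero])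
  moreover have "\<bar>a 2 - a 1\<bar> \<le> D" "\<bar>a 3 - a 1\<bar> \<le> D" "\<bar>a 3 - a 2\<bar> \<le> D"
    by (subst abs_minus_commute, rule assms)+
  ultimately show ?thesis
    unfolding osc_le_def ball_idx using assms by (intro conjI) (simp_all only: diff_self abs_zero)
qed

text \<open>Any difference of two vertex values of a subcell is \<open>l\<close> times a sum of at
  most three differences of \<open>a\<close>, and \<open>l\<close> is at most 1/5.\<close>

lemma osc_le_subvals:
  assumes l: "0 \<le> l" "l \<le> 1 / 5" and a: "osc_le D a" and i: "i \<in> idx"
  shows "osc_le (3 / 5 * D) (subvals l a i)"
proof -
  have D: "\<bar>a 1 - a 2\<bar> \<le> D" "\<bar>a 1 - a 3\<bar> \<le> D" "\<bar>a 2 - a 3\<bar> \<le> D"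
    using a unfolding osc_le_def idx_def by auto
  then have D0: "0 \<le> D" by simp
  have b: "\<bar>l * z\<bar> \<le> 3 / 5 * D" if "\<bar>z\<bar> \<le> 3 * D" for z
  proof -
    have "\<bar>l * z\<bar> = l * \<bar>z\<bar>" using l by (simp add: abs_mult)
    also have "\<dots> \<le> 1 / 5 * (3 * D)" using l that D0 by (intro mult_mono) auto
    finally show ?thesis by simp
  qed
  have d: "\<bar>subvals l a i j - subvals l a i k\<bar> \<le> 3 / 5 * D"
    if "subvals l a i j - subvals l a i k = l * z" "\<bar>z\<bar> \<le> 3 * D" for i j k z
    unfolding that(1) by (rule b[OF that(2)])
  consider "i = 1" | "i = 2" | "i = 3" using i unfolding idx_def by auto
  then show ?thesis
  proof cases
    case 1
    have "\<bar>subvals l a 1 1 - subvals l a 1 2\<bar> \<le> 3 / 5 * D" "\<bar>subvals l a 1 1 - subvals l a 1 3\<bar> \<le> 3 / 5 * D" "\<bar>subvals l a 1 2 - subvals l a 1 3\<bar> \<le> 3 / 5 * D"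
      by (rule d[of _ _ _ "3 * a 1 - 2 * a 2 - a 3"], simp add: subvals_def algebra_simps, use D in linarith, rule d[of _ _ _ "3 * a 1 - 2 * a 3 - a 2"], simp add: subvals_def algebra_simps, use D in linarith, rule d[of _ _ _ "a 2 - a 3"], simp add: subvals_def algebra_simps, use D in linarith)
    then show ?thesis unfolding 1 by (rule osc_leI)
  next
    case 2
    have "\<bar>subvals l a 2 1 - subvals l a 2 2\<bar> \<le> 3 / 5 * D" "\<bar>subvals l a 2 1 - subvals l a 2 3\<bar> \<le> 3 / 5 * D" "\<bar>subvals l a 2 2 - subvals l a 2 3\<bar> \<le> 3 / 5 * D"
      by (rule d[of _ _ _ "2 * a 1 + a 3 - 3 * a 2"], simp add: subvals_def algebra_simps, use D in linarith, rule d[of _ _ _ "a 1 - a 3"], simp add: subvals_def algebra_simps, use D in linarith, rule d[of _ _ _ "3 * a 2 - 2 * a 3 - a 1"], simp add: subvals_def algebra_simps, use D in linarith)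
    then show ?thesis unfolding 2 by (rule osc_leI)
  next
    case 3
    have "\<bar>subvals l a 3 1 - subvals l a 3 2\<bar> \<le> 3 / 5 * D" "\<bar>subvals l a 3 1 - subvals l a 3 3\<bar> \<le> 3 / 5 * D" "\<bar>subvals l a 3 2 - subvals l a 3 3\<bar> \<le> 3 / 5 * D"
      by (rule d[of _ _ _ "a 1 - a 2"], simp add: subvals_def algebra_simps, use D in linarith, rule d[of _ _ _ "2 * a 1 + a 2 - 3 * a 3"], simp add: subvals_def algebra_simps, use D in linarith, rule d[of _ _ _ "2 * a 2 + a 1 - 3 * a 3"], simp add: subvals_def algebra_simps, use D in linarith)
    then show ?thesis unfolding 3 by (rule osc_leI)
  qed
qed

text \<open>The recursion peels off the outermost subdivision, hence the shifted sequence of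
  parameters inside the cells; after \<open>n\<close> subdivisions the affine interpolation serves
  as a provisional filling.\<close>

primrec happ :: "nat \<Rightarrow> (nat \<Rightarrow> real) \<Rightarrow> (nat \<Rightarrow> real) \<Rightarrow> plane \<Rightarrow> real" where
  "happ 0 = (\<lambda>l a x. \<Sum>i\<in>idx. a i * bary i x)"
| "happ (Suc n) = (\<lambda>l a. glue (\<lambda>i. happ n (\<lambda>k. l (Suc k)) (subvals (l 0) a i)) (interps (subvals (l 0) a)))"

lemma matching_subvals:
  assumes l: "admissible l" and v: "\<And>i j. i \<in> idx \<Longrightarrow> j \<in> idx \<Longrightarrow> v i (p j) = subvals (l 0) a i j"
  shows "matching v (interps (subvals (l 0) a))"
  unfolding matching_def using v interps_subvals_pp[OF l] by simp

lemma glue_vertex: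
  assumes m: "matching v e" and i: "i \<in> idx"
  shows "glue v e (p i) = v i (p i)"
  using glue_cell[OF m i p_in_T[OF i]] by simp

lemma happ_vertex:
  assumes "admissible l" "i \<in> idx"
  shows "happ n l a (p i) = a i"
  using assms
proof (induction n arbitrary: l a i)
  case 0
  then show ?case by (auto simp: sum_idx idx_def)
next
  case (Suc n)
  have "happ n (\<lambda>k. l (Suc k)) (subvals (l 0) a i) (p j) = subvals (l 0) a i j" if "j \<in> idx" for i j
    by (rule Suc.IH[OF admissible_Suc[OF Suc.prems(1)] that])
  then have "matching (\<lambda>i. happ n (\<lambda>k. l (Suc k)) (subvals (l 0) a i)) (interps (subvals (l 0) a))"
    by (intro matching_subvals Suc.prems)
  from glue_vertex[OF this Suc.prems(2)] show ?case
    using Suc.IH[OF admissible_Suc[OF Suc.prems(1)] Suc.prems(2)] by simp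
qed

lemma happ_matching:
  assumes "admissible l"
  shows "matching (\<lambda>i. happ n (\<lambda>k. l (Suc k)) (subvals (l 0) a i)) (interps (subvals (l 0) a))"
  by (intro matching_subvals assms happ_vertex admissible_Suc)

lemma happ_Suc_cell:
  assumes "admissible l" "i \<in> idx" "x \<in> T"
  shows "happ (Suc n) l a (g i x) = happ n (\<lambda>k. l (Suc k)) (subvals (l 0) a i) x"
  using glue_cell[OF happ_matching[OF assms(1)] assms(2,3)] by simp

lemma happ_Suc_edge:
  assumes "admissible l" "(i, j) \<in> edges" "x \<in> bridge i j"
  shows "happ (Suc n) l a x = interps (subvals (l 0) a) x"
  using glue_edge[OF happ_matching[OF assms(1)] assms(2,3)] by simp

lemma continuous_on_happ:
  assumes "admissible l" shows "continuous_on K (happ n l a)"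
  using assms
proof (induction n arbitrary: l a)
  case 0 show ?case by (auto intro!: continuous_intros continuous_on_bary)
next
  case (Suc n)
  show ?case unfolding happ.simps
    by (intro continuous_on_glue happ_matching continuous_on_interps Suc.IH admissible_Suc Suc.prems)
qed

text \<open>5/2 is the fixed point of \<open>c = 1 + 3/5 * c\<close>: passing to the vertex
  \<open>a i\<close> of the cell that contains the point costs \<open>D\<close>, and the rest
  happens in a cell of oscillation \<open>3/5 * D\<close>. On a bridge 8/5 suffices.\<close>

lemma happ_bound:
  assumes "admissible l" "osc_le D a" "x \<in> K" "k \<in> idx"
  shows "\<bar>happ n l a x - a k\<bar> \<le> 5 / 2 * D"
  using assms
proof (induction n arbitrary: l a D x k)
  case 0
  have D: "\<bar>a i - a k\<bar> \<le> D" if "i \<in> idx" for i using 0 that unfolding osc_le_def by auto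
  have D0: "0 \<le> D" using D[OF \<open>k \<in> idx\<close>] by simp
  note T = K_in_T[OF \<open>x \<in> K\<close>]
  have "(\<Sum>i\<in>idx. (a i - a k) * bary i x) = happ 0 l a x - a k * (bary 1 x + bary 2 x + bary 3 x)"
    by (simp add: sum_idx algebra_simps)
  then have "happ 0 l a x - a k = (\<Sum>i\<in>idx. (a i - a k) * bary i x)" unfolding bary_sum by simp
  also have "\<bar>\<dots>\<bar> \<le> (\<Sum>i\<in>idx. D * bary i x)"
  proof (rule order_trans[OF sum_abs], rule sum_mono)
    fix i assume i: "i \<in> idx"
    show "\<bar>(a i - a k) * bary i x\<bar> \<le> D * bary i x"
      unfolding abs_mult using T_nonneg[OF T i] D[OF i] by (simp add: mult_right_mono)
  qed
  also have "\<dots> = D" using bary_sum[of x] by (simp add: sum_idx flip: distrib_left)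
  finally show ?case using D0 by simp
next
  case (Suc n)
  have D: "\<bar>a i - a k\<bar> \<le> D" if "i \<in> idx" for i using Suc.prems that unfolding osc_le_def by auto
  have D0: "0 \<le> D" using D[OF \<open>k \<in> idx\<close>] by simp
  have l: "0 \<le> l 0" "l 0 \<le> 1 / 5" using Suc.prems unfolding admissible_def by auto
  note os = osc_le_subvals[OF l \<open>osc_le D a\<close>]
  from \<open>x \<in> K\<close> K(2) consider i y where "i \<in> idx" "y \<in> K" "x = g i y" | i j where "(i, j) \<in> edges" "x \<in> bridge i j"
    unfolding bridges_eq by blast
  then show ?case
  proof cases
    case 1
    have "\<bar>happ n (\<lambda>k. l (Suc k)) (subvals (l 0) a i) y - subvals (l 0) a i i\<bar> \<le> 5 / 2 * (3 / 5 * D)"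
      by (rule Suc.IH[OF admissible_Suc[OF Suc.prems(1)] os[OF 1(1)] 1(2,1)])
    then show ?thesis
      using D[OF 1(1)] unfolding 1(3) happ_Suc_cell[OF Suc.prems(1) 1(1) K_in_T[OF 1(2)]] subvals_self by linarith
  next
    case 2
    have ij: "i \<in> idx" "j \<in> idx" using edges_D[OF 2(1)] by auto
    from 2(2) obtain t where t: "t \<in> {0..1}" "x = linepath (tip i j) (tip j i) t"
      unfolding seg_def linepath_image_01[symmetric] by auto
    define u where "u = (if \<alpha> = 0 then 0 else t)"
    have u: "0 \<le> u" "u \<le> 1" unfolding u_def using t by auto
    define c d where "c = subvals (l 0) a i j" and "d = subvals (l 0) a j i"
    have "\<bar>a i - c\<bar> \<le> 3 / 5 * D" "\<bar>a j - d\<bar> \<le> 3 / 5 * D"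
      using os[OF ij(1)] os[OF ij(2)] ij unfolding osc_le_def c_def d_def by (metis subvals_self)+
    then have cd: "\<bar>c - a k\<bar> \<le> 8 / 5 * D" "\<bar>d - a k\<bar> \<le> 8 / 5 * D" using D[OF ij(1)] D[OF ij(2)] by linarith+
    have "happ (Suc n) l a x = interps (subvals (l 0) a) x" by (rule happ_Suc_edge[OF Suc.prems(1) 2])
    also have "\<dots> = c + u * (d - c)"
      unfolding t(2) interps_linepath[OF 2(1) t(1)] c_def d_def u_def by simp
    finally have "happ (Suc n) l a x - a k = (1 - u) * (c - a k) + u * (d - a k)" by (simp add: algebra_simps)
    also have "\<bar>\<dots>\<bar> \<le> (1 - u) * \<bar>c - a k\<bar> + u * \<bar>d - a k\<bar>"
      using u by (intro order_trans[OF abs_triangle_ineq]) (simp add: abs_mult)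
    also have "\<dots> \<le> (1 - u) * (8 / 5 * D) + u * (8 / 5 * D)"
      using u cd by (intro add_mono mult_left_mono) auto
    also have "\<dots> = 8 / 5 * D" by (simp add: field_simps)
    finally show ?thesis using D0 by simp
  qed
qed

text \<open>The constant 5 is twice the 5/2 of \<open>happ_bound\<close>. Each level contributes the
  contraction 3/5 on the cells, while on the outermost bridges consecutive approximations agree from
  the first subdivision on.\<close>

lemma happ_cauchy:
  assumes "admissible l" "osc_le D a" "x \<in> K"
  shows "\<bar>happ (Suc n) l a x - happ n l a x\<bar> \<le> (3 / 5) ^ n * (5 * D)"
  using assms
proof (induction n arbitrary: l a D x)
  case 0
  have "1 \<in> idx" unfolding idx_def by simp
  from happ_bound[OF 0 this, of "Suc 0"] happ_bound[OF 0 this, of 0]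
  show ?case unfolding power_0 mult_1 by linarith
next
  case (Suc n)
  have l: "0 \<le> l 0" "l 0 \<le> 1 / 5" using Suc.prems unfolding admissible_def by auto
  have "\<bar>a 1 - a 1\<bar> \<le> D" using Suc.prems(2) unfolding osc_le_def idx_def by blast
  then have D0: "0 \<le> D" by simp
  note os = osc_le_subvals[OF l \<open>osc_le D a\<close>]
  from \<open>x \<in> K\<close> K(2) consider i y where "i \<in> idx" "y \<in> K" "x = g i y" | i j where "(i, j) \<in> edges" "x \<in> bridge i j"
    unfolding bridges_eq by blast
  then show ?case
  proof cases
    case 1
    have "\<bar>happ (Suc n) (\<lambda>k. l (Suc k)) (subvals (l 0) a i) y - happ n (\<lambda>k. l (Suc k)) (subvals (l 0) a i) y\<bar>
        \<le> (3 / 5) ^ n * (5 * (3 / 5 * D))"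
      by (rule Suc.IH[OF admissible_Suc[OF Suc.prems(1)] os[OF 1(1)] 1(2)])
    then show ?thesis
      unfolding 1(3) happ_Suc_cell[OF Suc.prems(1) 1(1) K_in_T[OF 1(2)]] by (simp only: power_Suc)
  next
    case 2
    then show ?thesis
      unfolding happ_Suc_edge[OF Suc.prems(1) 2] using D0 by simp
  qed
qed

section \<open>The limiting extension\<close>

definition harm :: "(nat \<Rightarrow> real) \<Rightarrow> (nat \<Rightarrow> real) \<Rightarrow> plane \<Rightarrow> real" where
  "harm l a x = lim (\<lambda>n. happ n l a x)"

lemma osc_le_exists: "\<exists>D. osc_le D a"
proof -
  have "osc_le (\<Sum>i\<in>idx. \<Sum>j\<in>idx. \<bar>a i - a j\<bar>) a"
    unfolding osc_le_def
  proof (intro ballI)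
    fix i j assume ij: "i \<in> idx" "j \<in> idx"
    have "\<bar>a i - a j\<bar> \<le> (\<Sum>j\<in>idx. \<bar>a i - a j\<bar>)" using ij by (intro member_le_sum) auto
    also have "\<dots> \<le> (\<Sum>i\<in>idx. \<Sum>j\<in>idx. \<bar>a i - a j\<bar>)"
      using ij(1) by (intro member_le_sum[of i idx "\<lambda>i. \<Sum>j\<in>idx. \<bar>a i - a j\<bar>"] sum_nonneg abs_ge_zero finite_idx)
    finally show "\<bar>a i - a j\<bar> \<le> (\<Sum>i\<in>idx. \<Sum>j\<in>idx. \<bar>a i - a j\<bar>)" .
  qed
  then show ?thesis ..
qed

lemma harm_uniform_limit:
  assumes l: "admissible l"
  shows "uniform_limit K (\<lambda>n. happ n l a) (harm l a) sequentially"
proof -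
  obtain D where D: "osc_le D a" using osc_le_exists by blast
  have "uniform_limit K (\<lambda>n x. \<Sum>i<n. (happ (Suc i) l a x - happ i l a x)) (\<lambda>x. suminf (\<lambda>i. happ (Suc i) l a x - happ i l a x)) sequentially"
  proof (rule Weierstrass_m_test)
    show "norm (happ (Suc n) l a x - happ n l a x) \<le> (3 / 5) ^ n * (5 * D)" if "x \<in> K" for n x
      using happ_cauchy[OF l D that] by simp
    show "summable (\<lambda>n. (3 / 5) ^ n * (5 * D))" by (intro summable_mult2 summable_geometric) simp
  qed
  moreover have "(\<Sum>i<n. (happ (Suc i) l a x - happ i l a x)) = happ n l a x - happ 0 l a x" for n x
    by (rule sum_lessThan_telescope)
  ultimately have "uniform_limit K (\<lambda>n x. happ n l a x - happ 0 l a x) (\<lambda>x. suminf (\<lambda>i. happ (Suc i) l a x - happ i l a x)) sequentially"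
    by simp
  then have "uniform_limit K (\<lambda>n x. (happ n l a x - happ 0 l a x) + happ 0 l a x)
      (\<lambda>x. suminf (\<lambda>i. happ (Suc i) l a x - happ i l a x) + happ 0 l a x) sequentially"
    by (intro uniform_limit_add uniform_limit_const)
  then have u: "uniform_limit K (\<lambda>n. happ n l a) (\<lambda>x. suminf (\<lambda>i. happ (Suc i) l a x - happ i l a x) + happ 0 l a x) sequentially"
    by simp
  have "harm l a x = suminf (\<lambda>i. happ (Suc i) l a x - happ i l a x) + happ 0 l a x" if "x \<in> K" for x
    unfolding harm_def by (rule limI) (rule tendsto_uniform_limitI[OF u that])
  then show ?thesis
    using uniform_limit_cong'[of K "\<lambda>n. happ n l a" "\<lambda>n. happ n l a" "harm l a", OF refl] u by simp
qed

lemma harm_limit: "admissible l \<Longrightarrow> x \<in> K \<Longrightarrow> (\<lambda>n. happ n l a x) \<longlonglongrightarrow> harm l a x"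
  by (rule tendsto_uniform_limitI[OF harm_uniform_limit])

lemma harm_limit_Suc: "admissible l \<Longrightarrow> x \<in> K \<Longrightarrow> (\<lambda>n. happ (Suc n) l a x) \<longlonglongrightarrow> harm l a x"
  using harm_limit by (rule LIMSEQ_Suc)

lemma continuous_on_harm: "admissible l \<Longrightarrow> continuous_on K (harm l a)"
  by (rule uniform_limit_theorem[OF _ harm_uniform_limit]) (auto intro: continuous_on_happ always_eventually)

lemma harm_vertex: "admissible l \<Longrightarrow> i \<in> idx \<Longrightarrow> harm l a (p i) = a i"
  using harm_limit[of l "p i" a] p_in_K by (simp add: happ_vertex LIMSEQ_const_iff)

lemma harm_cell:
  assumes "admissible l" "i \<in> idx" "x \<in> K"
  shows "harm l a (g i x) = harm (\<lambda>k. l (Suc k)) (subvals (l 0) a i) x"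
  using harm_limit_Suc[OF assms(1) G_in_K[OF assms(2,3)], of a]
    harm_limit[OF admissible_Suc[OF assms(1)] assms(3), of "subvals (l 0) a i"]
  unfolding happ_Suc_cell[OF assms(1,2) K_in_T[OF assms(3)]] by (rule LIMSEQ_unique)

lemma harm_edge:
  assumes "admissible l" "(i, j) \<in> edges" "x \<in> bridge i j"
  shows "harm l a x = interps (subvals (l 0) a) x"
proof -
  have "x \<in> K" using seg_in_K assms by blast
  from harm_limit_Suc[OF assms(1) this, of a] show ?thesis
    unfolding happ_Suc_edge[OF assms] by (simp add: LIMSEQ_const_iff)
qed

lemma harm_bound:
  assumes "admissible l" "osc_le D a" "x \<in> K" "k \<in> idx"
  shows "\<bar>harm l a x - a k\<bar> \<le> 5 / 2 * D"
proof (rule LIMSEQ_le_const2)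
  show "(\<lambda>n. \<bar>happ n l a x - a k\<bar>) \<longlonglongrightarrow> \<bar>harm l a x - a k\<bar>"
    by (intro tendsto_intros harm_limit assms)
qed (use happ_bound[OF assms] in auto)

end

section \<open>Energies\<close>

lemma sum_words_snoc: "(\<Sum>w\<in>words (Suc m). f w) = (\<Sum>w\<in>words m. \<Sum>i\<in>idx. f (w @ [i]))"
proof -
  have 1: "(\<Sum>w\<in>words (Suc 0). g w) = (\<Sum>i\<in>idx. g [i])" for g :: "nat list \<Rightarrow> 'a"
    using sum_words_Suc[of g 0] by simp
  show ?thesis using sum_words_add[of f m "Suc 0"] by (simp add: 1)
qed

lemma Q0_eq: "Q0 p u u = (u (p 1) - u (p 2))\<^sup>2 + (u (p 2) - u (p 3))\<^sup>2 + (u (p 3) - u (p 1))\<^sup>2"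
  unfolding Q0_def sum_edges by (simp add: power2_eq_square)

lemma Q0_nonneg: "0 \<le> Q0 p u u"
  unfolding Q0_eq by simp

lemma Q0_lincomb:
  "Q0 p (lincomb c u d v) (lincomb c u d v) = c\<^sup>2 * Q0 p u u + 2 * c * d * Q0 p u v + d\<^sup>2 * Q0 p v v"
  unfolding Q0_def sum_edges by (simp add: power2_eq_square algebra_simps)

lemma Q_Sigma_nonneg: "0 \<le> Q_Sigma p \<alpha> m u u"
  unfolding Q_Sigma_def by (intro sum_nonneg Q0_nonneg)

lemma Q_Sigma_lincomb:
  "Q_Sigma p \<alpha> m (lincomb c u d v) (lincomb c u d v)
    = c\<^sup>2 * Q_Sigma p \<alpha> m u u + 2 * c * d * Q_Sigma p \<alpha> m u v + d\<^sup>2 * Q_Sigma p \<alpha> m v v"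
proof -
  have "Q0 p ((lincomb c u d v) \<circ> Gw p \<alpha> w) ((lincomb c u d v) \<circ> Gw p \<alpha> w)
     = c\<^sup>2 * Q0 p (u \<circ> Gw p \<alpha> w) (u \<circ> Gw p \<alpha> w) + 2 * c * d * Q0 p (u \<circ> Gw p \<alpha> w) (v \<circ> Gw p \<alpha> w)
       + d\<^sup>2 * Q0 p (v \<circ> Gw p \<alpha> w) (v \<circ> Gw p \<alpha> w)" for w
    using Q0_lincomb[of p c "u \<circ> Gw p \<alpha> w" d "v \<circ> Gw p \<alpha> w"] by (simp add: o_def)
  then show ?thesis unfolding Q_Sigma_def by (simp add: sum.distrib sum_distrib_left)
qed

lemma DI_Suc: "DI p \<alpha> (Suc m) u v = (\<Sum>w\<in>words m. \<Sum>(i, j)\<in>edges.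
    dirichlet (Gw p \<alpha> w (pp p \<alpha> i j)) (Gw p \<alpha> w (pp p \<alpha> j i)) u v)"
  unfolding DI_def by (simp add: sum.cartesian_product)

lemma DI_nonneg: "0 \<le> DI p \<alpha> m u u"
  unfolding DI_def by (intro sum_nonneg) (auto intro: dirichlet_nonneg)

text \<open>A weighted form of the star-triangle estimate: both terms are compared with their tangent at
  the harmonic values, which makes the bound linear in the inner values.\<close>

lemma matching_pair_inequality:
  fixes a b c b12 b13 b21 b23 b31 b32 x y :: real
  assumes "0 < y" "y < x"
  shows "((a - b)\<^sup>2 + (b - c)\<^sup>2 + (c - a)\<^sup>2) / x
    \<le> 5 / 3 * (((a - b12)\<^sup>2 + (b12 - b13)\<^sup>2 + (b13 - a)\<^sup>2) + ((b21 - b)\<^sup>2 + (b - b23)\<^sup>2 + (b23 - b21)\<^sup>2)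
       + ((b31 - b32)\<^sup>2 + (b32 - c)\<^sup>2 + (c - b31)\<^sup>2)) / y
     + ((b12 - b21)\<^sup>2 + (b23 - b32)\<^sup>2 + (b31 - b13)\<^sup>2) / (x - y)"
    (is "?Q / x \<le> 5 / 3 * ?A / y + ?B / (x - y)")
proof -
  have x: "0 < x" "0 < x - y" using assms by auto
  \<comment> \<open>Equality holds for \<open>z = l * s\<close> with \<open>l = y / (5 * x)\<close>,
    which is the value of a cell difference of \<open>subvals l\<close>; correspondingly in
    \<open>B\<close> the bridge differences of \<open>subvals l\<close> are
    \<open>(x - y) / x\<close> times a difference of boundary values.\<close>
  have A: "10 * y / x * (z * s) - y\<^sup>2 / x\<^sup>2 * s\<^sup>2 \<le> 25 * z\<^sup>2" for z s :: real
  proof -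
    have "0 \<le> (5 * z - y / x * s)\<^sup>2" by simp
    then show ?thesis by (simp add: power2_diff power_mult_distrib power_divide algebra_simps)
  qed
  have B: "2 * (x - y) / x * (z * s) - (x - y)\<^sup>2 / x\<^sup>2 * s\<^sup>2 \<le> z\<^sup>2" for z s :: real
  proof -
    have "0 \<le> (z - (x - y) / x * s)\<^sup>2" by simp
    then show ?thesis
      unfolding power2_diff[of z] power_mult_distrib power_divide by (simp add: algebra_simps)
  qed
  define S where "S = (a - b12) * (3 * a - 2 * b - c) + (b12 - b13) * (b - c) + (b13 - a) * (2 * c + b - 3 * a)
     + (b21 - b) * (2 * a + c - 3 * b) + (b - b23) * (3 * b - 2 * c - a) + (b23 - b21) * (c - a)
     + (b31 - b32) * (a - b) + (b32 - c) * (2 * b + a - 3 * c) + (c - b31) * (3 * c - 2 * a - b)"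
  define L where "L = (b12 - b21) * (a - b) + (b23 - b32) * (b - c) + (b31 - b13) * (c - a)"
  have "10 * y / x * S - y\<^sup>2 / x\<^sup>2 * (15 * ?Q) \<le> 25 * ?A"
  proof -
    have q: "15 * ?Q = (3 * a - 2 * b - c)\<^sup>2 + (b - c)\<^sup>2 + (2 * c + b - 3 * a)\<^sup>2 + (2 * a + c - 3 * b)\<^sup>2 + (3 * b - 2 * c - a)\<^sup>2
       + (c - a)\<^sup>2 + (a - b)\<^sup>2 + (2 * b + a - 3 * c)\<^sup>2 + (3 * c - 2 * a - b)\<^sup>2"
      by (simp add: power2_eq_square algebra_simps)
    show ?thesis
      unfolding q S_def unfolding distrib_left
      using A[of "a - b12" "3 * a - 2 * b - c"] A[of "b12 - b13" "b - c"] A[of "b13 - a" "2 * c + b - 3 * a"]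
        A[of "b21 - b" "2 * a + c - 3 * b"] A[of "b - b23" "3 * b - 2 * c - a"] A[of "b23 - b21" "c - a"]
        A[of "b31 - b32" "a - b"] A[of "b32 - c" "2 * b + a - 3 * c"] A[of "c - b31" "3 * c - 2 * a - b"]
      by linarith
  qed
  then have "(10 * y / x * S - y\<^sup>2 / x\<^sup>2 * (15 * ?Q)) / (15 * y) \<le> (25 * ?A) / (15 * y)"
    using assms by (intro divide_right_mono) auto
  then have 1: "2 / 3 * S / x - y / x\<^sup>2 * ?Q \<le> 5 / 3 * ?A / y"
  proof -
    have "(10 * y / x * S - y\<^sup>2 / x\<^sup>2 * (15 * z)) / (15 * y) = 2 / 3 * S / x - y / x\<^sup>2 * z"
      "(25 * z) / (15 * y) = 5 / 3 * z / y" for z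
      using assms x by (simp_all add: field_simps power2_eq_square)
    then show ?thesis using \<open>_ / (15 * y) \<le> _\<close> by (simp only:)
  qed
  have "2 * (x - y) / x * L - (x - y)\<^sup>2 / x\<^sup>2 * ?Q \<le> ?B"
    unfolding L_def distrib_left
    using B[of "b12 - b21" "a - b"] B[of "b23 - b32" "b - c"] B[of "b31 - b13" "c - a"] by linarith
  then have "(2 * (x - y) / x * L - (x - y)\<^sup>2 / x\<^sup>2 * ?Q) / (x - y) \<le> ?B / (x - y)"
    using x by (intro divide_right_mono) auto
  moreover have "(2 * (x - y) / x * L - (x - y)\<^sup>2 / x\<^sup>2 * ?Q) / (x - y) = 2 * L / x - (x - y) / x\<^sup>2 * ?Q"
  proof -
    have "(2 * v / x * L - v\<^sup>2 / x\<^sup>2 * z) / v = 2 * L / x - v / x\<^sup>2 * z" if "0 < v" for v z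
      using that x by (simp add: field_simps power2_eq_square)
    from this[OF x(2)] show ?thesis .
  qed
  ultimately have 2: "2 * L / x - (x - y) / x\<^sup>2 * ?Q \<le> ?B / (x - y)" by simp
  \<comment> \<open>All inner values cancel: this is Kirchhoff's law for the harmonic values in the
    form of a summation by parts.\<close>
  have "S / 3 + L = ?Q" unfolding S_def L_def by (simp add: power2_eq_square field_simps)
  then have L: "L = ?Q - S / 3" by simp
  have "2 / 3 * S / x - y / x\<^sup>2 * ?Q + (2 * L / x - (x - y) / x\<^sup>2 * ?Q) = ?Q / x"
    unfolding L using x by (simp add: field_simps power2_eq_square)
  then show ?thesis using 1 2 by linarith
qed

context gasket
begin

lemma F_tilde_continuous: "u \<in> FT \<Longrightarrow> continuous_on K u"
  unfolding F_tilde_def by simp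

lemma F_tilde_H1C:
  assumes "u \<in> FT" "w \<in> words_fin" "(i, j) \<in> edges"
  shows "H1C (gw w (tip i j)) (gw w (tip j i)) u"
proof -
  have "continuous_on (bridge_at w i j) u"
    by (rule continuous_on_subset[OF F_tilde_continuous[OF assms(1)] segw_in_K[OF assms(2,3)]])
  moreover have "u \<in> H1_seg (gw w (tip i j)) (gw w (tip j i))"
    using assms unfolding F_tilde_def by blast
  ultimately show ?thesis unfolding H1C_def segw_eq by blast
qed

lemma F_tildeI:
  assumes "continuous_on K u"
    and "\<And>w i j. w \<in> words_fin \<Longrightarrow> (i, j) \<in> edges \<Longrightarrow> u \<in> H1_seg (gw w (tip i j)) (gw w (tip j i))"
  shows "u \<in> FT"
  using assms unfolding F_tilde_def by auto

lemma F_tilde_lincomb: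
  assumes "u \<in> FT" "v \<in> FT"
  shows "(lincomb c u d v) \<in> FT"
proof (rule F_tildeI)
  show "continuous_on K (lincomb c u d v)"
    by (intro continuous_intros F_tilde_continuous assms)
  show "(lincomb c u d v) \<in> H1_seg (gw w (tip i j)) (gw w (tip j i))"
    if "w \<in> words_fin" "(i, j) \<in> edges" for w i j
    using H1C_lincomb[OF F_tilde_H1C[OF assms(1) that] F_tilde_H1C[OF assms(2) that], of c d]
    unfolding H1C_def by blast
qed

lemma DI_lincomb:
  assumes "u \<in> FT" "v \<in> FT"
  shows "DI p \<alpha> (Suc m) (lincomb c u d v) (lincomb c u d v)
    = c\<^sup>2 * DI p \<alpha> (Suc m) u u + 2 * c * d * DI p \<alpha> (Suc m) u v + d\<^sup>2 * DI p \<alpha> (Suc m) v v"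
proof -
  let ?D = "\<lambda>w i j. bridge_form w i j"
  have "?D w i j (lincomb c u d v) (lincomb c u d v)
      = c\<^sup>2 * ?D w i j u u + 2 * c * d * ?D w i j u v + d\<^sup>2 * ?D w i j v v"
    if "w \<in> words m" "(i, j) \<in> edges" for w i j
    by (intro dirichlet_lincomb F_tilde_H1C assms that words_fin_mono[OF that(1)])
  then have "DI p \<alpha> (Suc m) (lincomb c u d v) (lincomb c u d v)
     = (\<Sum>w\<in>words m. \<Sum>(i, j)\<in>edges. c\<^sup>2 * ?D w i j u u + 2 * c * d * ?D w i j u v + d\<^sup>2 * ?D w i j v v)"
    unfolding DI_Suc by (intro sum.cong refl) auto
  also have "\<dots> = c\<^sup>2 * DI p \<alpha> (Suc m) u u + 2 * c * d * DI p \<alpha> (Suc m) u v + d\<^sup>2 * DI p \<alpha> (Suc m) v v"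
    unfolding DI_Suc case_prod_unfold by (simp add: sum.distrib sum_distrib_left)
  finally show ?thesis .
qed

section \<open>Scaled energies of cells and bridges\<close>

definition q_en :: "nat \<Rightarrow> (plane \<Rightarrow> real) \<Rightarrow> real" where
  "q_en m u = (5 / 3) ^ m * Q_Sigma p \<alpha> m u u"

definition d_en :: "nat \<Rightarrow> (plane \<Rightarrow> real) \<Rightarrow> real" where
  "d_en m u = (5 / 3) ^ m * DI p \<alpha> (Suc m) u u"

lemma q_en_nonneg: "0 \<le> q_en m u" unfolding q_en_def by (simp add: Q_Sigma_nonneg)
lemma d_en_nonneg: "0 \<le> d_en m u" unfolding d_en_def by (simp add: DI_nonneg)

text \<open>The inequality for one cell summed over all words, after \<open>dirichlet_ge\<close> has
  replaced each bridge energy by the squared difference of its end values. With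
  \<open>x = cc m\<close> and \<open>y = cc (Suc m)\<close> it will give the monotonicity of the
  energies in \<open>m\<close>.\<close>

lemma q_en_step:
  assumes u: "u \<in> FT" and xy: "0 < y" "y < x"
  shows "q_en m u / x \<le> q_en (Suc m) u / y + d_en m u / (x - y)"
proof -
  let ?b = "\<lambda>w i j. u (gw w (tip i j))"
  let ?D = "\<lambda>w i j. bridge_form w i j u u"
  have step: "Q0 p (u \<circ> gw w) (u \<circ> gw w) / x
      \<le> 5 / 3 * (\<Sum>i\<in>idx. Q0 p (u \<circ> gw (w @ [i])) (u \<circ> gw (w @ [i]))) / y + (\<Sum>(i, j)\<in>edges. ?D w i j) / (x - y)"
    if w: "w \<in> words m" for w
  proof -
    have "(?b w 1 2 - ?b w 2 1)\<^sup>2 + (?b w 2 3 - ?b w 3 2)\<^sup>2 + (?b w 3 1 - ?b w 1 3)\<^sup>2 \<le> (\<Sum>(i, j)\<in>edges. ?D w i j)"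
      unfolding sum_edges
      by (intro add_mono dirichlet_ge F_tilde_H1C u words_fin_mono[OF w]) (auto simp: edges_def)
    then have B: "((?b w 1 2 - ?b w 2 1)\<^sup>2 + (?b w 2 3 - ?b w 3 2)\<^sup>2 + (?b w 3 1 - ?b w 1 3)\<^sup>2) / (x - y) \<le> (\<Sum>(i, j)\<in>edges. ?D w i j) / (x - y)"
      using xy by (intro divide_right_mono) auto
    have v: "(u \<circ> gw (w @ [i])) (p j) = (if i = j then u (gw w (p i)) else ?b w i j)" for i j
      by (simp add: comp_word_append pp_def)
    show ?thesis
      using matching_pair_inequality[OF xy, of "u (gw w (p 1))" "u (gw w (p 2))" "u (gw w (p 3))"
          "?b w 1 2" "?b w 1 3" "?b w 2 1" "?b w 2 3" "?b w 3 1" "?b w 3 2"] B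
      unfolding sum_idx Q0_eq v by (simp only: o_apply) simp
  qed
  have "q_en m u / x = (5 / 3) ^ m * (\<Sum>w\<in>words m. Q0 p (u \<circ> gw w) (u \<circ> gw w) / x)"
    unfolding q_en_def Q_Sigma_def by (simp flip: sum_divide_distrib)
  also have "\<dots> \<le> (5 / 3) ^ m * (\<Sum>w\<in>words m. 5 / 3 * (\<Sum>i\<in>idx. Q0 p (u \<circ> gw (w @ [i])) (u \<circ> gw (w @ [i]))) / y + (\<Sum>(i, j)\<in>edges. ?D w i j) / (x - y))"
    by (intro mult_left_mono sum_mono step) auto
  also have "\<dots> = q_en (Suc m) u / y + d_en m u / (x - y)"
    unfolding q_en_def d_en_def Q_Sigma_def DI_Suc sum_words_snoc
    by (simp add: sum.distrib sum_divide_distrib sum_distrib_left algebra_simps)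
  finally show ?thesis .
qed

subsection \<open>Piecewise harmonic functions along words\<close>

primrec vals :: "nat list \<Rightarrow> (nat \<Rightarrow> real) \<Rightarrow> (nat \<Rightarrow> real) \<Rightarrow> nat \<Rightarrow> real" where
  "vals [] = (\<lambda>l a. a)"
| "vals (i # w) = (\<lambda>l a. vals w (\<lambda>k. l (Suc k)) (subvals (l 0) a i))"

lemma admissible_shift: "admissible l \<Longrightarrow> admissible (\<lambda>k. l (n + k))"
  unfolding admissible_def by auto

lemma harm_word:
  assumes "admissible l" "w \<in> words n" "x \<in> K"
  shows "harm l a (gw w x) = harm (\<lambda>k. l (n + k)) (vals w l a) x"
  using assms
proof (induction w arbitrary: l a n)
  case Nil
  then have "n = 0" by (simp add: words_def)
  then show ?case by simp
next
  case (Cons i w)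
  then obtain m where n: "n = Suc m" and w: "w \<in> words m" and i: "i \<in> idx"
    by (cases n) (auto simp: words_def)
  have "harm l a (gw (i # w) x) = harm (\<lambda>k. l (Suc k)) (subvals (l 0) a i) (gw w x)"
    using harm_cell[OF Cons.prems(1) i Gw_in_K[OF words_fin_mono[OF w] Cons.prems(3)]] by simp
  also have "\<dots> = harm (\<lambda>k. l (Suc (m + k))) (vals (i # w) l a) x"
    using Cons.IH[OF admissible_Suc[OF Cons.prems(1)] w Cons.prems(3)] by simp
  finally show ?case unfolding n by simp
qed

definition osc2 :: "(nat \<Rightarrow> real) \<Rightarrow> real" where
  "osc2 a = (a 1 - a 2)\<^sup>2 + (a 2 - a 3)\<^sup>2 + (a 3 - a 1)\<^sup>2"

text \<open>At \<open>l = 1/5\<close> the factor is 3/5, the energy scaling of the Sierpinski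
  gasket.\<close>

lemma osc2_subvals: "(\<Sum>i\<in>idx. osc2 (subvals l a i)) = 15 * l\<^sup>2 * osc2 a"
  unfolding sum_idx osc2_def subvals_def by (simp add: power2_eq_square algebra_simps)

lemma osc2_vals: "(\<Sum>w\<in>words n. osc2 (vals w l a)) = (\<Prod>k<n. 15 * (l k)\<^sup>2) * osc2 a"
proof (induction n arbitrary: l a)
  case (Suc n)
  have "(\<Sum>w\<in>words (Suc n). osc2 (vals w l a)) = (\<Prod>k<n. 15 * (l (Suc k))\<^sup>2) * (\<Sum>i\<in>idx. osc2 (subvals (l 0) a i))"
    unfolding sum_words_Suc by (simp add: Suc sum_distrib_left)
  also have "\<dots> = (\<Prod>k<Suc n. 15 * (l k)\<^sup>2) * osc2 a"
    unfolding osc2_subvals prod.lessThan_Suc_shift by simp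
  finally show ?case .
qed simp

lemma vals_osc:
  assumes "admissible l" "osc_le D a" "w \<in> words n"
  shows "osc_le ((3 / 5) ^ n * D) (vals w l a)"
  using assms
proof (induction w arbitrary: l a n D)
  case Nil
  then show ?case by (simp add: words_def)
next
  case (Cons i w)
  then obtain m where n: "n = Suc m" and w: "w \<in> words m" and i: "i \<in> idx"
    by (cases n) (auto simp: words_def)
  have "osc_le (3 / 5 * D) (subvals (l 0) a i)"
    using Cons.prems by (intro osc_le_subvals i) (auto simp: admissible_def)
  from Cons.IH[OF admissible_Suc[OF Cons.prems(1)] this w] show ?case unfolding n by (simp add: mult_ac)
qed

text \<open>For parameter 0 all vertices of a subcell take the value of the vertex it shares with
  its parent; this is how cells of a level are shorted.\<close>

lemma vals_zero:
  assumes "w \<in> words (Suc n)" "l n = 0"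
  shows "osc_le 0 (vals w l a)"
  using assms
proof (induction n arbitrary: w l a)
  case 0
  then obtain i where "w = [i]" by (auto simp: words_def length_Suc_conv)
  then show ?case using 0 by (simp add: osc_le_def subvals_def)
next
  case (Suc n)
  then obtain i v where "w = i # v" "v \<in> words (Suc n)" by (cases w) (auto simp: words_def)
  then show ?case using Suc by simp
qed

lemma Q0_vertex: "Q0 p u u = osc2 (\<lambda>i. u (p i))"
  unfolding Q0_eq osc2_def ..

text \<open>The prefix \<open>v\<close> makes the statement applicable to functions that are
  harmonic extensions only inside the cell of \<open>v\<close>.\<close>

lemma harm_affine_edge:
  assumes l: "admissible l" and w: "w \<in> words n" and ij: "(i, j) \<in> edges" and t: "t \<in> {0..1}"
    and u: "\<And>x. x \<in> K \<Longrightarrow> u (gw v x) = harm l a x"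
  defines "b \<equiv> subvals (l n) (vals w l a)"
  shows "u (linepath (gw (v @ w) (tip i j)) (gw (v @ w) (tip j i)) t)
    = b i j + t * (if \<alpha> = 0 then 0 else b j i - b i j)"
proof -
  let ?x = "linepath (tip i j) (tip j i) t"
  have s: "?x \<in> bridge i j" unfolding seg_def using t by (intro linepath_in_path) auto
  then have xK: "?x \<in> K" using seg_in_K[OF ij] by blast
  have "u (linepath (gw (v @ w) (tip i j)) (gw (v @ w) (tip j i)) t) = u (gw v (gw w ?x))"
    unfolding Gw_linepath[symmetric] by (simp add: comp_word_append)
  also have "\<dots> = harm l a (gw w ?x)"
    by (rule u[OF Gw_in_K[OF words_fin_mono[OF w] xK]])
  also have "\<dots> = harm (\<lambda>k. l (n + k)) (vals w l a) ?x"
    by (rule harm_word[OF l w xK])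
  also have "\<dots> = interps b ?x"
    using harm_edge[OF admissible_shift[OF l] ij s] unfolding b_def by simp
  also have "\<dots> = b i j + t * (if \<alpha> = 0 then 0 else b j i - b i j)"
    by (rule interps_linepath[OF ij t])
  finally show ?thesis .
qed

lemma harm_Q:
  assumes l: "admissible l" and u: "\<And>x. x \<in> K \<Longrightarrow> u (gw v x) = harm l a x"
  shows "(\<Sum>w\<in>words n. Q0 p (u \<circ> gw (v @ w)) (u \<circ> gw (v @ w))) = (\<Prod>k<n. 15 * (l k)\<^sup>2) * osc2 a"
proof -
  have "Q0 p (u \<circ> gw (v @ w)) (u \<circ> gw (v @ w)) = osc2 (vals w l a)" if w: "w \<in> words n" for w
  proof -
    have "(u \<circ> gw (v @ w)) (p i) = vals w l a i" if i: "i \<in> idx" for i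
      using u[OF Gw_in_K[OF words_fin_mono[OF w] p_in_K[OF i]]] harm_word[OF l w p_in_K[OF i], of a]
        harm_vertex[OF admissible_shift[OF l] i] by (simp add: comp_word_append)
    then show ?thesis unfolding Q0_vertex osc2_def by (simp add: idx_def)
  qed
  then show ?thesis using osc2_vals[where n=n and l=l and a=a] by simp
qed

text \<open>A bridge of level \<open>n\<close> inside a cell carries the fraction
  \<open>1 - 5 * l n\<close> of the difference of the two cell vertices that it connects, and
  \<open>osc2_vals\<close> sums the squared differences.\<close>

lemma harm_D:
  assumes a0: "\<alpha> \<noteq> 0" and l: "admissible l" and u: "\<And>x. x \<in> K \<Longrightarrow> u (gw v x) = harm l a x"
  shows "(\<Sum>w\<in>words n. \<Sum>(i, j)\<in>edges. bridge_form (v @ w) i j u u)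
    = (1 - 5 * l n)\<^sup>2 * (\<Prod>k<n. 15 * (l k)\<^sup>2) * osc2 a"
proof -
  have "(\<Sum>(i, j)\<in>edges. bridge_form (v @ w) i j u u)
      = (1 - 5 * l n)\<^sup>2 * osc2 (vals w l a)" if w: "w \<in> words n" for w
  proof -
    let ?b = "subvals (l n) (vals w l a)"
    have "bridge_form (v @ w) i j u u
        = (1 - 5 * l n)\<^sup>2 * (vals w l a i - vals w l a j)\<^sup>2" if ij: "(i, j) \<in> edges" for i j
    proof -
      have "bridge_form (v @ w) i j u u = (?b j i - ?b i j)\<^sup>2"
        by (rule dirichlet_affine[where c="?b i j"]) (use harm_affine_edge[OF l w ij _ u] a0 in simp)
      also have "?b j i - ?b i j = - ((1 - 5 * l n) * (vals w l a i - vals w l a j))"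
        using edges_D[OF ij] unfolding subvals_def by (simp add: algebra_simps)
      finally show ?thesis by (simp add: power_mult_distrib)
    qed
    then have "(\<Sum>(i, j)\<in>edges. bridge_form (v @ w) i j u u)
        = (\<Sum>(i, j)\<in>edges. (1 - 5 * l n)\<^sup>2 * (vals w l a i - vals w l a j)\<^sup>2)"
      by (intro sum.cong refl) auto
    then show ?thesis unfolding sum_edges osc2_def by (simp add: algebra_simps)
  qed
  then have "(\<Sum>w\<in>words n. \<Sum>(i, j)\<in>edges. bridge_form (v @ w) i j u u)
    = (1 - 5 * l n)\<^sup>2 * (\<Sum>w\<in>words n. osc2 (vals w l a))"
    by (simp add: sum_distrib_left)
  then show ?thesis unfolding osc2_vals by (simp add: mult.assoc)
qed

subsection \<open>Replacing a function by a piecewise harmonic one on the cells of a level\<close>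

text \<open>The sequence \<open>l\<close> is not shifted during the descent to level
  \<open>m\<close>, so \<open>l k\<close> governs the subdivision of the cells of level
  \<open>m + k\<close>. Continuity across the junctions is inherited from
  \<open>glue\<close>.\<close>

primrec pharm :: "nat \<Rightarrow> (nat \<Rightarrow> real) \<Rightarrow> (plane \<Rightarrow> real) \<Rightarrow> plane \<Rightarrow> real" where
  "pharm 0 = (\<lambda>l u. harm l (\<lambda>i. u (p i)))"
| "pharm (Suc m) = (\<lambda>l u. glue (\<lambda>i. pharm m l (u \<circ> g i)) u)"

lemma pharm_matching:
  assumes l: "admissible l"
  shows "matching (\<lambda>i. pharm m l (u \<circ> g i)) u"
proof -
  have v: "pharm m l u (p i) = u (p i)" if "i \<in> idx" for u i m
    using that
  proof (induction m arbitrary: u i)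
    case 0 then show ?case using harm_vertex[OF l] by simp
  next
    case (Suc m)
    have "matching (\<lambda>i. pharm m l (u \<circ> g i)) u"
      unfolding matching_def pp_def using Suc.IH by simp
    from glue_vertex[OF this Suc.prems] show ?case using Suc by simp
  qed
  then show ?thesis unfolding matching_def pp_def by simp
qed

lemma pharm_cell:
  assumes l: "admissible l" and "w \<in> words m" "x \<in> K"
  shows "pharm m l u (gw w x) = harm l (\<lambda>i. u (gw w (p i))) x"
  using assms(2,3)
proof (induction m arbitrary: w u)
  case (Suc m)
  then obtain i v where w: "w = i # v" "v \<in> words m" "i \<in> idx" by (cases w) (auto simp: words_def)
  have "pharm (Suc m) l u (gw w x) = pharm m l (u \<circ> g i) (gw v x)"
    using glue_cell[OF pharm_matching[OF l] w(3) K_in_T[OF Gw_in_K[OF words_fin_mono[OF w(2)] Suc.prems(2)]]] w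
    by simp
  then show ?case using Suc.IH[OF w(2) Suc.prems(2), of "u \<circ> g i"] w by simp
qed simp

lemma pharm_edge:
  assumes l: "admissible l" and "w \<in> words k" "k < m" "(i, j) \<in> edges" "x \<in> bridge i j"
  shows "pharm m l u (gw w x) = u (gw w x)"
  using assms(2-)
proof (induction m arbitrary: w u k)
  case (Suc m)
  show ?case
  proof (cases w)
    case Nil
    then show ?thesis using glue_edge[OF pharm_matching[OF l] Suc.prems(3,4)] by simp
  next
    case (Cons n v)
    with Suc.prems obtain k' where w: "v \<in> words k'" "k' < m" "n \<in> idx" by (cases k) (auto simp: words_def)
    have "x \<in> K" using Suc.prems seg_in_K by blast
    have "pharm (Suc m) l u (gw w x) = pharm m l (u \<circ> g n) (gw v x)"
      using glue_cell[OF pharm_matching[OF l] w(3) K_in_T[OF Gw_in_K[OF words_fin_mono[OF w(1)] \<open>x \<in> K\<close>]]] Cons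
      by simp
    then show ?thesis using Suc.IH[OF w(1,2) Suc.prems(3,4), of "u \<circ> g n"] Cons by simp
  qed
qed simp

lemma pharm_segw:
  assumes l: "admissible l" and "w \<in> words k" "k < m" "(i, j) \<in> edges"
    and "x \<in> closed_segment (gw w (tip i j)) (gw w (tip j i))"
  shows "pharm m l u x = u x"
proof -
  have "x \<in> gw w ` bridge i j" using assms(5) unfolding segw_eq[symmetric] segw_def .
  then show ?thesis using pharm_edge[OF assms(1-4)] by blast
qed

lemma continuous_on_pharm:
  assumes l: "admissible l" and "continuous_on K u"
  shows "continuous_on K (pharm m l u)"
  using assms(2)
proof (induction m arbitrary: u)
  case 0 show ?case using continuous_on_harm[OF l] by simp
next
  case (Suc m)
  have "continuous_on K (u \<circ> g i)" if "i \<in> idx" for i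
    using that by (intro continuous_on_compose continuous_on_G continuous_on_subset[OF Suc.prems]) (auto intro: G_in_K)
  then show ?case unfolding pharm.simps
    by (intro continuous_on_glue pharm_matching l Suc.IH continuous_on_subset[OF Suc.prems] seg_in_K)
qed

lemma words_split:
  assumes "w \<in> words_fin" "\<not> length w < m"
  obtains v w' n where "w = v @ w'" "v \<in> words m" "w' \<in> words n"
proof
  show "w = take m w @ drop m w" by simp
  show "take m w \<in> words m" "drop m w \<in> words (length w - m)"
    using assms by (auto simp: words_def words_fin_eq dest: in_set_takeD in_set_dropD)
qed

lemma pharm_F_tilde:
  assumes l: "admissible l" and u: "u \<in> FT"
  shows "pharm m l u \<in> FT"
proof (rule F_tildeI)
  show "continuous_on K (pharm m l u)" by (rule continuous_on_pharm[OF l F_tilde_continuous[OF u]])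
  fix w i j assume w: "w \<in> words_fin" and ij: "(i, j) \<in> edges"
  show "pharm m l u \<in> H1_seg (gw w (tip i j)) (gw w (tip j i))"
  proof (cases "length w < m")
    case True
    let ?l = "linepath (gw w (tip i j)) (gw w (tip j i))"
    have w': "w \<in> words (length w)" using w by (auto simp: words_def words_fin_eq)
    have "(pharm m l u \<circ> ?l) t = (u \<circ> ?l) t" if "t \<in> {0..1}" for t
      using pharm_segw[OF l w' True ij linepath_in_path[OF that]] by simp
    from H1_unit_cong[of "pharm m l u \<circ> ?l" "u \<circ> ?l", OF this] show ?thesis
      using H1C_D(1)[OF F_tilde_H1C[OF u w ij]] unfolding H1_seg_def by simp
  next
    case False
    from words_split[OF w False] obtain v w' n where vw: "w = v @ w'" "v \<in> words m" "w' \<in> words n" .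
    show ?thesis unfolding vw(1)
      by (rule affine_H1_seg, rule harm_affine_edge[OF l vw(3) ij _ pharm_cell[OF l vw(2)]])
  qed
qed

lemma prod_15: "(\<Prod>k<n. 15 * (l k)\<^sup>2) = (3 / 5) ^ n * (\<Prod>k<n. 5 * l k :: real)\<^sup>2"
  by (induction n) (simp_all add: power_mult_distrib)

text \<open>The power of 3/5 produced by the subdivisions is cancelled by the scaling in
  \<open>q_en\<close>; what remains is the product of the factors \<open>5 * l\<close>.\<close>

lemma pharm_q_en:
  assumes l: "admissible l"
  shows "q_en (m + n) (pharm m l u) = (\<Prod>k<n. 5 * l k)\<^sup>2 * q_en m u"
proof -
  have "Q_Sigma p \<alpha> (m + n) (pharm m l u) (pharm m l u)
     = (\<Sum>v\<in>words m. (\<Prod>k<n. 15 * (l k)\<^sup>2) * osc2 (\<lambda>i. u (gw v (p i))))"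
    unfolding Q_Sigma_def sum_words_add by (intro sum.cong refl harm_Q l pharm_cell)
  also have "\<dots> = (\<Prod>k<n. 15 * (l k)\<^sup>2) * Q_Sigma p \<alpha> m u u"
    unfolding Q_Sigma_def Q0_vertex by (simp add: sum_distrib_left)
  also have "(\<Prod>k<n. 15 * (l k)\<^sup>2) = (3 / 5) ^ n * (\<Prod>k<n. 5 * l k)\<^sup>2" by (rule prod_15)
  finally show ?thesis unfolding q_en_def by (simp add: power_add power_divide)
qed

text \<open>The drop across the bridges is the fraction \<open>1 - 5 * l n\<close> of the current
  product. Written as a difference of consecutive products, the energies depend on the sequence of
  products only, which can then be prescribed.\<close>

lemma pharm_d_en:
  assumes l: "admissible l" and a0: "\<alpha> \<noteq> 0"
  shows "d_en (m + n) (pharm m l u) = ((\<Prod>k<n. 5 * l k) - (\<Prod>k<Suc n. 5 * l k))\<^sup>2 * q_en m u"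
proof -
  have "DI p \<alpha> (Suc (m + n)) (pharm m l u) (pharm m l u)
     = (\<Sum>v\<in>words m. (1 - 5 * l n)\<^sup>2 * (\<Prod>k<n. 15 * (l k)\<^sup>2) * osc2 (\<lambda>i. u (gw v (p i))))"
    unfolding DI_Suc sum_words_add by (intro sum.cong refl harm_D a0 l pharm_cell)
  also have "\<dots> = (1 - 5 * l n)\<^sup>2 * (\<Prod>k<n. 15 * (l k)\<^sup>2) * Q_Sigma p \<alpha> m u u"
    unfolding Q_Sigma_def Q0_vertex by (simp add: sum_distrib_left)
  also have "(\<Prod>k<n. 15 * (l k)\<^sup>2) = (3 / 5) ^ n * (\<Prod>k<n. 5 * l k)\<^sup>2" by (rule prod_15)
  finally have "d_en (m + n) (pharm m l u) = ((1 - 5 * l n) * (\<Prod>k<n. 5 * l k))\<^sup>2 * q_en m u"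
    unfolding q_en_def d_en_def by (simp add: power_add power_divide power_mult_distrib)
  then show ?thesis by (simp add: algebra_simps)
qed

text \<open>The coefficients 0 and 1 give the energy of \<open>pharm\<close> itself, the
  coefficients 1 and 1 that of its sum with \<open>u\<close>, which enters the parallelogram
  law.\<close>

lemma pharm_d_en_below:
  assumes l: "admissible l" and u: "u \<in> FT" and k: "k < m"
  shows "d_en k (\<lambda>x. c * u x + d * pharm m l u x) = (c + d)\<^sup>2 * d_en k u"
proof -
  let ?D = "\<lambda>w i j. bridge_form w i j"
  let ?v = "\<lambda>x. c * u x + d * pharm m l u x"
  have "?D w i j ?v ?v = (c + d)\<^sup>2 * ?D w i j u u" if w: "w \<in> words k" and ij: "(i, j) \<in> edges" for w i j
  proof -
    have "?D w i j ?v ?v = ?D w i j (\<lambda>x. c * u x + d * u x) (\<lambda>x. c * u x + d * u x)"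
      by (intro dirichlet_cong) (simp_all add: pharm_segw[OF l w k ij])
    also have "\<dots> = (c + d)\<^sup>2 * ?D w i j u u"
      using F_tilde_H1C[OF u words_fin_mono[OF w] ij]
      by (subst dirichlet_lincomb) (simp_all add: power2_eq_square algebra_simps)
    finally show ?thesis .
  qed
  then have "DI p \<alpha> (Suc k) ?v ?v = (\<Sum>w\<in>words k. \<Sum>(i, j)\<in>edges. (c + d)\<^sup>2 * ?D w i j u u)"
    unfolding DI_Suc by (intro sum.cong refl) auto
  also have "\<dots> = (c + d)\<^sup>2 * DI p \<alpha> (Suc k) u u"
    unfolding DI_Suc case_prod_unfold by (simp add: sum_distrib_left)
  finally show ?thesis unfolding d_en_def by simp
qed

lemma pharm_q_en_level:
  assumes l: "admissible l"
  shows "q_en m (\<lambda>x. c * u x + d * pharm m l u x) = (c + d)\<^sup>2 * q_en m u"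
proof -
  let ?v = "\<lambda>x. c * u x + d * pharm m l u x"
  have "Q0 p (?v \<circ> gw w) (?v \<circ> gw w) = (c + d)\<^sup>2 * Q0 p (u \<circ> gw w) (u \<circ> gw w)"
    if w: "w \<in> words m" for w
  proof -
    have ve: "(?v \<circ> gw w) (p i) = (c + d) * (u \<circ> gw w) (p i)" if "i \<in> idx" for i
      using pharm_cell[OF l w p_in_K[OF that], of u] harm_vertex[OF l that] by (simp add: algebra_simps)
    have vd: "(?v \<circ> gw w) (p i) - (?v \<circ> gw w) (p j) = (c + d) * ((u \<circ> gw w) (p i) - (u \<circ> gw w) (p j))"
      if "i \<in> idx" "j \<in> idx" for i j
      unfolding ve[OF that(1)] ve[OF that(2)] by (simp only: right_diff_distrib)
    have 123: "1 \<in> idx" "2 \<in> idx" "3 \<in> idx" by (simp_all add: idx_def)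
    show ?thesis
      unfolding Q0_eq vd[OF 123(1,2)] vd[OF 123(2,3)] vd[OF 123(3,1)] by (simp only: power_mult_distrib distrib_left)
  qed
  then show ?thesis unfolding q_en_def Q_Sigma_def by (simp add: sum_distrib_left mult_ac)
qed

text \<open>The constant 7/2 is the bound 5/2 for piecewise harmonic functions plus one oscillation of \<open>u\<close>.\<close>

lemma pharm_uniformly_close:
  assumes u: "continuous_on K u" and e: "0 < e"
  shows "\<exists>M. \<forall>m\<ge>M. \<forall>l. admissible l \<longrightarrow> (\<forall>x\<in>K. \<bar>pharm m l u x - u x\<bar> \<le> e)"
proof -
  have "uniformly_continuous_on K u" by (rule compact_uniformly_continuous[OF u K(1)])
  then obtain d where d: "0 < d" "\<And>x y. x \<in> K \<Longrightarrow> y \<in> K \<Longrightarrow> dist x y < d \<Longrightarrow> \<bar>u x - u y\<bar> < 2 / 7 * e"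
    using e unfolding uniformly_continuous_on_def dist_real_def
    by (metis (no_types, lifting) divide_pos_pos mult_pos_pos zero_less_numeral dist_commute)
  obtain B where B: "\<And>x y. x \<in> K \<Longrightarrow> y \<in> K \<Longrightarrow> dist x y \<le> B"
    using compact_imp_bounded[OF K(1)] unfolding bounded_two_points by blast
  have "(\<lambda>m. \<beta> ^ m * B) \<longlonglongrightarrow> 0" using beta by (intro tendsto_mult_left_zero LIMSEQ_power_zero) auto
  then have "\<forall>\<^sub>F m in sequentially. \<beta> ^ m * B < d" using d(1) by (rule order_tendstoD)
  then obtain M where M: "\<And>m. M \<le> m \<Longrightarrow> \<beta> ^ m * B < d" unfolding eventually_sequentially by blast
  show ?thesis
  proof (intro exI[of _ M] allI impI ballI)
    fix m l x assume m: "M \<le> m" and l: "admissible l" and x: "x \<in> K"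
    from K_level_cases[OF x, of m] show "\<bar>pharm m l u x - u x\<bar> \<le> e"
    proof
      assume "\<exists>w\<in>words_fin. length w < m \<and> (\<exists>(i, j)\<in>edges. x \<in> bridge_at w i j)"
      then obtain w i j where w: "w \<in> words_fin" "length w < m" "(i, j) \<in> edges" "x \<in> bridge_at w i j" by blast
      have "w \<in> words (length w)" using w by (auto simp: words_def words_fin_eq)
      from pharm_segw[OF l this w(2,3)] w(4) show ?thesis using e unfolding segw_eq by simp
    next
      assume "\<exists>w\<in>words m. x \<in> gw w ` K"
      then obtain w y where w: "w \<in> words m" "y \<in> K" "x = gw w y" by blast
      have osc: "\<bar>u (gw w y) - u (gw w z)\<bar> \<le> 2 / 7 * e" if "y \<in> K" "z \<in> K" for y z
      proof -
        have "dist (gw w y) (gw w z) = \<beta> ^ m * dist y z"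
          using w(1) unfolding dist_Gw by (simp add: words_def)
        also have "\<dots> \<le> \<beta> ^ m * B" using B[OF that] beta by (intro mult_left_mono) auto
        also have "\<dots> < d" by (rule M[OF m])
        finally show ?thesis using d(2) Gw_in_K[OF words_fin_mono[OF w(1)]] that by (intro less_imp_le) blast
      qed
      let ?a = "\<lambda>i. u (gw w (p i))"
      have 1: "1 \<in> idx" unfolding idx_def by simp
      have "osc_le (2 / 7 * e) ?a" unfolding osc_le_def using osc p_in_K by blast
      from harm_bound[OF l this w(2) 1]
      have "\<bar>pharm m l u x - ?a 1\<bar> \<le> 5 / 2 * (2 / 7 * e)" unfolding w(3) pharm_cell[OF l w(1,2)] .
      moreover have "\<bar>u x - ?a 1\<bar> \<le> 2 / 7 * e" unfolding w(3) by (rule osc[OF w(2) p_in_K[OF 1]])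
      ultimately show ?thesis by linarith
    qed
  qed
qed

end

section \<open>Infinite words and the Sierpinski gasket\<close>

context gasket
begin

section \<open>Addresses of the points of \<Sigma>\<close>

lemma word_prefix: "\<omega> \<in> words_inf \<Longrightarrow> map \<omega> [0..<m] \<in> words m"
  unfolding words_inf_def words_def by auto

text \<open>Nested nonempty compact sets whose diameters are at most \<open>\<beta> ^ m * B\<close>:
  their intersection is a single point, so \<open>the_elem\<close> is meaningful.\<close>

lemma
  assumes w: "\<omega> \<in> words_inf"
  shows sigma_pt_mem: "sigma_pt p \<alpha> \<omega> \<in> gw (map \<omega> [0..<m]) ` \<Sigma>"
    and sigma_pt_unique: "(\<And>m. x \<in> gw (map \<omega> [0..<m]) ` \<Sigma>) \<Longrightarrow> sigma_pt p \<alpha> \<omega> = x"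
proof -
  let ?A = "\<lambda>m. gw (map \<omega> [0..<m]) ` \<Sigma>"
  have mono: "?A n \<subseteq> ?A m" if "m \<le> n" for m n
  proof -
    have "map \<omega> [0..<n] = map \<omega> [0..<m] @ map \<omega> [m..<n]"
      using that by (metis le_add_diff_inverse map_append upt_add_eq_append zero_le)
    moreover have "map \<omega> [m..<n] \<in> words_fin" using w unfolding words_fin_eq words_inf_def by auto
    ultimately show ?thesis using Gw_in_Sigma by (auto simp: comp_word_append)
  qed
  have "\<Inter>(range ?A) \<noteq> {}"
  proof (rule compact_nest)
    show "compact (?A n)" for n by (intro compact_continuous_image continuous_on_Gw Sigma)
    show "?A n \<noteq> {}" for n using Sigma(5) by simp
  qed (rule mono)
  then obtain y where y: "y \<in> ?A m" for m by blast
  obtain B where B: "\<And>x y. x \<in> \<Sigma> \<Longrightarrow> y \<in> \<Sigma> \<Longrightarrow> dist x y \<le> B"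
    using compact_imp_bounded[OF Sigma(1)] unfolding bounded_two_points by blast
  have uniq: "z = y" if z: "\<And>m. z \<in> ?A m" for z
  proof -
    have "dist z y \<le> \<beta> ^ m * B" for m
    proof -
      from z[of m] y[of m] obtain z' y' where "z' \<in> \<Sigma>" "y' \<in> \<Sigma>" "z = gw (map \<omega> [0..<m]) z'" "y = gw (map \<omega> [0..<m]) y'"
        by auto
      then show ?thesis using B beta by (simp add: dist_Gw)
    qed
    moreover have "(\<lambda>m. \<beta> ^ m * B) \<longlonglongrightarrow> 0" using beta by (intro tendsto_mult_left_zero LIMSEQ_power_zero) auto
    ultimately have "dist z y \<le> 0" using LIMSEQ_le_const[of _ 0 "dist z y"] by blast
    then show "z = y" by simp
  qed
  have "\<Inter>(range ?A) = {y}"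
  proof (intro equalityI subsetI)
    show "z \<in> {y}" if "z \<in> \<Inter>(range ?A)" for z using uniq[of z] that by simp
  qed (use y in simp)
  then have s: "sigma_pt p \<alpha> \<omega> = y" unfolding sigma_pt_def by simp
  show "sigma_pt p \<alpha> \<omega> \<in> ?A m" unfolding s by (rule y)
  show "sigma_pt p \<alpha> \<omega> = x" if "\<And>m. x \<in> ?A m" unfolding s using uniq[OF that] by simp
qed

lemma sigma_pt_surj:
  assumes "x \<in> \<Sigma>"
  obtains \<omega> where "\<omega> \<in> words_inf" "sigma_pt p \<alpha> \<omega> = x"
proof -
  define i where "i y = (SOME i. i \<in> idx \<and> y \<in> g i ` \<Sigma>)" for y
  have i: "i y \<in> idx \<and> y \<in> g (i y) ` \<Sigma>" if "y \<in> \<Sigma>" for y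
    unfolding i_def by (rule someI_ex) (use that Sigma(2) in blast)
  define pre where "pre y = G_inv (i y) y" for y
  have pre: "pre y \<in> \<Sigma>" "g (i y) (pre y) = y" if y: "y \<in> \<Sigma>" for y
  proof -
    obtain z where "z \<in> \<Sigma>" "y = g (i y) z" using i[OF y] by blast
    moreover from this(2) have "G_inv (i y) y = z" by (metis G_inv)
    ultimately show "pre y \<in> \<Sigma>" "g (i y) (pre y) = y" unfolding pre_def by simp_all
  qed
  define \<omega> where "\<omega> n = i ((pre ^^ n) x)" for n
  have it: "(pre ^^ n) x \<in> \<Sigma>" for n using assms pre by (induction n) auto
  have "\<omega> \<in> words_inf" unfolding words_inf_def \<omega>_def using i it by blast
  moreover have "x = gw (map \<omega> [0..<m]) ((pre ^^ m) x)" for m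
  proof (induction m)
    case (Suc m)
    have "g (\<omega> m) ((pre ^^ Suc m) x) = (pre ^^ m) x" unfolding \<omega>_def using pre(2)[OF it] by simp
    then show ?case using Suc by (simp add: comp_word_append)
  qed simp
  then have "x \<in> gw (map \<omega> [0..<m]) ` \<Sigma>" for m using it by blast
  ultimately show ?thesis using that sigma_pt_unique by blast
qed

lemma sigma_pt_ev_const:
  assumes v: "v \<in> words_fin" and j: "j \<in> idx"
  shows "ev_const v j \<in> words_inf" "sigma_pt p \<alpha> (ev_const v j) = gw v (p j)"
proof -
  show w: "ev_const v j \<in> words_inf"
    using v j unfolding words_inf_def ev_const_def words_fin_eq by (auto simp: subset_iff)
  show "sigma_pt p \<alpha> (ev_const v j) = gw v (p j)"
  proof (rule sigma_pt_unique[OF w])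
    fix m
    show "gw v (p j) \<in> gw (map (ev_const v j) [0..<m]) ` \<Sigma>"
    proof (cases "m \<le> length v")
      case True
      then have "map (ev_const v j) [0..<m] = take m v"
        by (intro nth_equalityI) (auto simp: ev_const_def)
      moreover have "gw v (p j) = gw (take m v) (gw (drop m v) (p j))"
        using comp_word_append[of "g" "take m v" "drop m v"] by simp
      moreover have "drop m v \<in> words_fin" using v by (auto simp: words_fin_eq dest: in_set_dropD)
      ultimately show ?thesis using Gw_in_Sigma p_in_Sigma[OF j] by auto
    next
      case False
      then have "map (ev_const v j) [0..<m] = v @ replicate (m - length v) j"
        by (intro nth_equalityI) (auto simp: ev_const_def nth_append)
      moreover have "gw (replicate n j) (p j) = p j" for n by (induction n) auto
      ultimately show ?thesis using p_in_Sigma[OF j] by (auto simp: comp_word_append intro!: image_eqI[of _ _ "p j"])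
    qed
  qed
qed

text \<open>The approximating values \<open>vals\<close> depend on the address, \<open>l\<close> and
  \<open>a\<close> but not on \<alpha>. This carries harmonic extensions from the stretched gasket
  to the Sierpinski gasket and back.\<close>

lemma harm_sigma_pt:
  assumes l: "admissible l" and w: "\<omega> \<in> words_inf"
  shows "(\<lambda>m. vals (map \<omega> [0..<m]) l a 1) \<longlonglongrightarrow> harm l a (sigma_pt p \<alpha> \<omega>)"
proof -
  obtain D where D: "osc_le D a" using osc_le_exists by blast
  have 1: "1 \<in> idx" by (simp add: idx_def)
  have "\<bar>vals (map \<omega> [0..<m]) l a 1 - harm l a (sigma_pt p \<alpha> \<omega>)\<bar> \<le> 5 / 2 * ((3 / 5) ^ m * D)" for m
  proof -
    note wm = word_prefix[OF w, of m]
    obtain y where y: "y \<in> \<Sigma>" "sigma_pt p \<alpha> \<omega> = gw (map \<omega> [0..<m]) y"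
      using sigma_pt_mem[OF w, of m] by blast
    then have yK: "y \<in> K" using Sigma_subset_K by blast
    show ?thesis
      unfolding y(2) harm_word[OF l wm yK] abs_minus_commute[of "vals _ _ _ _"]
      by (rule harm_bound[OF admissible_shift[OF l] vals_osc[OF l D wm] yK 1])
  qed
  then have bd: "\<forall>m. norm (vals (map \<omega> [0..<m]) l a 1 - harm l a (sigma_pt p \<alpha> \<omega>)) \<le> 5 / 2 * ((3 / 5) ^ m * D)"
    unfolding real_norm_def by blast
  have lim: "(\<lambda>m. 5 / 2 * ((3 / 5) ^ m * D)) \<longlonglongrightarrow> 0"
    by (intro tendsto_mult_right_zero tendsto_mult_left_zero LIMSEQ_power_zero) auto
  show ?thesis by (rule LIM_zero_cancel) (rule Lim_null_comparison[OF always_eventually[OF bd] lim])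
qed

lemma K_eq_Sigma_collapsed:
  assumes "\<alpha> = 0" shows "K = \<Sigma>"
proof
  have "bridges \<subseteq> (\<Union>i\<in>idx. g i ` K)"
  proof
    fix x assume "x \<in> bridges"
    then obtain i j where ij: "(i, j) \<in> edges" "x \<in> bridge i j" unfolding bridges_eq by auto
    then have "x = tip i j" using pp_collapse[OF assms, of i j] unfolding seg_def by simp
    then show "x \<in> (\<Union>i\<in>idx. g i ` K)" using edges_D[OF ij(1)] p_in_K unfolding pp_def by blast
  qed
  then have e: "K = (\<Union>i\<in>idx. g i ` K) \<union> {}" using K(2) by blast
  have e': "\<Sigma> = (\<Union>i\<in>idx. g i ` \<Sigma>) \<union> {}" using Sigma(2) by blast
  show "K \<subseteq> \<Sigma>" using attractor_unique[OF K(1) e Sigma(1,5) e'] by blast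
qed (rule Sigma_subset_K)

text \<open>An outermost bridge meets the cells only at its tips, which lie in \<Sigma>, and two
  different cells could meet only for \<alpha> = 0. Hence a point off \<Sigma> lies on one bridge,
  and the definite description in \<open>pi_star\<close> is single-valued.\<close>

lemma segw_disjoint:
  assumes a0: "\<alpha> \<noteq> 0" and x: "x \<notin> \<Sigma>"
    and "w \<in> words_fin" "(i, j) \<in> edges" "x \<in> bridge_at w i j"
    and "w' \<in> words_fin" "(i', j') \<in> edges" "x \<in> bridge_at w' i' j'"
  shows "w = w' \<and> (i, j) = (i', j')"
  using assms(2-)
proof (induction w arbitrary: w' x)
  have mixed: False if x: "x \<notin> \<Sigma>" and ij: "(i, j) \<in> edges" and xs: "x \<in> bridge_at [] i j"
    and w': "k # v \<in> words_fin" "(i', j') \<in> edges" "x \<in> bridge_at (k # v) i' j'" for x i j k v i' j'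
  proof -
    have k: "k \<in> idx" and v: "v \<in> words_fin" using w'(1) by (auto simp: words_fin_eq)
    obtain y where y: "y \<in> bridge_at v i' j'" "x = g k y" using w'(3) unfolding segw_def by auto
    have yT: "y \<in> T" using y(1) segw_in_K[OF v w'(2)] K_in_T by blast
    have "1 - \<beta> \<le> bary k x"
      unfolding y(2) bary_G using k T_nonneg[OF yT k] beta by simp
    moreover have "x \<in> bridge i j" using xs unfolding segw_def by simp
    ultimately have "x = tip i j \<or> x = tip j i" using seg_cell_endpoint[OF ij _ k] by blast
    then show False using x edges_D[OF ij] G_in_Sigma p_in_Sigma unfolding pp_def by blast
  qed
  {
    case Nil
    show ?case
    proof (cases w')
      case Nil
      then show ?thesis using seg_disjoint[OF Nil.prems(3,6)] Nil.prems(4,7) unfolding segw_def by simp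
    next
      case (Cons k v)
      then show ?thesis using mixed[OF Nil.prems(1,3,4)] Nil.prems(5-7) by blast
    qed
  next
    case (Cons n u)
    show ?case
    proof (cases w')
      case Nil
      then show ?thesis using mixed[OF Cons.prems(1,6) _ Cons.prems(2-4)] Cons.prems(7) by blast
    next
      case w': (Cons k v)
      have idx: "n \<in> idx" "k \<in> idx" and uv: "u \<in> words_fin" "v \<in> words_fin"
        using Cons.prems w' by (auto simp: words_fin_eq)
      obtain y where y: "y \<in> bridge_at u i j" "x = g n y" using Cons.prems(4) unfolding segw_def by auto
      obtain z where z: "z \<in> bridge_at v i' j'" "x = g k z" using Cons.prems(7) unfolding w' segw_def by auto
      have T: "y \<in> T" "z \<in> T"
        using y(1) z(1) segw_in_K[OF uv(1) Cons.prems(3)] segw_in_K[OF uv(2) Cons.prems(6)] K_in_T by blast+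
      have "n = k"
      proof (rule ccontr)
        assume "n \<noteq> k"
        have "1 - \<beta> \<le> bary n x" unfolding y(2) bary_G using idx T_nonneg[OF T(1) idx(1)] beta by simp
        also have "\<dots> \<le> \<beta>"
          unfolding z(2) bary_G using idx \<open>n \<noteq> k\<close> T_le_1[OF T(2) idx(1)] beta by (simp add: mult_left_le)
        finally have "1 - \<beta> \<le> \<beta>" .
        moreover have "2 * \<beta> = 1 - \<alpha>" unfolding \<beta>_def by simp
        ultimately have "\<alpha> \<le> 0" by linarith
        then show False using a0 alpha by simp
      qed
      then have "y = z" using y(2) z(2) inj_G by (metis injD)
      moreover have "y \<notin> \<Sigma>" using Cons.prems(1) G_in_Sigma[OF idx(1)] y(2) by blast
      ultimately show ?thesis
        using Cons.IH[OF _ uv(1) Cons.prems(3) y(1) uv(2) Cons.prems(6)] z(1) w' \<open>n = k\<close> by blast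
    qed
  }
qed

end

section \<open>The Sierpinski gasket as the case of collapsed bridges\<close>

lemma F_eq_G: "F p = G p 0"
  unfolding F_def G_def by (intro ext) simp

lemma sg_K_eq: "sg_K p = ssg_Sigma p 0"
  unfolding sg_K_def ssg_Sigma_def F_eq_G ..

lemma sg_pt_eq: "sg_pt p \<omega> = sigma_pt p 0 \<omega>"
  unfolding sg_pt_def sigma_pt_def sg_K_eq F_eq_G ..

abbreviation fifth :: "nat \<Rightarrow> real" where "fifth \<equiv> (\<lambda>_. 1 / 5)"

context gasket
begin

lemma admissible_fifth: "admissible fifth"
  unfolding admissible_def by simp

text \<open>The factor \<open>15 * l^2\<close> is 3/5 for \<open>l = 1/5\<close>, so the
  renormalized energies do not depend on the level at all.\<close>

lemma harm_in_F_star: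
  assumes "\<alpha> = 0"
  shows "harm fifth a \<in> F_star p"
proof -
  have c: "continuous_on (sg_K p) (harm fifth a)"
    using continuous_on_harm[OF admissible_fifth] K_eq_Sigma_collapsed[OF assms] assms unfolding sg_K_eq by simp
  have "(\<Sum>w\<in>words m. Q0 p (harm fifth a \<circ> Fw p w) (harm fifth a \<circ> Fw p w)) = (\<Prod>k<m. 15 * (1 / 5)\<^sup>2) * osc2 a" for m
    using harm_Q[OF admissible_fifth, of "harm fifth a" "[]" a m] assms unfolding F_eq_G by simp
  moreover have "(\<Prod>k<m. 15 * (1 / 5)\<^sup>2) = (3 / 5 :: real) ^ m" for m :: nat by (simp add: power2_eq_square)
  ultimately have "(5 / 3) ^ m * (\<Sum>w\<in>words m. Q0 p (harm fifth a \<circ> Fw p w) (harm fifth a \<circ> Fw p w)) = osc2 a" for m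
    by (simp add: power_divide)
  then show ?thesis using c unfolding F_star_def by simp
qed

text \<open>The function on the Sierpinski gasket is the extension of the same \<open>a\<close> for
  \<alpha> = 0. On \<Sigma> both are limits of the same values along an address, whichever address
  the inverse picks. On a bridge \<open>subvals (1 / 5)\<close> is symmetric, so the extension is
  constant there and can be read off at a tip, whose address is the one in
  \<open>pi_star\<close>.\<close>

lemma harm_in_F_star_K:
  assumes a0: "\<alpha> \<noteq> 0" and u: "\<And>x. x \<in> K \<Longrightarrow> u x = harm fifth a x"
  shows "u \<in> F_star_K p \<alpha>"
proof -
  interpret sg: gasket p 0 using triangle by unfold_locales auto
  define f where "f = sg.harm fifth a"
  have f: "f \<in> F_star p" unfolding f_def by (rule sg.harm_in_F_star) simp
  have pt: "harm fifth a (sigma_pt p \<alpha> \<omega>) = f (sg_pt p \<omega>)" if w: "\<omega> \<in> words_inf" for \<omega>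
    unfolding f_def sg_pt_eq
    by (rule LIMSEQ_unique[OF harm_sigma_pt[OF admissible_fifth w] sg.harm_sigma_pt[OF sg.admissible_fifth w]])
  have "u x = f (pi_star p \<alpha> x)" if x: "x \<in> K" for x
  proof (cases "x \<in> \<Sigma>")
    case True
    then have s: "x \<in> sigma_pt p \<alpha> ` words_inf" using sigma_pt_surj by blast
    then have "sigma_pt p \<alpha> (inv_into words_inf (sigma_pt p \<alpha>) x) = x" "inv_into words_inf (sigma_pt p \<alpha>) x \<in> words_inf"
      by (rule f_inv_into_f, rule inv_into_into)
    with pt[of "inv_into words_inf (sigma_pt p \<alpha>) x"] u[OF x] True show ?thesis
      unfolding pi_star_def pi_map_def by simp
  next
    case False
    obtain w i j where w: "w \<in> words_fin" "(i, j) \<in> edges" "x \<in> bridge_at w i j"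
      using K_cases[OF x] False by blast
    note ij = edges_D[OF w(2)]
    have wi: "w @ [i] \<in> words_fin" using w(1) ij by (simp add: words_fin_eq)
    have "(THE y. \<exists>w\<in>words_fin. \<exists>(i, j)\<in>edges. x \<in> bridge_at w i j \<and> y = sg_pt p (ev_const (w @ [i]) j))
       = sg_pt p (ev_const (w @ [i]) j)"
    proof (rule the_equality)
      show "\<exists>w'\<in>words_fin. \<exists>(k, l)\<in>edges. x \<in> bridge_at w' k l \<and> sg_pt p (ev_const (w @ [i]) j) = sg_pt p (ev_const (w' @ [k]) l)"
        by (rule bexI[OF _ w(1)], rule bexI[OF _ w(2)]) (use w(3) in simp)
    next
      fix y assume "\<exists>w\<in>words_fin. \<exists>(i, j)\<in>edges. x \<in> bridge_at w i j \<and> y = sg_pt p (ev_const (w @ [i]) j)"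
      then obtain w' i' j' where w': "w' \<in> words_fin" "(i', j') \<in> edges" "x \<in> bridge_at w' i' j'"
        "y = sg_pt p (ev_const (w' @ [i']) j')" by blast
      show "y = sg_pt p (ev_const (w @ [i]) j)"
        using segw_disjoint[OF a0 False w w'(1-3)] w'(4) by simp
    qed
    then have ps: "pi_star p \<alpha> x = sg_pt p (ev_const (w @ [i]) j)" using False unfolding pi_star_def by simp
    have wl: "w \<in> words (length w)" using w(1) by (simp add: words_def words_fin_eq)
    let ?l = "linepath (gw w (tip i j)) (gw w (tip j i))"
    obtain t where t: "t \<in> {0..1}" "x = ?l t"
      using w(3) unfolding segw_eq linepath_image_01[symmetric] by blast
    have const: "harm fifth a (?l s) = subvals (1 / 5) (vals w fifth a) i j" if "s \<in> {0..1}" for s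
    proof -
      have "subvals (1 / 5) (vals w fifth a) j i = subvals (1 / 5) (vals w fifth a) i j"
        unfolding subvals_def using ij by (simp add: algebra_simps)
      then show ?thesis
        using harm_affine_edge[OF admissible_fifth wl w(2) that, of "harm fifth a" "[]" a] by simp
    qed
    have "harm fifth a x = harm fifth a (?l 0)" using const[OF t(1)] const[of 0] unfolding t(2) by simp
    also have "?l 0 = sigma_pt p \<alpha> (ev_const (w @ [i]) j)"
      using sigma_pt_ev_const(2)[OF wi, of j] ij by (simp add: linepath_0' comp_word_append pp_def)
    also have "harm fifth a \<dots> = f (sg_pt p (ev_const (w @ [i]) j))"
      using sigma_pt_ev_const(1)[OF wi, of j] ij by (intro pt) auto
    finally show ?thesis unfolding ps u[OF x] .
  qed
  then show ?thesis using f unfolding F_star_K_def by blast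
qed

lemma pharm_in_F_star:
  assumes a0: "\<alpha> \<noteq> 0" and u: "u \<in> FT"
  shows "pharm m fifth u \<in> F_star_m p \<alpha> m"
proof -
  have "pharm m fifth u \<circ> gw w \<in> F_star_K p \<alpha>" if "w \<in> words m" for w
    by (rule harm_in_F_star_K[OF a0]) (simp add: pharm_cell[OF admissible_fifth that])
  then show ?thesis using pharm_F_tilde[OF admissible_fifth u] unfolding F_star_m_def by blast
qed

text \<open>Equal vertex values on a cell force constancy on the whole cell, because
  \<open>harm_bound\<close> then holds with oscillation 0.\<close>

lemma pharm_in_F_tilde_m:
  assumes l: "admissible l" and u: "u \<in> FT" and z: "l n = 0"
  shows "pharm m l u \<in> F_tilde_m p \<alpha> (m + Suc n)"
proof -
  have "pharm m l u constant_on (gw w ` K)" if w: "w \<in> words (m + Suc n)" for w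
  proof -
    from w obtain v w' where vw: "w = v @ w'" "v \<in> words m" "w' \<in> words (Suc n)"
      unfolding words_add by auto
    let ?b = "vals w' l (\<lambda>i. u (gw v (p i)))"
    have 1: "1 \<in> idx" by (simp add: idx_def)
    have "pharm m l u (gw w x) = ?b 1" if x: "x \<in> K" for x
    proof -
      have "pharm m l u (gw w x) = harm (\<lambda>k. l (Suc n + k)) ?b x"
        unfolding vw(1) comp_word_append o_apply
          pharm_cell[OF l vw(2) Gw_in_K[OF words_fin_mono[OF vw(3)] x]] harm_word[OF l vw(3) x] ..
      then show ?thesis
        using harm_bound[OF admissible_shift[OF l] vals_zero[where l=l and n=n, OF vw(3) z] x 1, of "Suc n"] by simp
    qed
    then show ?thesis unfolding constant_on_def by blast
  qed
  then show ?thesis using pharm_F_tilde[OF l u] unfolding F_tilde_m_def by blast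
qed

end

section \<open>The resistance weights\<close>

locale matched_gasket = gasket p \<alpha> for p \<alpha> +
  fixes R :: "nat \<Rightarrow> real \<times> real"
  assumes alpha_pos: "0 < \<alpha>" and MP: "\<And>m. 1 \<le> m \<Longrightarrow> R m \<in> MP"
begin

abbreviation "FR \<equiv> F_R p \<alpha> R"
abbreviation "DI_quad \<equiv> DI_eta_quad p \<alpha> (eta R)"
abbreviation "Rs \<equiv> R_star R"

definition rho :: "nat \<Rightarrow> real" where "rho k = snd (R (Suc k))"

text \<open>The matching condition gives \<open>r = 3/5 * (1 - \<rho>)\<close>, so this is
  \<open>delta R m\<close> freed from its power of 3/5. Indices start at 0.\<close>

definition cc :: "nat \<Rightarrow> real" where "cc m = (\<Prod>k<m. 1 - rho k)"

lemma rho: "0 < rho k" "rho k < 1" "fst (R (Suc k)) = 3 / 5 * (1 - rho k)"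
proof -
  have "R (Suc k) \<in> MP" by (rule MP) simp
  then have "0 < fst (R (Suc k))" "0 < rho k" "5 / 3 * fst (R (Suc k)) + rho k = 1"
    unfolding MP_def rho_def by auto
  then show "0 < rho k" "rho k < 1" "fst (R (Suc k)) = 3 / 5 * (1 - rho k)" by auto
qed

lemma cc_0 [simp]: "cc 0 = 1" unfolding cc_def by simp

lemma cc_Suc: "cc (Suc m) = cc m * (1 - rho m)" unfolding cc_def by simp

lemma cc_pos: "0 < cc m"
  unfolding cc_def using rho by (intro prod_pos) auto

lemma cc_decreasing: "cc (Suc m) < cc m"
  unfolding cc_Suc using cc_pos[of m] rho[of m] by simp

lemma cc_diff_pos: "0 < cc m - cc (Suc m)"
  using cc_decreasing[of m] by simp

lemma decseq_cc: "decseq cc"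
  by (intro decseq_SucI less_imp_le cc_decreasing)

lemma cc_strict: "m < n \<Longrightarrow> cc n < cc m"
  using cc_decreasing decseqD[OF decseq_cc, of "Suc m" n] by (metis Suc_leI le_less_trans)

lemma prod_from_1: "(\<Prod>k=1..m. f k) = (\<Prod>k<m. f (Suc k))" for f :: "nat \<Rightarrow> real"
  unfolding One_nat_def by (rule prod.atLeast1_atMost_eq)

lemma sum_from_1: "(\<Sum>k=1..m. f k) = (\<Sum>k<m. f (Suc k))" for f :: "nat \<Rightarrow> real"
  unfolding One_nat_def by (rule sum.atLeast1_atMost_eq)

lemma delta_cc: "delta R m = (3 / 5) ^ m * cc m"
  unfolding delta_def prod_from_1 rho(3) cc_def prod.distrib by simp

lemma gamma_cc: "gamma R (Suc k) = (3 / 5) ^ k * (cc k - cc (Suc k))"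
  unfolding gamma_def delta_cc cc_Suc rho_def[symmetric] by (simp add: algebra_simps)

lemma R_star_lim: "Rs = lim cc"
proof -
  have "(\<lambda>n. \<Prod>m=1..n. 1 - snd (R m)) = cc"
    unfolding prod_from_1 cc_def rho_def ..
  then show ?thesis unfolding R_star_def by simp
qed

lemma cc_tendsto: "cc \<longlonglongrightarrow> Rs"
  unfolding R_star_lim
  using decseq_convergent[OF decseq_cc, of 0] cc_pos by (metis less_imp_le limI)

lemma R_star_le: "Rs \<le> cc m"
  by (rule decseq_ge[OF decseq_cc cc_tendsto])

lemma R_star_nonneg: "0 \<le> Rs"
  by (rule LIMSEQ_le_const[OF cc_tendsto]) (use cc_pos less_imp_le in blast)

lemma R_star_less_1: "Rs < 1"
  using R_star_le[of 1] cc_strict[of 0 1] by simp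

text \<open>Contrapositive: \<open>1 - t \<le> exp (- t)\<close> bounds the partial sums of
  \<open>rho\<close> by \<open>- ln Rs\<close> if the limit is positive.\<close>

lemma R_star_0:
  assumes "\<not> summable rho" shows "Rs = 0"
proof (rule ccontr)
  assume "Rs \<noteq> 0"
  then have pos: "0 < Rs" using R_star_nonneg by simp
  have "(\<Sum>k<m. rho k) \<le> - ln (Rs)" for m
  proof -
    have "cc m \<le> (\<Prod>k<m. exp (- rho k))"
      unfolding cc_def
    proof (rule prod_mono)
      show "0 \<le> 1 - rho k \<and> 1 - rho k \<le> exp (- rho k)" for k
        using rho(2)[of k] exp_ge_add_one_self[of "- rho k"] by simp
    qed
    also have "\<dots> = exp (- (\<Sum>k<m. rho k))" by (simp only: exp_sum[OF finite_lessThan] sum_negf[symmetric])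
    finally have "Rs \<le> exp (- (\<Sum>k<m. rho k))" using R_star_le[of m] by simp
    then have "ln (Rs) \<le> ln (exp (- (\<Sum>k<m. rho k)))" using pos by (subst ln_le_cancel_iff) simp_all
    then show ?thesis by simp
  qed
  then have "(\<Sum>k\<le>n. rho k) \<le> - ln (Rs)" for n
    unfolding lessThan_Suc_atMost[symmetric] .
  then have "summable rho" by (rule bounded_imp_summable[OF less_imp_le[OF rho(1)]])
  then show False using assms by simp
qed

text \<open>Absolute convergence of the product yields convergence in the strict sense, for which
  the limit is nonzero when no factor vanishes.\<close>

lemma R_star_pos:
  assumes "summable rho" shows "0 < Rs"
proof -
  have c: "convergent_prod (\<lambda>k. 1 - rho k)"
    using assms rho(1) by (intro abs_convergent_prod_imp_convergent_prod summable_imp_abs_convergent_prod) (simp add: less_imp_le)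
  have nz: "1 - rho k \<noteq> 0" for k using rho(2)[of k] by simp
  have "(\<lambda>n. \<Prod>k\<le>n. 1 - rho k) \<longlonglongrightarrow> Rs"
    using LIMSEQ_Suc[OF cc_tendsto] unfolding cc_def lessThan_Suc_atMost .
  then have "Rs = prodinf (\<lambda>k. 1 - rho k)"
    by (rule LIMSEQ_unique[OF _ convergent_prod_LIMSEQ[OF c]])
  then show ?thesis using R_star_nonneg prodinf_nonzero[OF c nz] by simp
qed

section \<open>The limit form\<close>

definition s_en :: "nat \<Rightarrow> (plane \<Rightarrow> real) \<Rightarrow> real" where
  "s_en k u = d_en k u / (cc k - cc (Suc k))"

definition En :: "nat \<Rightarrow> (plane \<Rightarrow> real) \<Rightarrow> real" where
  "En m u = q_en m u / cc m + (\<Sum>k<m. s_en k u)"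

lemma s_en_nonneg: "0 \<le> s_en k u"
  unfolding s_en_def using d_en_nonneg cc_diff_pos by (simp add: less_imp_le)

lemma q_cc_nonneg: "0 \<le> q_en m u / cc m"
  using q_en_nonneg cc_pos by (simp add: less_imp_le)

lemma q_cc_le_En: "q_en m u / cc m \<le> En m u"
  unfolding En_def using sum_nonneg[of "{..<m}" "\<lambda>k. s_en k u"] s_en_nonneg by simp

lemma sum_s_en_le_En: "(\<Sum>k<m. s_en k u) \<le> En m u"
  unfolding En_def using q_cc_nonneg by simp

lemma E_R_m_eq:
  "E_R_m p \<alpha> R m u v = (5 / 3) ^ m * Q_Sigma p \<alpha> m u v / cc m
     + (\<Sum>k<m. (5 / 3) ^ k * DI p \<alpha> (Suc k) u v / (cc k - cc (Suc k)))"
  unfolding E_R_m_def sum_from_1 delta_cc gamma_cc by (simp add: power_divide field_simps)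

lemma E_R_m_diag: "E_R_m p \<alpha> R m u u = En m u"
  unfolding E_R_m_eq En_def q_en_def s_en_def d_en_def ..

lemma E_R_m_lincomb:
  assumes "u \<in> FT" "v \<in> FT"
  shows "En m (\<lambda>x. c * u x + d * v x) = c\<^sup>2 * En m u + 2 * c * d * E_R_m p \<alpha> R m u v + d\<^sup>2 * En m v"
proof -
  have "E_R_m p \<alpha> R m (\<lambda>x. c * u x + d * v x) (\<lambda>x. c * u x + d * v x)
      = c\<^sup>2 * E_R_m p \<alpha> R m u u + 2 * c * d * E_R_m p \<alpha> R m u v + d\<^sup>2 * E_R_m p \<alpha> R m v v"
    unfolding E_R_m_eq Q_Sigma_lincomb DI_lincomb[OF assms]
    by (simp add: distrib_left add_divide_distrib sum.distrib sum_distrib_left mult_ac)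
  then show ?thesis unfolding E_R_m_diag .
qed

lemma parallelogram_scale:
  fixes k :: real
  assumes "a + b = 2 * c + 2 * d"
  shows "k * a + k * b = 2 * (k * c) + 2 * (k * d)"
proof -
  have "k * a + k * b = k * (2 * c + 2 * d)" unfolding assms[symmetric] by (rule distrib_left[symmetric])
  then show ?thesis by (simp add: algebra_simps)
qed

lemma q_en_parallelogram:
  "q_en m (\<lambda>x. u x + v x) + q_en m (\<lambda>x. u x - v x) = 2 * q_en m u + 2 * q_en m v"
  unfolding q_en_def
  using Q_Sigma_lincomb[of p \<alpha> m 1 u 1 v] Q_Sigma_lincomb[of p \<alpha> m 1 u "-1" v]
  by (intro parallelogram_scale) simp

lemma s_en_parallelogram:
  assumes "u \<in> FT" "v \<in> FT"
  shows "s_en m (\<lambda>x. u x + v x) + s_en m (\<lambda>x. u x - v x) = 2 * s_en m u + 2 * s_en m v"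
  unfolding s_en_def d_en_def times_divide_eq_left[symmetric]
  using DI_lincomb[OF assms, of m 1 1] DI_lincomb[OF assms, of m 1 "-1"]
  by (intro parallelogram_scale) simp

lemma
  assumes "u \<in> FT" "v \<in> FT"
  shows F_tilde_add: "(\<lambda>x. u x + v x) \<in> FT" and F_tilde_diff: "(\<lambda>x. u x - v x) \<in> FT"
  using F_tilde_lincomb[OF assms, of 1 1] F_tilde_lincomb[OF assms, of 1 "-1"] by simp_all

lemma
  assumes "u \<in> FT" "v \<in> FT"
  shows En_parallelogram: "En m (\<lambda>x. u x + v x) + En m (\<lambda>x. u x - v x) = 2 * En m u + 2 * En m v"
    and En_polar: "E_R_m p \<alpha> R m u v = (En m (\<lambda>x. u x + v x) - En m (\<lambda>x. u x - v x)) / 4"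
  using E_R_m_lincomb[OF assms, of m 1 1] E_R_m_lincomb[OF assms, of m 1 "-1"] by simp_all

lemma En_nonneg: "0 \<le> En m u"
  using q_cc_nonneg q_cc_le_En order_trans by blast

lemma En_sum_le:
  assumes "u \<in> FT" "v \<in> FT"
  shows "En m u \<le> 2 * En m v + 2 * En m (\<lambda>x. u x - v x)"
  using En_parallelogram[OF assms(2) F_tilde_diff[OF assms], of m] En_nonneg[of m "\<lambda>x. v x - (u x - v x)"] by simp

lemma incseq_En:
  assumes "u \<in> FT" shows "incseq (\<lambda>m. En m u)"
proof (rule incseq_SucI)
  fix m
  show "En m u \<le> En (Suc m) u"
    using q_en_step[OF assms cc_pos cc_decreasing, of m m] unfolding En_def s_en_def by simp
qed

definition Elim :: "(plane \<Rightarrow> real) \<Rightarrow> real" where "Elim u = lim (\<lambda>m. En m u)"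

lemma F_R_iff: "u \<in> FR \<longleftrightarrow> u \<in> FT \<and> convergent (\<lambda>m. En m u)"
  unfolding F_R_def E_R_m_diag by simp

lemma F_R_I:
  assumes "u \<in> FT" "\<And>m. En m u \<le> B" shows "u \<in> FR"
  unfolding F_R_iff using incseq_convergent[OF incseq_En[OF assms(1)], of B] assms unfolding convergent_def by blast

lemma F_R_tilde: "u \<in> FR \<Longrightarrow> u \<in> FT"
  unfolding F_R_iff by simp

lemma En_tendsto: "u \<in> FR \<Longrightarrow> (\<lambda>m. En m u) \<longlonglongrightarrow> Elim u"
  unfolding F_R_iff Elim_def by (simp add: convergent_LIMSEQ_iff)

lemma En_le_Elim: "u \<in> FR \<Longrightarrow> En m u \<le> Elim u"
  by (rule incseq_le[OF incseq_En[OF F_R_tilde] En_tendsto])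

lemma
  assumes "u \<in> FR" "v \<in> FR"
  shows F_R_add: "(\<lambda>x. u x + v x) \<in> FR" and F_R_diff: "(\<lambda>x. u x - v x) \<in> FR"
proof -
  note t = assms[THEN F_R_tilde]
  have b: "2 * En m u + 2 * En m v \<le> 2 * Elim u + 2 * Elim v" for m
    using En_le_Elim[OF assms(1), of m] En_le_Elim[OF assms(2), of m] by simp
  show "(\<lambda>x. u x + v x) \<in> FR"
  proof (rule F_R_I[OF F_tilde_add[OF t]])
    show "En m (\<lambda>x. u x + v x) \<le> 2 * Elim u + 2 * Elim v" for m
      using En_parallelogram[OF t, of m] En_nonneg[of m "\<lambda>x. u x - v x"] b[of m] by simp
  qed
  show "(\<lambda>x. u x - v x) \<in> FR"
  proof (rule F_R_I[OF F_tilde_diff[OF t]])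
    show "En m (\<lambda>x. u x - v x) \<le> 2 * Elim u + 2 * Elim v" for m
      using En_parallelogram[OF t, of m] En_nonneg[of m "\<lambda>x. u x + v x"] b[of m] by simp
  qed
qed

lemma E_R_polar:
  assumes "u \<in> FR" "v \<in> FR"
  shows "E_R p \<alpha> R u v = (Elim (\<lambda>x. u x + v x) - Elim (\<lambda>x. u x - v x)) / 4"
  unfolding E_R_def En_polar[OF assms[THEN F_R_tilde]]
  by (intro limI tendsto_intros En_tendsto F_R_add F_R_diff assms) simp

lemma s_en_summable:
  assumes "u \<in> FR" shows "summable (\<lambda>k. s_en k u)"
proof (rule bounded_imp_summable)
  show "0 \<le> s_en k u" for k by (rule s_en_nonneg)
  show "(\<Sum>k\<le>n. s_en k u) \<le> Elim u" for n
    using sum_s_en_le_En[of u "Suc n"] En_le_Elim[OF assms, of "Suc n"] unfolding lessThan_Suc_atMost by simp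
qed

section \<open>The form on the bridges\<close>

text \<open>The differences \<open>cc k - cc (Suc k)\<close> add up to \<open>1 - Rs\<close>.
  Division by this number normalizes the weights \<open>eta R (Suc k)\<close>, freed from their
  powers of 3/5, to total mass one.\<close>

lemma eta_cc: "1 / eta R (Suc k) * DI p \<alpha> (Suc k) u u = (1 - Rs) * s_en k u"
proof -
  have "eta R (Suc k) = gamma R (Suc k) / (1 - Rs)"
    unfolding eta_def gamma_def delta_def ..
  then show ?thesis unfolding gamma_cc s_en_def d_en_def by (simp add: power_divide field_simps)
qed

lemma DI_eta_quad_eq: "DI_quad u = (\<Sum>k. ennreal ((1 - Rs) * s_en k u))"
  unfolding DI_eta_quad_def eta_cc ..

lemma DI_eta_terms_nonneg: "0 \<le> (1 - Rs) * s_en k u"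
  using R_star_less_1 s_en_nonneg by simp

lemma DI_eta_quad_summable:
  assumes "summable (\<lambda>k. s_en k u)"
  shows "DI_quad u = ennreal ((1 - Rs) * suminf (\<lambda>k. s_en k u))"
  unfolding DI_eta_quad_eq suminf_mult[OF assms, symmetric]
  by (intro suminf_ennreal2 DI_eta_terms_nonneg summable_mult assms)

lemma summable_DI_eta_quad:
  assumes "DI_quad u < \<infinity>" shows "summable (\<lambda>k. s_en k u)"
proof -
  have "summable (\<lambda>k. (1 - Rs) * s_en k u)"
    using assms unfolding DI_eta_quad_eq by (intro summable_suminf_not_top DI_eta_terms_nonneg) auto
  then show ?thesis using R_star_less_1 by (simp add: summable_cmult_iff)
qed

lemma DI_eta_quad_le:
  assumes "\<And>m. (\<Sum>k<m. s_en k u) \<le> b"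
  shows "DI_quad u \<le> ennreal ((1 - Rs) * b)"
proof -
  have s: "summable (\<lambda>k. s_en k u)"
    using assms[of "Suc _"] s_en_nonneg unfolding lessThan_Suc_atMost by (rule bounded_imp_summable[rotated])
  have "suminf (\<lambda>k. s_en k u) \<le> b" by (rule suminf_le_const[OF s assms])
  then show ?thesis unfolding DI_eta_quad_summable[OF s] using R_star_less_1 by (intro ennreal_leI mult_left_mono) auto
qed

lemma sum_s_en_le_DI_eta_quad:
  assumes "DI_quad u \<le> ennreal ((1 - Rs) * b)" "0 \<le> b"
  shows "(\<Sum>k<m. s_en k u) \<le> b"
proof -
  have s: "summable (\<lambda>k. s_en k u)"
    by (rule summable_DI_eta_quad) (use assms(1) in \<open>auto intro: le_less_trans\<close>)
  have "(1 - Rs) * suminf (\<lambda>k. s_en k u) \<le> (1 - Rs) * b"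
    using assms R_star_less_1 unfolding DI_eta_quad_summable[OF s] by (subst (asm) ennreal_le_iff) auto
  then have "suminf (\<lambda>k. s_en k u) \<le> b" using R_star_less_1 by simp
  then show ?thesis using sum_le_suminf[OF s, of "{..<m}"] s_en_nonneg by fastforce
qed

lemma DI_eta_quad_finite_F_R: "u \<in> FR \<Longrightarrow> DI_quad u < \<infinity>"
  using DI_eta_quad_summable[OF s_en_summable] by simp

lemma DI_eta_polar:
  assumes "u \<in> FR" "v \<in> FR"
  shows "DI_eta p \<alpha> (eta R) u v
    = (1 - Rs) * (suminf (\<lambda>k. s_en k (\<lambda>x. u x + v x)) - suminf (\<lambda>k. s_en k (\<lambda>x. u x - v x))) / 4"
proof -
  have e: "enn2real (DI_quad w) = (1 - Rs) * suminf (\<lambda>k. s_en k w)" if "w \<in> FR" for w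
    unfolding DI_eta_quad_summable[OF s_en_summable[OF that]]
    using R_star_less_1 suminf_nonneg[OF s_en_summable[OF that] s_en_nonneg] by simp
  show ?thesis
    unfolding DI_eta_def e[OF F_R_add[OF assms]] e[OF F_R_diff[OF assms]] right_diff_distrib ..
qed

section \<open>Approximation\<close>

text \<open>Since \<open>u\<close> and its approximant agree up to level \<open>n\<close>, the energy of their sum is at least
  \<open>4 * En n u\<close>; the parallelogram law then bounds the energy of the difference.\<close>

lemma approximation:
  assumes u: "u \<in> FR" and l: "admissible l" and e: "\<And>M. En M (pharm n l u) \<le> En n u + e"
  shows "En M (\<lambda>x. u x - pharm n l u x) \<le> 2 * Elim u - 2 * En n u + 2 * e"
proof -
  let ?v = "pharm n l u"
  have ut: "u \<in> FT" by (rule F_R_tilde[OF u])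
  have vt: "?v \<in> FT" by (rule pharm_F_tilde[OF l ut])
  have *: "En M (\<lambda>x. u x - ?v x) \<le> 2 * Elim u - 2 * En n u + 2 * e" if "n \<le> M" for M
  proof -
    have "En n (\<lambda>x. u x + ?v x) = 4 * En n u"
      using pharm_q_en_level[OF l, of n 1 u 1] pharm_d_en_below[OF l ut, of _ n 1 1]
      unfolding En_def s_en_def by (simp add: sum_distrib_left algebra_simps)
    moreover have "En n (\<lambda>x. u x + ?v x) \<le> En M (\<lambda>x. u x + ?v x)"
      by (rule incseqD[OF incseq_En[OF F_tilde_add[OF ut vt]] that])
    moreover have "x \<le> 2 * E - 2 * a + 2 * e" if "b = 4 * a" "b \<le> c" "c + x = 2 * y + 2 * z" "z \<le> a + e" "y \<le> E"
      for x E a b c y z :: real using that by linarith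
    ultimately show ?thesis
      using En_parallelogram[OF ut vt, of M] e[of M] En_le_Elim[OF u, of M] by blast
  qed
  have "En M (\<lambda>x. u x - ?v x) \<le> En (max n M) (\<lambda>x. u x - ?v x)"
    by (rule incseqD[OF incseq_En[OF F_tilde_diff[OF ut vt]]]) simp
  also have "\<dots> \<le> 2 * Elim u - 2 * En n u + 2 * e" by (rule *) simp
  finally show ?thesis .
qed

text \<open>Bridges below level \<open>n\<close> contribute as for \<open>u\<close>, that is
  \<open>En n u - q_en n u / cc n\<close>; everything else depends on \<open>u\<close> only through
  \<open>q_en n u\<close> and on \<open>l\<close> only through the products.\<close>

lemma En_pharm:
  assumes u: "u \<in> FT" and l: "admissible l"
  shows "En (n + j) (pharm n l u) = (\<Prod>k<j. 5 * l k)\<^sup>2 * q_en n u / cc (n + j) + (En n u - q_en n u / cc n)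
     + (\<Sum>k<j. ((\<Prod>i<k. 5 * l i) - (\<Prod>i<Suc k. 5 * l i))\<^sup>2 * q_en n u / (cc (n + k) - cc (Suc (n + k))))"
proof -
  have "(\<Sum>k<n + j. s_en k (pharm n l u)) = (\<Sum>k<n. s_en k (pharm n l u)) + (\<Sum>k<j. s_en (n + k) (pharm n l u))"
    by (induction j) simp_all
  moreover have "(\<Sum>k<n. s_en k (pharm n l u)) = En n u - q_en n u / cc n"
    using pharm_d_en_below[OF l u, of _ n 0 1] unfolding En_def s_en_def by simp
  moreover have "s_en (n + k) (pharm n l u) = ((\<Prod>i<k. 5 * l i) - (\<Prod>i<Suc k. 5 * l i))\<^sup>2 * q_en n u / (cc (n + k) - cc (Suc (n + k)))" for k
    unfolding s_en_def using pharm_d_en[OF l, of n k u] alpha_pos by simp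
  ultimately show ?thesis unfolding En_def[of "n + j"] pharm_q_en[OF l] by simp
qed

text \<open>Turns prescribed products into parameters. Where \<open>P k = 0\<close> the quotient is
  0 by convention, which is consistent since \<open>P\<close> then stays 0.\<close>

lemma ratio_admissible:
  fixes P :: "nat \<Rightarrow> real"
  assumes P: "P 0 = 1" "\<And>k. 0 \<le> P k" "\<And>k. P (Suc k) \<le> P k"
  defines "l \<equiv> \<lambda>k. P (Suc k) / P k / 5"
  shows "admissible l" "(\<Prod>k<j. 5 * l k) = P j"
proof -
  have "0 \<le> l k \<and> l k \<le> 1 / 5" for k
    using P(2)[of k] P(2)[of "Suc k"] P(3)[of k] unfolding l_def by (cases "P k = 0") (auto simp: field_simps)
  then show "admissible l" unfolding admissible_def using alpha_pos by simp
  show "(\<Prod>k<j. 5 * l k) = P j"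
  proof (induction j)
    case (Suc j)
    have "P (Suc j) = 0" if "P j = 0" using P(2)[of "Suc j"] P(3)[of j] that by simp
    then show ?case using Suc unfolding l_def by auto
  qed (simp add: P)
qed

text \<open>For \<open>Rs = 0\<close> the piecewise harmonic functions are taken with respect to the network in which all
  cells of level \<open>N\<close> are shorted; \<open>P k\<close> is the factor by which differences shrink, up to
  normalization, after \<open>k\<close> further levels.\<close>

lemma shorted_approximation:
  assumes R0: "Rs = 0" and u: "u \<in> FT" and e: "0 < e"
  obtains l N where "admissible l" "pharm n l u \<in> F_tilde_inf p \<alpha>" "\<And>M. En M (pharm n l u) \<le> En n u + e"
    "\<And>M. N \<le> M \<Longrightarrow> q_en M (pharm n l u) = 0"
proof -
  \<comment> \<open>\<open>q_en n u / (cc n - cc N)\<close> will be the energy of the extension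
    below level \<open>n\<close>; this limit is where \<open>Rs = 0\<close> enters.\<close>
  have "(\<lambda>N. q_en n u / (cc n - cc N)) \<longlonglongrightarrow> q_en n u / (cc n - 0)"
    using cc_tendsto cc_pos[of n] unfolding R0 by (intro tendsto_intros) auto
  then have "\<forall>\<^sub>F N in sequentially. q_en n u / (cc n - cc N) < q_en n u / cc n + e"
    using e by (intro order_tendstoD(2)) auto
  moreover have "\<forall>\<^sub>F N in sequentially. n < N" by (rule eventually_gt_at_top)
  ultimately have "\<forall>\<^sub>F N in sequentially. q_en n u / (cc n - cc N) < q_en n u / cc n + e \<and> n < N"
    by (rule eventually_conj)
  then obtain N where N: "q_en n u / (cc n - cc N) < q_en n u / cc n + e" "n < N"
    by (auto dest: eventually_happens)
  define D where "D = cc n - cc N"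
  have D: "0 < D" unfolding D_def using cc_strict[OF N(2)] by simp
  \<comment> \<open>The drop \<open>P k - P (Suc k)\<close> is proportional to the weight
    \<open>cc (n + k) - cc (Suc (n + k))\<close>, which makes the quadratic sum in
    \<open>En_pharm\<close> linear in the drops and therefore telescoping.\<close>
  define P where "P k = (if n + k \<le> N then (cc (n + k) - cc N) / D else 0)" for k
  have P0: "P 0 = 1" unfolding P_def using N(2) D by (simp add: D_def)
  have Pnn: "0 \<le> P k" for k
    unfolding P_def using decseqD[OF decseq_cc, of "n + k" N] D by simp
  have Pdec: "P (Suc k) \<le> P k" for k
    unfolding P_def using D cc_decreasing[of "n + k"] decseqD[OF decseq_cc, of "n + k" N]
    by (auto intro!: divide_right_mono)
  define l where "l k = P (Suc k) / P k / 5" for k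
  note l = ratio_admissible[of P, OF P0 Pnn Pdec, folded l_def]
  have PN: "P k = 0" if "N \<le> n + k" for k using that unfolding P_def by auto
  have sq: "(P k - P (Suc k))\<^sup>2 * q_en n u / (cc (n + k) - cc (Suc (n + k))) = (P k - P (Suc k)) * (q_en n u / D)" for k
  proof (cases "n + k < N")
    case True
    then have "P k - P (Suc k) = (cc (n + k) - cc (Suc (n + k))) / D"
      unfolding P_def by (simp add: diff_divide_distrib[symmetric])
    then show ?thesis using cc_diff_pos[of "n + k"] D by (simp add: power2_eq_square)
  next
    case False
    then show ?thesis using PN[of k] PN[of "Suc k"] by simp
  qed
  have tel: "(\<Sum>k<j. (P k - P (Suc k)) * (q_en n u / D)) = (1 - P j) * (q_en n u / D)" for j
    unfolding sum_distrib_right[symmetric] sum_lessThan_telescope' P0 ..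
  have En: "En (n + j) (pharm n l u) \<le> En n u + e" if "N \<le> n + j" for j
    unfolding En_pharm[OF u l(1)] l(2) sq tel PN[OF that] using N(1) unfolding D_def by simp
  have tilde: "pharm n l u \<in> FT" by (rule pharm_F_tilde[OF l(1) u])
  show ?thesis
  proof (rule that)
    show "admissible l" by (rule l(1))
    \<comment> \<open>\<open>P\<close> first vanishes at \<open>N - n\<close>, so the parameter
      before it is 0 and the cells of level \<open>n + Suc (N - n - 1) = N\<close> are
      shorted.\<close>
    have "l (N - n - 1) = 0" unfolding l_def using PN[of "Suc (N - n - 1)"] N(2) by simp
    from pharm_in_F_tilde_m[OF l(1) u this, of n] show "pharm n l u \<in> F_tilde_inf p \<alpha>"
      unfolding F_tilde_inf_def by (intro UN_I[of "n + Suc (N - n - 1)"]) simp_all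
    show "En M (pharm n l u) \<le> En n u + e" for M
    proof -
      have "En M (pharm n l u) \<le> En (n + (M + N)) (pharm n l u)"
        by (rule incseqD[OF incseq_En[OF tilde]]) simp
      also have "\<dots> \<le> En n u + e" by (rule En) simp
      finally show ?thesis .
    qed
    show "q_en M (pharm n l u) = 0" if "N \<le> M" for M
    proof -
      have "M = n + (M - n)" using that N(2) by simp
      then show ?thesis using pharm_q_en[OF l(1), of n "M - n" u] PN[of "M - n"] that unfolding l(2) by simp
    qed
  qed
qed

text \<open>All products equal 1, so new bridges carry nothing and only the weight of the cell
  energy changes, from \<open>1 / cc n\<close> to at most \<open>1 / Rs\<close>. Since
  \<open>cc n \<le> 1\<close>, that cell energy is at most \<open>Elim u\<close>.\<close>

lemma bridge_constant_approximation:
  assumes R0: "0 < Rs" and u: "u \<in> FR"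
  shows "En M (pharm n fifth u) \<le> En n u + Elim u * (1 / Rs - 1 / cc n)"
proof -
  have ut: "u \<in> FT" by (rule F_R_tilde[OF u])
  have "En M (pharm n fifth u) \<le> En (n + M) (pharm n fifth u)"
    by (rule incseqD[OF incseq_En[OF pharm_F_tilde[OF admissible_fifth ut]]]) simp
  also have "\<dots> = En n u + q_en n u * (1 / cc (n + M) - 1 / cc n)"
    unfolding En_pharm[OF ut admissible_fifth] by (simp add: algebra_simps)
  also have "q_en n u * (1 / cc (n + M) - 1 / cc n) \<le> Elim u * (1 / Rs - 1 / cc n)"
  proof (rule mult_mono)
    have "q_en n u \<le> q_en n u / cc n"
      using q_en_nonneg[of n u] cc_pos[of n] decseqD[OF decseq_cc, of 0 n] by (simp add: le_divide_eq mult_left_le)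
    also have "\<dots> \<le> Elim u" using q_cc_le_En En_le_Elim[OF u] order_trans by blast
    finally show "q_en n u \<le> Elim u" .
    then show "0 \<le> Elim u" using q_en_nonneg order_trans by blast
    show "1 / cc (n + M) - 1 / cc n \<le> 1 / Rs - 1 / cc n"
      using R0 R_star_le[of "n + M"] by (simp add: frac_le)
    show "0 \<le> 1 / cc (n + M) - 1 / cc n"
      using cc_pos decseqD[OF decseq_cc, of n "n + M"] by (simp add: frac_le)
  qed
  finally show ?thesis by simp
qed

text \<open>The parameters may change with \<open>n\<close>, because the closeness of
  \<open>pharm\<close> to \<open>u\<close> is uniform over all admissible sequences.\<close>

lemma pharm_tendsto:
  assumes "continuous_on K u" "\<And>n. admissible (l n)" "x \<in> K"
  shows "(\<lambda>n. pharm n (l n) u x) \<longlonglongrightarrow> u x"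
proof (rule LIMSEQ_I)
  fix e :: real assume "0 < e"
  then have "0 < e / 2" by simp
  from pharm_uniformly_close[OF assms(1) this] obtain M
    where "\<And>m l x. M \<le> m \<Longrightarrow> admissible l \<Longrightarrow> x \<in> K \<Longrightarrow> \<bar>pharm m l u x - u x\<bar> \<le> e / 2" by blast
  then have "\<And>m. M \<le> m \<Longrightarrow> \<bar>pharm m (l m) u x - u x\<bar> \<le> e / 2" using assms by blast
  then have "\<And>m. M \<le> m \<Longrightarrow> norm (pharm m (l m) u x - u x) < e" using \<open>0 < e\<close> by force
  then show "\<exists>no. \<forall>n\<ge>no. norm (pharm n (l n) u x - u x) < e" by blast
qed

lemma DI_eta_quad_tendsto_0:
  assumes b: "b \<longlonglongrightarrow> 0" and "\<And>n m. En m (v n) \<le> b n"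
  shows "(\<lambda>n. DI_quad (v n)) \<longlonglongrightarrow> 0"
proof (rule tendsto_sandwich[OF always_eventually always_eventually tendsto_const])
  show "\<forall>n. 0 \<le> DI_quad (v n)" by simp
  show "\<forall>n. DI_quad (v n) \<le> ennreal ((1 - Rs) * b n)"
    using assms(2) sum_s_en_le_En order_trans by (intro allI DI_eta_quad_le) blast
  have "(\<lambda>n. ennreal ((1 - Rs) * b n)) \<longlonglongrightarrow> ennreal ((1 - Rs) * 0)"
    by (intro tendsto_ennrealI tendsto_intros b)
  then show "(\<lambda>n. ennreal ((1 - Rs) * b n)) \<longlonglongrightarrow> 0" by simp
qed

text \<open>The approximants lie in \<open>F_tilde_inf\<close> and converge in energy, which gives
  the membership. Since their cell energy is eventually zero, that of \<open>u\<close> is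
  asymptotically bounded by the energy of the difference, so in the limit only the bridges
  remain.\<close>

lemma F_R_shorted:
  assumes R0: "Rs = 0" and u: "u \<in> FR"
  shows "u \<in> F_eta p \<alpha> (eta R)" "Elim u = suminf (\<lambda>k. s_en k u)"
proof -
  have ut: "u \<in> FT" by (rule F_R_tilde[OF u])
  define e where "e n = inverse (real (Suc n))" for n
  have "\<forall>n. \<exists>l N. admissible l \<and> pharm n l u \<in> F_tilde_inf p \<alpha> \<and> (\<forall>M. En M (pharm n l u) \<le> En n u + e n)
      \<and> (\<forall>M\<ge>N. q_en M (pharm n l u) = 0)"
    using shorted_approximation[OF R0 ut, of "e _"] unfolding e_def by (metis inverse_positive_iff_positive of_nat_0_less_iff zero_less_Suc)
  then obtain l N where l: "\<And>n. admissible (l n)" and inf: "\<And>n. pharm n (l n) u \<in> F_tilde_inf p \<alpha>"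
    and En: "\<And>n M. En M (pharm n (l n) u) \<le> En n u + e n" and q0: "\<And>n M. N n \<le> M \<Longrightarrow> q_en M (pharm n (l n) u) = 0"
    by metis
  define b where "b n = 2 * Elim u - 2 * En n u + 2 * e n" for n
  have b: "b \<longlonglongrightarrow> 0"
  proof -
    have "b \<longlonglongrightarrow> 2 * Elim u - 2 * Elim u + 2 * 0"
      unfolding b_def e_def by (intro tendsto_intros En_tendsto u LIMSEQ_inverse_real_of_nat)
    then show ?thesis by simp
  qed
  have v: "En m (\<lambda>x. u x - pharm n (l n) u x) \<le> b n" for m n
    unfolding b_def by (rule approximation[OF u l En])
  show "u \<in> F_eta p \<alpha> (eta R)"
    unfolding F_eta_def
  proof (intro CollectI conjI exI[of _ "\<lambda>n. pharm n (l n) u"] allI ballI)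
    show "(\<lambda>n. DI_quad (\<lambda>x. u x - pharm n (l n) u x)) \<longlonglongrightarrow> 0"
      by (rule DI_eta_quad_tendsto_0[OF b v])
    show "(\<lambda>n. pharm n (l n) u x) \<longlonglongrightarrow> u x" if "x \<in> K" for x
      by (rule pharm_tendsto[OF F_tilde_continuous[OF ut] l that])
  qed (use ut inf DI_eta_quad_finite_F_R[OF u] in simp_all)
  have "(\<lambda>m. q_en m u / cc m) \<longlonglongrightarrow> 0"
  proof (rule LIMSEQ_I)
    fix r :: real assume "0 < r"
    then have "\<forall>\<^sub>F n in sequentially. b n < r / 2" using b by (intro order_tendstoD(2)) auto
    then obtain n where n: "b n < r / 2" by (auto dest: eventually_happens)
    have "norm (q_en m u / cc m - 0) < r" if "N n \<le> m" for m
    proof -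
      let ?v = "pharm n (l n) u"
      have "q_en m u \<le> 2 * q_en m ?v + 2 * q_en m (\<lambda>x. u x - ?v x)"
        using q_en_parallelogram[of m ?v "\<lambda>x. u x - ?v x"] q_en_nonneg[of m "\<lambda>x. ?v x - (u x - ?v x)"] by simp
      then have "q_en m u \<le> 2 * q_en m (\<lambda>x. u x - ?v x)" using q0[OF that] by simp
      then have "q_en m u / cc m \<le> 2 * q_en m (\<lambda>x. u x - ?v x) / cc m"
        using cc_pos[of m] by (intro divide_right_mono) auto
      also have "\<dots> \<le> 2 * b n"
        using q_cc_le_En[of m "\<lambda>x. u x - ?v x"] v[of m n] by simp
      finally show ?thesis using n q_cc_nonneg[of m u] by simp
    qed
    then show "\<exists>no. \<forall>m\<ge>no. norm (q_en m u / cc m - 0) < r" by blast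
  qed
  from tendsto_add[OF this summable_LIMSEQ[OF s_en_summable[OF u]]]
  have "(\<lambda>m. En m u) \<longlonglongrightarrow> suminf (\<lambda>k. s_en k u)" unfolding En_def by simp
  then show "Elim u = suminf (\<lambda>k. s_en k u)" by (rule LIMSEQ_unique[OF En_tendsto[OF u]])
qed

section \<open>The reverse inclusion for \<open>F_eta\<close>\<close>

lemma F_tilde_inf_q_en:
  assumes "v \<in> F_tilde_inf p \<alpha>"
  obtains N where "\<And>M. N \<le> M \<Longrightarrow> q_en M v = 0"
proof -
  obtain N where N: "v \<in> F_tilde_m p \<alpha> N" using assms unfolding F_tilde_inf_def by blast
  have "q_en M v = 0" if M: "N \<le> M" for M
  proof -
    have "Q0 p (v \<circ> gw w) (v \<circ> gw w) = 0" if w: "w \<in> words M" for w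
    proof -
      have "w \<in> words (N + (M - N))" using w M by simp
      then obtain w1 w2 where w12: "w = w1 @ w2" "w1 \<in> words N" "w2 \<in> words (M - N)"
        unfolding words_add by auto
      then obtain c where c: "\<And>x. x \<in> K \<Longrightarrow> v (gw w1 x) = c"
        using N unfolding F_tilde_m_def constant_on_def by blast
      have "(v \<circ> gw w) (p i) = c" if "i \<in> idx" for i
        using c[OF Gw_in_K[OF words_fin_mono[OF w12(3)] p_in_K[OF that]]] unfolding w12(1) comp_word_append by simp
      then show ?thesis unfolding Q0_eq by (simp add: idx_def)
    qed
    then show ?thesis unfolding q_en_def Q_Sigma_def by simp
  qed
  then show ?thesis by (rule that)
qed

text \<open>For fixed \<open>m\<close> only finitely many points enter \<open>q_en m\<close>, so
  pointwise convergence suffices.\<close>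

lemma q_en_tendsto_0:
  assumes "\<And>x. x \<in> K \<Longrightarrow> (\<lambda>n. v n x) \<longlonglongrightarrow> 0"
  shows "(\<lambda>n. q_en m (v n)) \<longlonglongrightarrow> 0"
proof -
  have pt: "(\<lambda>n. (v n \<circ> gw w) (p i)) \<longlonglongrightarrow> 0" if "w \<in> words m" "i \<in> idx" for w i
    using assms[OF Gw_in_K[OF words_fin_mono[OF that(1)] p_in_K[OF that(2)]]] by simp
  have i: "1 \<in> idx" "2 \<in> idx" "3 \<in> idx" by (simp_all add: idx_def)
  have "(\<lambda>n. q_en m (v n)) \<longlonglongrightarrow> (5 / 3) ^ m * (\<Sum>w\<in>words m. (0 - 0)\<^sup>2 + (0 - 0)\<^sup>2 + (0 - 0)\<^sup>2)"
    unfolding q_en_def Q_Sigma_def Q0_eq by (intro tendsto_intros pt i)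
  then show ?thesis by simp
qed

text \<open>For each \<open>m\<close> an approximant is chosen that is close in bridge energy and at
  the finitely many vertices of level \<open>m\<close>. Its energy at level \<open>m\<close> is at
  most that at a level where its cell energy has vanished, hence is a pure bridge energy. The
  approximant depends on \<open>m\<close>, the resulting bound does not.\<close>

lemma F_eta_subset: "F_eta p \<alpha> (eta R) \<subseteq> FR"
proof
  fix u assume "u \<in> F_eta p \<alpha> (eta R)"
  then obtain us where ut: "u \<in> FT" and fin: "DI_quad u < \<infinity>"
    and us: "\<And>n. us n \<in> F_tilde_inf p \<alpha>"
    and D: "(\<lambda>n. DI_quad (\<lambda>x. u x - us n x)) \<longlonglongrightarrow> 0"
    and pt: "\<And>x. x \<in> K \<Longrightarrow> (\<lambda>n. us n x) \<longlonglongrightarrow> u x"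
    unfolding F_eta_def by blast
  have ust: "us n \<in> FT" for n using us[of n] unfolding F_tilde_inf_def F_tilde_m_def by blast
  define S where "S = suminf (\<lambda>k. s_en k u)"
  have S: "(\<Sum>k<m. s_en k u) \<le> S" for m
    unfolding S_def using s_en_nonneg by (intro sum_le_suminf summable_DI_eta_quad fin) auto
  show "u \<in> FR"
  proof (rule F_R_I[OF ut])
    fix m
    have "(\<lambda>n. u x - us n x) \<longlonglongrightarrow> 0" if "x \<in> K" for x
      using tendsto_diff[OF tendsto_const pt[OF that], of "u x"] by simp
    then have "(\<lambda>n. q_en m (\<lambda>x. u x - us n x)) \<longlonglongrightarrow> 0" by (rule q_en_tendsto_0)
    then
    have "\<forall>\<^sub>F n in sequentially. q_en m (\<lambda>x. u x - us n x) < cc m"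
      by (rule order_tendstoD(2)) (rule cc_pos)
    moreover have "\<forall>\<^sub>F n in sequentially. DI_quad (\<lambda>x. u x - us n x) < ennreal ((1 - Rs) * 1)"
      using D R_star_less_1 by (intro order_tendstoD(2)) auto
    ultimately have "\<forall>\<^sub>F n in sequentially. q_en m (\<lambda>x. u x - us n x) < cc m \<and> DI_quad (\<lambda>x. u x - us n x) < ennreal ((1 - Rs) * 1)"
      by (rule eventually_conj)
    then obtain n where n: "q_en m (\<lambda>x. u x - us n x) < cc m"
      "DI_quad (\<lambda>x. u x - us n x) < ennreal ((1 - Rs) * 1)"
      by (auto dest: eventually_happens)
    let ?v = "us n"
    \<comment> \<open>\<open>DI_quad\<close> is \<open>1 - Rs\<close> times the sum of the
      \<open>s_en\<close>, so the threshold above amounts to bridge energy at most 1.\<close>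
    have d: "(\<Sum>k<M. s_en k (\<lambda>x. u x - ?v x)) \<le> 1" for M
      by (rule sum_s_en_le_DI_eta_quad[OF less_imp_le[OF n(2)]]) simp
    obtain N where N: "\<And>M. N \<le> M \<Longrightarrow> q_en M ?v = 0" using F_tilde_inf_q_en[OF us] by blast
    have "s_en k ?v \<le> 2 * s_en k u + 2 * s_en k (\<lambda>x. u x - ?v x)" for k
      using s_en_parallelogram[OF ut F_tilde_diff[OF ut ust], of k n] s_en_nonneg[of k "\<lambda>x. u x + (u x - ?v x)"] by simp
    then have "(\<Sum>k<M. s_en k ?v) \<le> (\<Sum>k<M. 2 * s_en k u + 2 * s_en k (\<lambda>x. u x - ?v x))" for M
      by (intro sum_mono)
    then have sv: "(\<Sum>k<M. s_en k ?v) \<le> 2 * S + 2" for M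
      using S[of M] d[of M] unfolding sum.distrib sum_distrib_left[symmetric] by (smt (verit))
    have "En m ?v \<le> En (max m N) ?v" by (rule incseqD[OF incseq_En[OF ust]]) simp
    also have "\<dots> \<le> 2 * S + 2" unfolding En_def using N[of "max m N"] sv[of "max m N"] by simp
    finally have "En m ?v \<le> 2 * S + 2" .
    moreover have "En m (\<lambda>x. u x - ?v x) \<le> 2"
    proof -
      have "q_en m (\<lambda>x. u x - ?v x) / cc m \<le> 1" using n(1) cc_pos[of m] by simp
      then show ?thesis unfolding En_def using d[of m] by simp
    qed
    \<comment> \<open>\<open>4 * S + 8\<close> is \<open>2 * (2 * S + 2) + 2 * 2\<close>.\<close>
    ultimately show "En m u \<le> 4 * S + 8"
      using En_sum_le[OF ut ust, of m n] by linarith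
  qed
qed

section \<open>The case of positive limit\<close>

text \<open>\<open>q_en m\<close> is \<open>cc m\<close> times the difference of \<open>En m\<close>
  and the bridge sum, and all three converge on \<open>FR\<close>. As \<open>FR\<close> is closed
  under differences, this also puts the differences needed below into
  \<open>F_Sigma\<close>.\<close>

lemma E_star_quad_F_R:
  assumes R0: "0 < Rs" and u: "u \<in> FR"
  shows "(\<lambda>m. q_en m u) \<longlonglongrightarrow> Rs * (Elim u - suminf (\<lambda>k. s_en k u))"
    and "E_star_quad p \<alpha> u = Rs * (Elim u - suminf (\<lambda>k. s_en k u))"
    and "u \<in> F_Sigma p \<alpha>"
proof -
  have "(\<lambda>m. cc m * (En m u - (\<Sum>k<m. s_en k u))) \<longlonglongrightarrow> Rs * (Elim u - suminf (\<lambda>k. s_en k u))"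
    by (intro tendsto_intros cc_tendsto En_tendsto u summable_LIMSEQ s_en_summable)
  moreover have "cc m * (En m u - (\<Sum>k<m. s_en k u)) = q_en m u" for m
    unfolding En_def using cc_pos[of m] by simp
  ultimately show L: "(\<lambda>m. q_en m u) \<longlonglongrightarrow> Rs * (Elim u - suminf (\<lambda>k. s_en k u))" by simp
  then show "E_star_quad p \<alpha> u = Rs * (Elim u - suminf (\<lambda>k. s_en k u))"
    unfolding E_star_quad_def q_en_def by (rule limI)
  show "u \<in> F_Sigma p \<alpha>"
    using LIMSEQ_imp_Cauchy[OF L] F_tilde_continuous[OF F_R_tilde[OF u]] unfolding F_Sigma_def q_en_def by simp
qed

lemma E_star_diag:
  assumes R0: "0 < Rs" and u: "u \<in> FR"
  shows "E_star p \<alpha> u u = E_star_quad p \<alpha> u"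
proof -
  have q: "q_en m (\<lambda>x. u x + u x) = 4 * q_en m u" "q_en m (\<lambda>x. u x - u x) = 0" for m
    unfolding q_en_def using Q_Sigma_lincomb[of p \<alpha> m 1 u 1 u] Q_Sigma_lincomb[of p \<alpha> m 1 u "-1" u] by simp_all
  have e: "E_star_quad p \<alpha> w = lim (\<lambda>m. q_en m w)" for w unfolding E_star_quad_def q_en_def ..
  have "E_star_quad p \<alpha> (\<lambda>x. u x + u x) = lim (\<lambda>m. 4 * q_en m u)" "E_star_quad p \<alpha> (\<lambda>x. u x - u x) = lim (\<lambda>m. 0)"
    unfolding e q by (rule refl)+
  moreover have "lim (\<lambda>m. 4 * q_en m u) = 4 * E_star_quad p \<alpha> u"
    unfolding E_star_quad_F_R(2)[OF assms] by (intro limI tendsto_intros E_star_quad_F_R(1)[OF assms])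
  ultimately show ?thesis unfolding E_star_def by simp
qed

text \<open>One bound \<open>b n\<close> on the energy of the difference controls both parts: its
  limit energy dominates \<open>E_star\<close> divided by \<open>Rs\<close> as well as the bridge
  sum.\<close>

lemma F_R_subset_F_eta_star:
  assumes R0: "0 < Rs" and u: "u \<in> FR"
  shows "u \<in> F_eta_star p \<alpha> (eta R)"
proof -
  have ut: "u \<in> FT" by (rule F_R_tilde[OF u])
  define us where "us n = pharm n fifth u" for n
  define e where "e n = Elim u * (1 / Rs - 1 / cc n)" for n
  define b where "b n = 2 * Elim u - 2 * En n u + 2 * e n" for n
  have b: "b \<longlonglongrightarrow> 0"
  proof -
    have "b \<longlonglongrightarrow> 2 * Elim u - 2 * Elim u + 2 * (Elim u * (1 / Rs - 1 / Rs))"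
      unfolding b_def e_def using R0 by (intro tendsto_intros En_tendsto u cc_tendsto) auto
    then show ?thesis by simp
  qed
  let ?w = "\<lambda>n x. u x - us n x"
  have v: "En m (?w n) \<le> b n" for m n
    unfolding b_def e_def us_def
    by (rule approximation[OF u admissible_fifth bridge_constant_approximation[OF R0 u]])
  have ust: "us n \<in> FT" for n unfolding us_def by (rule pharm_F_tilde[OF admissible_fifth ut])
  have vR: "(?w n) \<in> FR" for n
    by (rule F_R_I[OF F_tilde_diff[OF ut ust] v])
  \<comment> \<open>The union defining \<open>F_star_inf\<close> starts at level 1, hence the
    shifted sequence of approximants.\<close>
  have mem: "us (Suc n) \<in> F_star_inf p \<alpha>" for n
  proof -
    have "us (Suc n) \<in> F_star_m p \<alpha> (Suc n)"
      unfolding us_def by (rule pharm_in_F_star[OF _ ut]) (use alpha_pos in simp)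
    moreover have "Suc n \<in> {1..}" by simp
    ultimately show ?thesis unfolding F_star_inf_def by blast
  qed
  have E: "E_star p \<alpha> (?w n) (?w n) = Rs * (Elim (?w n) - suminf (\<lambda>k. s_en k (?w n)))" for n
    unfolding E_star_diag[OF R0 vR] by (rule E_star_quad_F_R(2)[OF R0 vR])
  have E0: "(\<lambda>n. E_star p \<alpha> (?w n) (?w n)) \<longlonglongrightarrow> 0"
  proof (rule tendsto_sandwich[OF always_eventually always_eventually tendsto_const])
    show "\<forall>n. 0 \<le> E_star p \<alpha> (?w n) (?w n)"
      unfolding E using LIMSEQ_le_const[OF E_star_quad_F_R(1)[OF R0 vR]] q_en_nonneg by blast
    show "\<forall>n. E_star p \<alpha> (?w n) (?w n) \<le> Rs * b n"
    proof
      fix n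
      have "Elim (?w n) \<le> b n"
        using LIMSEQ_le_const2[OF En_tendsto[OF vR]] v by blast
      moreover have "0 \<le> suminf (\<lambda>k. s_en k (?w n))"
        by (rule suminf_nonneg[OF s_en_summable[OF vR] s_en_nonneg])
      ultimately show "E_star p \<alpha> (?w n) (?w n) \<le> Rs * b n"
        unfolding E using R0 by (intro mult_left_mono) auto
    qed
    show "(\<lambda>n. Rs * b n) \<longlonglongrightarrow> 0" by (rule tendsto_mult_right_zero[OF b])
  qed
  show ?thesis
    unfolding F_eta_star_def
  proof (intro CollectI conjI exI[of _ "\<lambda>n. us (Suc n)"] allI ballI)
    show "u \<in> FT \<inter> F_Sigma p \<alpha>" using ut E_star_quad_F_R(3)[OF R0 u] by simp
    show "DI_quad u < \<infinity>" by (rule DI_eta_quad_finite_F_R[OF u])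
    show "us (Suc n) \<in> F_star_inf p \<alpha>" for n by (rule mem)
    show "(?w (Suc n)) \<in> F_Sigma p \<alpha>" for n by (rule E_star_quad_F_R(3)[OF R0 vR])
    show "(\<lambda>n. E_star p \<alpha> (?w (Suc n)) (?w (Suc n))) \<longlonglongrightarrow> 0"
      by (rule LIMSEQ_Suc[OF E0])
    show "(\<lambda>n. DI_quad (?w (Suc n))) \<longlonglongrightarrow> 0"
      by (rule LIMSEQ_Suc[OF DI_eta_quad_tendsto_0[OF b v]])
    show "(\<lambda>n. us (Suc n) x) \<longlonglongrightarrow> u x" if "x \<in> K" for x
      unfolding us_def
      by (rule LIMSEQ_Suc[OF pharm_tendsto[OF F_tilde_continuous[OF ut] admissible_fifth that]])
  qed
qed

text \<open>Membership in \<open>F_Sigma\<close> makes the cell energies converge, and finiteness of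
  \<open>DI_quad\<close> the bridge sums; a positive limit of \<open>cc\<close> permits the
  division.\<close>

lemma F_eta_star_subset:
  assumes R0: "0 < Rs" shows "F_eta_star p \<alpha> (eta R) \<subseteq> FR"
proof
  fix u assume "u \<in> F_eta_star p \<alpha> (eta R)"
  then have ut: "u \<in> FT" and S: "u \<in> F_Sigma p \<alpha>" and fin: "DI_quad u < \<infinity>"
    unfolding F_eta_star_def by auto
  have "convergent (\<lambda>m. q_en m u)" using S unfolding F_Sigma_def q_en_def by (simp add: Cauchy_convergent)
  moreover have "convergent cc" using cc_tendsto unfolding convergent_def by blast
  ultimately have "convergent (\<lambda>m. q_en m u / cc m)"
    using cc_tendsto R0 unfolding convergent_def by (metis tendsto_divide less_irrefl)
  moreover have "convergent (\<lambda>m. \<Sum>k<m. s_en k u)"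
    using summable_DI_eta_quad[OF fin] by (simp add: summable_iff_convergent)
  ultimately have "convergent (\<lambda>m. En m u)" unfolding En_def by (rule convergent_add)
  then show "u \<in> FR" unfolding F_R_iff using ut by simp
qed

section \<open>The two formulas for the limit form\<close>

lemma E_R_shorted:
  assumes R0: "Rs = 0" and uv: "u \<in> FR" "v \<in> FR"
  shows "E_R p \<alpha> R u v = DI_eta p \<alpha> (eta R) u v"
  unfolding E_R_polar[OF uv] DI_eta_polar[OF uv] F_R_shorted(2)[OF R0 F_R_add[OF uv]]
    F_R_shorted(2)[OF R0 F_R_diff[OF uv]] R0 by simp

lemma E_R_decomposition:
  assumes R0: "0 < Rs" and uv: "u \<in> FR" "v \<in> FR"
  shows "E_R p \<alpha> R u v = 1 / Rs * E_star p \<alpha> u v + 1 / (1 - Rs) * DI_eta p \<alpha> (eta R) u v"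
  unfolding E_R_polar[OF uv] DI_eta_polar[OF uv] E_star_def E_star_quad_F_R(2)[OF R0 F_R_add[OF uv]]
    E_star_quad_F_R(2)[OF R0 F_R_diff[OF uv]]
  using R0 R_star_less_1 by (simp add: field_simps)

end

theorem theorem11p1:
  fixes p :: "nat \<Rightarrow> real^2" and \<alpha> :: real and R :: "nat \<Rightarrow> real \<times> real"
  assumes "regular_triangle p"
    and "0 < \<alpha>" and "\<alpha> < 1"
    and "\<And>m. m \<ge> 1 \<Longrightarrow> R m \<in> MP"
  shows "(\<not> summable (\<lambda>m. snd (R (Suc m))) \<longrightarrow>
            R_star R = 0 \<and>
            F_R p \<alpha> R = F_eta p \<alpha> (eta R) \<and>
            (\<forall>u\<in>F_R p \<alpha> R. \<forall>v\<in>F_R p \<alpha> R. E_R p \<alpha> R u v = DI_eta p \<alpha> (eta R) u v)) \<and>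
         (summable (\<lambda>m. snd (R (Suc m))) \<longrightarrow>
            0 < R_star R \<and> R_star R < 1 \<and>
            F_R p \<alpha> R = F_eta_star p \<alpha> (eta R) \<and>
            (\<forall>u\<in>F_R p \<alpha> R. \<forall>v\<in>F_R p \<alpha> R.
               E_R p \<alpha> R u v =
                 1 / R_star R * E_star p \<alpha> u v + 1 / (1 - R_star R) * DI_eta p \<alpha> (eta R) u v))"
proof -
  interpret matched_gasket p \<alpha> R
    using assms by unfold_locales auto
  have rho: "(\<lambda>m. snd (R (Suc m))) = rho" unfolding rho_def ..
  have eq1: "F_R p \<alpha> R = F_eta p \<alpha> (eta R)" if "R_star R = 0"
    using F_R_shorted(1)[OF that] F_eta_subset by (intro subset_antisym subsetI) blast+
  have eq2: "F_R p \<alpha> R = F_eta_star p \<alpha> (eta R)" if "0 < R_star R"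
    using F_R_subset_F_eta_star[OF that] F_eta_star_subset[OF that] by (intro subset_antisym subsetI) blast+
  show ?thesis
    unfolding rho
  proof (intro conjI impI ballI)
    assume n: "\<not> summable rho"
    show R0: "R_star R = 0" by (rule R_star_0[OF n])
    show "F_R p \<alpha> R = F_eta p \<alpha> (eta R)" by (rule eq1[OF R0])
    fix u v assume "u \<in> F_R p \<alpha> R" "v \<in> F_R p \<alpha> R"
    then show "E_R p \<alpha> R u v = DI_eta p \<alpha> (eta R) u v" by (rule E_R_shorted[OF R0])
  next
    assume s: "summable rho"
    show R0: "0 < R_star R" by (rule R_star_pos[OF s])
    show "R_star R < 1" by (rule R_star_less_1)
    show "F_R p \<alpha> R = F_eta_star p \<alpha> (eta R)" by (rule eq2[OF R0])
    fix u v assume "u \<in> F_R p \<alpha> R" "v \<in> F_R p \<alpha> R"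
    then show "E_R p \<alpha> R u v = 1 / R_star R * E_star p \<alpha> u v + 1 / (1 - R_star R) * DI_eta p \<alpha> (eta R) u v"
      by (rule E_R_decomposition[OF R0])
  qed
qed

end
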